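(* Let $g:\mathbb{R}\to\mathbb{R}$ be a function of class $C^4$ with $g,g',g''\in L^1(\mathbb{R})$, and let $X$, $X_M$ ($M>0$) be the shot noise process and truncated shot noise processes with kernel $g$ and impulse $\beta=1$ a.s. Let $T>0$, $a\le b$, and assume that for all $s\in[-T+a,T+b]$ the matrices $$\Phi(s)=\begin{pmatrix}g'(s)&g''(s)\\ g''(s)&g^{(3)}(s)\end{pmatrix}\quad\text{and}\quad \Phi'(s)=\begin{pmatrix}g''(s)&g^{(3)}(s)\\ g^{(3)}(s)&g^{(4)}(s)\end{pmatrix}$$ are invertible. Then, for every integer $k_0\ge 8$ and every $M\ge T$, the conditional mean number of crossings function $$\alpha\mapsto\mathbb{E}\bigl(N_{X_M}(\alpha,[a,b])\mid\gamma_T\ge k_0\bigr)$$ is continuous on $\mathbb{R}$. Moreover, $$\mathbb{E}\bigl(N_{X_M}(\alpha,[a,b])\mid\gamma_T\ge k_0\bigr)\longrightarrow\mathbb{E}\bigl(N_{X}(\alpha,[a,b])\mid\gamma_T\ge k_0\bigr)\quad\text{as }M\to+\infty,$$ uniformly in $\alpha\in\mathbb{R}$.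
   Context: Let $\lambda>0$ and let $\{\tau_i\}$ be the points of a homogeneous Poisson point process on $\mathbb{R}$ of intensity $\lambda\,ds$. With impulse $\beta=1$, the shot noise process is $X(t)=\sum_i g(t-\tau_i)$, $t\in\mathbb{R}$, and for $M>0$ the truncated process is $X_M(t)=\sum_{|\tau_i|\le M}g(t-\tau_i)$ (i.e. the Poisson process is restricted to $[-M,M]$). $\gamma_T=\#\{i:\tau_i\in[-T,T]\}$. For a process $Y$, $N_Y(\alpha,[a,b])=\#\{t\in[a,b]:Y(t)=\alpha\}$. *)

theory Defs
  imports "HOL-Probability.Probability"
begin

definition class_C :: "nat \<Rightarrow> (real \<Rightarrow> real) \<Rightarrow> bool" where
  "class_C n f \<longleftrightarrow>
     (\<forall>j<n. \<forall>x. (deriv ^^ j) f differentiable at x) \<and> continuous_on UNIV ((deriv ^^ n) f)"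

text \<open>
  Points are counted with multiplicity. As \<open>card\<close> of an infinite set is 0, almost sure finiteness
  of the counts is required separately in the definition of the Poisson process below.
\<close>

definition point_count :: "('i \<Rightarrow> 'w \<Rightarrow> real) \<Rightarrow> real set \<Rightarrow> 'w \<Rightarrow> nat" where
  "point_count \<tau> A \<omega> = card {i. \<tau> i \<omega> \<in> A}"

text \<open>
  The points are listed by an arbitrary countable index type, in no particular order. The
  Poisson probabilities are written out because \<open>poisson_pmf\<close> is only specified for a
  positive rate, whereas here \<open>A\<close> may be a null set (with the convention \<open>0 ^ 0 = 1\<close>).
\<close>

locale homogeneous_poisson_process = prob_space P
  for P :: "'w measure" and rate :: real and \<tau> :: "'i::countable \<Rightarrow> 'w \<Rightarrow> real" +
  assumes rate_pos: "rate > 0"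
    and random_points: "\<And>i. \<tau> i \<in> borel_measurable P"
    and finite_count: "\<And>A. A \<in> sets borel \<Longrightarrow> emeasure lborel A < \<infinity> \<Longrightarrow>
          AE \<omega> in P. finite {i. \<tau> i \<omega> \<in> A}"
    and poisson_count: "\<And>A k. A \<in> sets borel \<Longrightarrow> emeasure lborel A < \<infinity> \<Longrightarrow>
          prob {\<omega> \<in> space P. point_count \<tau> A \<omega> = k} =
            (rate * measure lborel A) ^ k / fact k * exp (- (rate * measure lborel A))"
    and indep_counts: "\<And>(A :: nat \<Rightarrow> real set) n.
          (\<And>j. j < n \<Longrightarrow> A j \<in> sets borel \<and> emeasure lborel (A j) < \<infinity>) \<Longrightarrow>
          disjoint_family_on A {..<n} \<Longrightarrow>
          indep_vars (\<lambda>_. count_space UNIV) (\<lambda>j. point_count \<tau> (A j)) {..<n}"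

definition shot_noise :: "(real \<Rightarrow> real) \<Rightarrow> ('i \<Rightarrow> 'w \<Rightarrow> real) \<Rightarrow> 'w \<Rightarrow> real \<Rightarrow> real" where
  "shot_noise g \<tau> \<omega> t = (\<Sum>\<^sub>\<infinity>i. g (t - \<tau> i \<omega>))"

definition truncated_shot_noise ::
    "(real \<Rightarrow> real) \<Rightarrow> ('i \<Rightarrow> 'w \<Rightarrow> real) \<Rightarrow> real \<Rightarrow> 'w \<Rightarrow> real \<Rightarrow> real" where
  "truncated_shot_noise g \<tau> M \<omega> t = (\<Sum>\<^sub>\<infinity>i \<in> {i. \<bar>\<tau> i \<omega>\<bar> \<le> M}. g (t - \<tau> i \<omega>))"

text \<open>The number of crossings may be infinite.\<close>

definition crossings :: "(real \<Rightarrow> real) \<Rightarrow> real \<Rightarrow> real set \<Rightarrow> ennreal" where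
  "crossings f \<alpha> S = emeasure (count_space UNIV) {t \<in> S. f t = \<alpha>}"

definition cond_nn_expectation :: "'w measure \<Rightarrow> ('w \<Rightarrow> ennreal) \<Rightarrow> 'w set \<Rightarrow> ennreal" where
  "cond_nn_expectation P Z A = (\<integral>\<^sup>+\<omega>. Z \<omega> * indicator A \<omega> \<partial>P) / emeasure P A"

definition \<Phi> :: "(real \<Rightarrow> real) \<Rightarrow> real \<Rightarrow> real^2^2" where
  "\<Phi> g s = vector [vector [deriv g s, (deriv ^^ 2) g s],
                   vector [(deriv ^^ 2) g s, (deriv ^^ 3) g s]]"

definition \<Phi>' :: "(real \<Rightarrow> real) \<Rightarrow> real \<Rightarrow> real^2^2" where
  "\<Phi>' g s = vector [vector [(deriv ^^ 2) g s, (deriv ^^ 3) g s],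
                    vector [(deriv ^^ 3) g s, (deriv ^^ 4) g s]]"

end

theory Submission
  imports Defs
begin

text \<open>
  No Fourier analysis is needed: everything rests on one concentration estimate. On the event that
  many points fall in \<open>[-T, T]\<close>, the probability that \<open>\<bar>X(t) - \<alpha>\<bar> \<le> \<Sum>\<^sub>i b(\<tau>\<^sub>i)\<close> is at most a constant times
  \<open>sup b\<close> over \<open>[-T, T]\<close> plus \<open>\<integral> b\<close> outside, uniformly in \<open>\<alpha>\<close>, \<open>t\<close> and the truncation. To see this, split the
  event according to a point \<open>\<tau>\<^sub>i\<close> of \<open>[-T, T]\<close> chosen with probability proportional to \<open>\<bar>g'(t - \<tau>\<^sub>i)\<bar>\<close> and apply
  the Mecke formula to that point: the weight \<open>\<bar>g'\<bar>\<close> is the Jacobian that makes \<open>g(t - \<tau>\<^sub>i)\<close> spread out,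
  and what remains is the expectation of \<open>1 / \<Sum>\<^sub>j \<bar>g'(t - \<tau>\<^sub>j)\<bar>\<close>, which is finite because \<open>g'\<close> has only simple
  zeros on \<open>[a - T, b + T]\<close> (this is where \<open>\<Phi>\<close> is used). The Mecke formula is only needed for step
  functions, that is, for finitely many independent Poisson counts.

  Next, count sign changes of \<open>X - \<alpha>\<close> along the dyadic grid of mesh \<open>h = (b - a) / 2^m\<close>. A cell in which
  this count misses a crossing, or gains one on halving, has a grid point where \<open>\<bar>X - \<alpha>\<bar>\<close> is below the
  linear interpolation error, which is at most \<open>h \<integral> \<bar>X''\<bar>\<close> over the cell. By concentration such a cell has
  probability \<open>O(h^2)\<close>, so the expected number of sign changes is within \<open>O(h)\<close> of the expected number
  of crossings, uniformly in \<open>\<alpha>\<close> and in the truncation. For fixed \<open>m\<close> the expected number of sign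
  changes is Lipschitz in \<open>\<alpha>\<close> and converges uniformly as \<open>M \<rightarrow> \<infinity>\<close>, again by concentration.
\<close>

section \<open>Level sets of functions with simple critical points\<close>

text \<open>The obstacle is the critical points of \<open>g\<close>, where the values
  \<open>g (t - \<tau>)\<close> pile up. The weight \<open>\<bar>g'\<bar>\<close> cures this at the
  price of a reciprocal of the total weight, and for a single point that reciprocal is
  \<open>1 / \<bar>g'\<bar>\<close>, which diverges logarithmically at a simple zero. Two points
  repair it: by the inequality of arithmetic and geometric means \<open>1 / (x + y)\<close> is at
  most \<open>1 / (sqrt x * sqrt y)\<close>, a product of factors that are integrable at simple
  zeros. So the estimate spends three points of the window, one to spread out the sum and two to
  tame the denominator. The tolerance is a sum over points because interpolation and truncation
  errors are such sums; a fixed tolerance is dominated by one with the help of a bump equal to 1 on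
  the window. Inside the window the tolerance is paid for by its supremum, since its points also
  enter the denominator; outside, independence of the window makes its mean suffice. Strict
  inequalities are treated before weak ones because they survive discretisation and the limit of
  growing windows.\<close>

lemma nn_integral_monotone_substitution_le:
  fixes F f \<psi> :: "real \<Rightarrow> real"
  assumes deriv: "\<And>x. (F has_real_derivative f x) (at x)"
    and cont: "continuous_on {l..r} f"
    and sgn: "(\<forall>x\<in>{l..r}. f x \<ge> 0) \<or> (\<forall>x\<in>{l..r}. f x \<le> 0)"
    and [measurable]: "\<psi> \<in> borel_measurable borel" and nonneg: "\<And>z. \<psi> z \<ge> 0"
  shows "(\<integral>\<^sup>+y. ennreal (\<psi> (F y) * \<bar>f y\<bar>) * indicator {l..r} y \<partial>lborel) \<le> (\<integral>\<^sup>+z. \<psi> z \<partial>lborel)"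
proof (cases "l \<le> r")
  case True
  have *: "(\<integral>\<^sup>+y. ennreal (\<phi> (H y) * \<bar>h y\<bar>) * indicator {l..r} y \<partial>lborel) \<le> (\<integral>\<^sup>+z. \<phi> z \<partial>lborel)"
    if H: "\<And>x. (H has_real_derivative h x) (at x)" and h: "continuous_on {l..r} h"
      and pos: "\<forall>x\<in>{l..r}. h x \<ge> 0"
      and [measurable]: "\<phi> \<in> borel_measurable borel" and \<phi>: "\<And>z. \<phi> z \<ge> 0" for H h \<phi> :: "real \<Rightarrow> real"
  proof -
    have "(\<integral>\<^sup>+y. ennreal (\<phi> (H y) * \<bar>h y\<bar>) * indicator {l..r} y \<partial>lborel)
        = (\<integral>\<^sup>+y. ennreal (\<phi> (H y) * h y * indicator {l..r} y) \<partial>lborel)"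
      using pos by (intro nn_integral_cong) (auto split: split_indicator)
    also have "\<dots> = (\<integral>\<^sup>+z. ennreal (\<phi> z * indicator {H l..H r} z) \<partial>lborel)"
      using pos True by (intro nn_integral_substitution[symmetric] H h)
        (auto simp: set_borel_measurable_def)
    also have "\<dots> \<le> (\<integral>\<^sup>+z. \<phi> z \<partial>lborel)"
      using \<phi> by (intro nn_integral_mono) (auto split: split_indicator)
    finally show ?thesis .
  qed
  show ?thesis
    using sgn
  proof
    assume "\<forall>x\<in>{l..r}. f x \<ge> 0"
    then show ?thesis by (intro * deriv cont nonneg) auto
  next
    \<comment> \<open>The decreasing case is the increasing one for \<open>- F\<close> with
      \<open>\<psi>\<close> reflected.\<close>
    assume neg: "\<forall>x\<in>{l..r}. f x \<le> 0"
    have "(\<integral>\<^sup>+y. ennreal (\<psi> (F y) * \<bar>f y\<bar>) * indicator {l..r} y \<partial>lborel)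
        = (\<integral>\<^sup>+y. ennreal (\<psi> (- (- F y)) * \<bar>- f y\<bar>) * indicator {l..r} y \<partial>lborel)"
      by simp
    also have "\<dots> \<le> (\<integral>\<^sup>+z. \<psi> (- z) \<partial>lborel)"
      using neg by (intro * nonneg) (auto intro!: derivative_eq_intros deriv continuous_intros cont)
    also have "\<dots> = (\<integral>\<^sup>+z. \<psi> z \<partial>lborel)"
      using nn_integral_real_affine[of "\<lambda>z. ennreal (\<psi> z)" "-1" 0] by simp
    finally show ?thesis .
  qed
qed (auto simp: indicator_def)

lemma nn_integral_Icc_split_le:
  fixes h :: "real \<Rightarrow> ennreal"
  assumes [measurable]: "h \<in> borel_measurable borel"
    and "(\<integral>\<^sup>+y. h y * indicator {l..m} y \<partial>lborel) \<le> A" "(\<integral>\<^sup>+y. h y * indicator {m..r} y \<partial>lborel) \<le> B"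
  shows "(\<integral>\<^sup>+y. h y * indicator {l..r} y \<partial>lborel) \<le> A + B"
proof -
  have "(\<integral>\<^sup>+y. h y * indicator {l..r} y \<partial>lborel)
      \<le> (\<integral>\<^sup>+y. h y * indicator {l..m} y + h y * indicator {m..r} y \<partial>lborel)"
    by (intro nn_integral_mono) (auto split: split_indicator)
  also have "\<dots> = (\<integral>\<^sup>+y. h y * indicator {l..m} y \<partial>lborel) + (\<integral>\<^sup>+y. h y * indicator {m..r} y \<partial>lborel)"
    by (intro nn_integral_add) auto
  finally show ?thesis using add_mono[OF assms(2,3)] by (rule order_trans)
qed

text \<open>Near \<open>x\<close> only two things can happen: \<open>f\<close> stays away from 0, or
  \<open>x\<close> is a simple zero with linear growth and one sign on each side. The first
  conclusion serves integrals of \<open>1 / sqrt \<bar>f\<bar>\<close>, the second splits a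
  primitive of \<open>f\<close> into monotone pieces. The quantification over all short intervals
  around \<open>x\<close> is the local premise of the bisection principle.\<close>

lemma local_sign_pieces:
  fixes f f' :: "real \<Rightarrow> real"
  assumes deriv: "\<And>x. (f has_real_derivative f' x) (at x)" and cont: "continuous_on UNIV f'"
    and nz: "f x \<noteq> 0 \<or> f' x \<noteq> 0"
  obtains d where "d > 0"
    and "\<And>l r. l \<le> x \<Longrightarrow> x \<le> r \<Longrightarrow> r - l < d \<Longrightarrow>
           (\<exists>e>0. \<forall>y\<in>{l..r}. \<bar>f y\<bar> \<ge> e) \<or> (f x = 0 \<and> (\<exists>e>0. \<forall>y\<in>{l..r}. \<bar>f y\<bar> \<ge> e * \<bar>y - x\<bar>))"
    and "\<And>l r. l \<le> x \<Longrightarrow> x \<le> r \<Longrightarrow> r - l < d \<Longrightarrow>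
           ((\<forall>y\<in>{l..x}. f y \<ge> 0) \<or> (\<forall>y\<in>{l..x}. f y \<le> 0)) \<and>
           ((\<forall>y\<in>{x..r}. f y \<ge> 0) \<or> (\<forall>y\<in>{x..r}. f y \<le> 0))"
proof -
  have contf: "continuous_on UNIV f"
    using deriv by (rule DERIV_continuous_on)
  show thesis
  proof (cases "f x = 0")
    case False
    obtain d where d: "d > 0" "\<And>y. \<bar>y - x\<bar> < d \<Longrightarrow> \<bar>f y - f x\<bar> < \<bar>f x\<bar> / 2"
      using contf False unfolding continuous_on_iff dist_real_def
      by (metis UNIV_I half_gt_zero zero_less_abs_iff)
    have *: "\<bar>f y\<bar> \<ge> \<bar>f x\<bar> / 2 \<and> (f x > 0 \<longrightarrow> f y \<ge> 0) \<and> (f x < 0 \<longrightarrow> f y \<le> 0)"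
      if "l \<le> x" "x \<le> r" "r - l < d" "y \<in> {l..r}" for l r y
    proof -
      have "\<bar>y - x\<bar> < d" using that by auto
      from d(2)[OF this] show ?thesis by linarith
    qed
    show ?thesis
    proof (rule that[OF d(1)])
      fix l r assume lr: "l \<le> x" "x \<le> r" "r - l < d"
      show "(\<exists>e>0. \<forall>y\<in>{l..r}. \<bar>f y\<bar> \<ge> e) \<or> (f x = 0 \<and> (\<exists>e>0. \<forall>y\<in>{l..r}. \<bar>f y\<bar> \<ge> e * \<bar>y - x\<bar>))"
        using *[OF lr] False by (intro disjI1 exI[of _ "\<bar>f x\<bar> / 2"]) auto
      show "((\<forall>y\<in>{l..x}. f y \<ge> 0) \<or> (\<forall>y\<in>{l..x}. f y \<le> 0)) \<and>
           ((\<forall>y\<in>{x..r}. f y \<ge> 0) \<or> (\<forall>y\<in>{x..r}. f y \<le> 0))"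
        using *[OF lr] False lr by (cases "f x > 0") auto
    qed
  next
    case True
    with nz have nz': "f' x \<noteq> 0" by simp
    obtain d where d: "d > 0" "\<And>y. \<bar>y - x\<bar> < d \<Longrightarrow> \<bar>f' y - f' x\<bar> < \<bar>f' x\<bar> / 2"
      using cont nz' unfolding continuous_on_iff dist_real_def
      by (metis UNIV_I half_gt_zero zero_less_abs_iff)
    \<comment> \<open>The mean value theorem factors out the zero; the remaining factor
      \<open>f' z\<close> has the sign of \<open>f' x\<close> and at least half its size.\<close>
    have mvt: "\<exists>z. \<bar>z - x\<bar> < d \<and> f y = (y - x) * f' z" if "\<bar>y - x\<bar> < d" for y
    proof (cases y x rule: linorder_cases)
      case less
      from MVT2[OF less deriv] obtain z where "y < z" "z < x" "f x - f y = (x - y) * f' z" by blast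
      with that True less show ?thesis by (intro exI[of _ z]) (auto simp: algebra_simps)
    next
      case equal then show ?thesis using d True by (intro exI[of _ x]) auto
    next
      case greater
      from MVT2[OF greater deriv] obtain z where "x < z" "z < y" "f y - f x = (y - x) * f' z" by blast
      with that True greater show ?thesis by (intro exI[of _ z]) auto
    qed
    have *: "\<bar>f y\<bar> \<ge> \<bar>f' x\<bar> / 2 * \<bar>y - x\<bar> \<and> (f' x > 0 \<longrightarrow> (y \<ge> x \<longrightarrow> f y \<ge> 0) \<and> (y \<le> x \<longrightarrow> f y \<le> 0))
         \<and> (f' x < 0 \<longrightarrow> (y \<ge> x \<longrightarrow> f y \<le> 0) \<and> (y \<le> x \<longrightarrow> f y \<ge> 0))" if yd: "\<bar>y - x\<bar> < d" for y
    proof -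
      obtain z where z: "\<bar>z - x\<bar> < d" "f y = (y - x) * f' z" using mvt[OF yd] by blast
      have "\<bar>f' z\<bar> \<ge> \<bar>f' x\<bar> / 2" "f' x > 0 \<longrightarrow> f' z > 0" "f' x < 0 \<longrightarrow> f' z < 0"
        using d(2)[OF z(1)] by linarith+
      moreover have "\<bar>f y\<bar> \<ge> \<bar>f' x\<bar> / 2 * \<bar>y - x\<bar>"
        unfolding z(2) abs_mult using mult_right_mono[OF \<open>\<bar>f' z\<bar> \<ge> \<bar>f' x\<bar> / 2\<close>, of "\<bar>y - x\<bar>"]
        by (simp add: mult.commute)
      ultimately show ?thesis
        unfolding z(2)
        by (auto simp: mult_nonneg_nonneg mult_nonneg_nonpos mult_nonpos_nonneg mult_nonpos_nonpos)
    qed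
    show ?thesis
    proof (rule that[OF d(1)])
      fix l r assume lr: "l \<le> x" "x \<le> r" "r - l < d"
      have yd: "\<bar>y - x\<bar> < d" if "y \<in> {l..r}" for y using that lr by auto
      show "(\<exists>e>0. \<forall>y\<in>{l..r}. \<bar>f y\<bar> \<ge> e) \<or> (f x = 0 \<and> (\<exists>e>0. \<forall>y\<in>{l..r}. \<bar>f y\<bar> \<ge> e * \<bar>y - x\<bar>))"
        using * yd nz' True by (intro disjI2 conjI exI[of _ "\<bar>f' x\<bar> / 2"]) auto
      show "((\<forall>y\<in>{l..x}. f y \<ge> 0) \<or> (\<forall>y\<in>{l..x}. f y \<le> 0)) \<and>
           ((\<forall>y\<in>{x..r}. f y \<ge> 0) \<or> (\<forall>y\<in>{x..r}. f y \<le> 0))"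
        using *[OF yd] nz' lr by (cases "f' x > 0") auto
    qed
  qed
qed

text \<open>On a piece where \<open>f\<close> keeps its sign, the substitution
  \<open>z = F y\<close> with Jacobian \<open>\<bar>f\<bar>\<close> turns the integral into at most
  the length of the level interval, whatever its centre. Since \<open>f\<close> has only simple
  zeros in \<open>{l..r}\<close>, finitely many such pieces suffice, and \<open>C\<close> counts
  them.\<close>

lemma weighted_level_set_bound:
  fixes F f f' :: "real \<Rightarrow> real"
  assumes F: "\<And>x. (F has_real_derivative f x) (at x)"
    and f: "\<And>x. (f has_real_derivative f' x) (at x)" and cont: "continuous_on UNIV f'"
    and nz: "\<And>x. x \<in> {l..r} \<Longrightarrow> f x \<noteq> 0 \<or> f' x \<noteq> 0"
  shows "\<exists>C\<ge>0. \<forall>c. \<forall>\<rho>\<ge>0. (\<integral>\<^sup>+y. ennreal (indicator {c - \<rho><..<c + \<rho>} (F y) * \<bar>f y\<bar>) * indicator {l..r} y \<partial>lborel)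
           \<le> ennreal (C * \<rho>)"
proof (cases "l \<le> r")
  case True
  define I where "I c \<rho> u v = (\<integral>\<^sup>+y. ennreal (indicator {c - \<rho><..<c + \<rho>} (F y) * \<bar>f y\<bar>) * indicator {u..v} y \<partial>lborel)"
    for c \<rho> u v
  let ?h = "\<lambda>c \<rho> y. ennreal (indicator {c - \<rho><..<c + \<rho>} (F y) * \<bar>f y\<bar>)"
  have [measurable]: "F \<in> borel_measurable borel" "f \<in> borel_measurable borel"
    using F f by (auto intro!: borel_measurable_continuous_onI DERIV_continuous_on)
  have contf: "continuous_on {u..v} f" for u v
    using DERIV_continuous_on[OF f] by (rule continuous_on_subset) auto
  have mono: "I c \<rho> u v \<le> ennreal (2 * \<rho>)"
    if "(\<forall>y\<in>{u..v}. f y \<ge> 0) \<or> (\<forall>y\<in>{u..v}. f y \<le> 0)" "\<rho> \<ge> 0" for c \<rho> u v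
  proof -
    have "I c \<rho> u v \<le> (\<integral>\<^sup>+z. ennreal (indicator {c - \<rho><..<c + \<rho>} z) \<partial>lborel)"
      unfolding I_def by (intro nn_integral_monotone_substitution_le F contf that) auto
    also have "\<dots> = ennreal (2 * \<rho>)" using that(2) by (simp add: ennreal_indicator)
    finally show ?thesis .
  qed
  \<comment> \<open>Bisection replaces an explicit list of the zeros: the property passes to
    adjoining intervals by adding constants and holds on short intervals around every point.\<close>
  have "\<exists>C\<ge>0. \<forall>c. \<forall>\<rho>\<ge>0. I c \<rho> l r \<le> ennreal (C * \<rho>)"
  proof (induction rule: Bolzano[OF True])
    case (1 u v w)
    then obtain C C' where C: "C \<ge> 0" "C' \<ge> 0" "\<And>c \<rho>. \<rho> \<ge> 0 \<Longrightarrow> I c \<rho> u v \<le> ennreal (C * \<rho>)"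
      "\<And>c \<rho>. \<rho> \<ge> 0 \<Longrightarrow> I c \<rho> v w \<le> ennreal (C' * \<rho>)" by blast
    have "I c \<rho> u w \<le> ennreal ((C + C') * \<rho>)" if "\<rho> \<ge> 0" for c \<rho>
      using nn_integral_Icc_split_le[of "?h c \<rho>" u v
          "ennreal (C * \<rho>)" w "ennreal (C' * \<rho>)"] C that
      by (simp add: I_def distrib_right)
    then show ?case using C by (intro exI[of _ "C + C'"]) auto
  next
    case (2 x)
    then have "f x \<noteq> 0 \<or> f' x \<noteq> 0" using nz by auto
    from local_sign_pieces[OF f cont this] obtain d where "d > 0" and
      d: "\<And>l r. l \<le> x \<Longrightarrow> x \<le> r \<Longrightarrow> r - l < d \<Longrightarrow>
           ((\<forall>y\<in>{l..x}. f y \<ge> 0) \<or> (\<forall>y\<in>{l..x}. f y \<le> 0)) \<and>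
           ((\<forall>y\<in>{x..r}. f y \<ge> 0) \<or> (\<forall>y\<in>{x..r}. f y \<le> 0))" by metis
    \<comment> \<open>One monotone piece on each side of \<open>x\<close>, each contributing at most
      \<open>2 * \<rho>\<close>.\<close>
    have "I c \<rho> u v \<le> ennreal (4 * \<rho>)" if "u \<le> x" "x \<le> v" "v - u < d" "\<rho> \<ge> 0" for c \<rho> u v
      using nn_integral_Icc_split_le[of "?h c \<rho>" u x
          "ennreal (2 * \<rho>)" v "ennreal (2 * \<rho>)"] mono[of u x \<rho> c] mono[of x v \<rho> c] d[OF that(1-3)] that(4)
      by (simp add: I_def flip: ennreal_plus)
    then show ?case using \<open>d > 0\<close> by (intro exI[of _ d] conjI allI impI exI[of _ 4]) auto
  qed
  then show ?thesis by (simp add: I_def)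
qed (auto simp: indicator_def intro!: exI[of _ 0])

lemma nn_integral_rsqrt_le:
  fixes R \<epsilon> :: real
  assumes "R \<ge> 0" "0 < \<epsilon>"
  shows "(\<integral>\<^sup>+z. ennreal (1 / sqrt (\<bar>z\<bar> + \<epsilon>)) * indicator {-R..R} z \<partial>lborel) \<le> ennreal (4 * sqrt (R + \<epsilon>))"
proof -
  have right: "(\<integral>\<^sup>+z. ennreal (1 / sqrt (\<bar>z\<bar> + \<epsilon>)) * indicator {0..R} z \<partial>lborel) \<le> ennreal (2 * sqrt (R + \<epsilon>))"
  proof -
    have "(\<integral>\<^sup>+z. ennreal (1 / sqrt (\<bar>z\<bar> + \<epsilon>)) * indicator {0..R} z \<partial>lborel)
      = ennreal (2 * sqrt (R + \<epsilon>) - 2 * sqrt (0 + \<epsilon>))"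
      using assms
      by (intro nn_integral_FTC_Icc) (auto intro!: derivative_eq_intros simp: divide_simps has_real_derivative_iff_has_vector_derivative[symmetric])
    also have "\<dots> \<le> ennreal (2 * sqrt (R + \<epsilon>))" using assms by (intro ennreal_leI) auto
    finally show ?thesis .
  qed
  have "(\<integral>\<^sup>+z. ennreal (1 / sqrt (\<bar>z\<bar> + \<epsilon>)) * indicator {-R..0} z \<partial>lborel)
      = (\<integral>\<^sup>+z. ennreal (1 / sqrt (\<bar>z\<bar> + \<epsilon>)) * indicator {0..R} z \<partial>lborel)"
    by (subst nn_integral_real_affine[where c="-1" and t=0])
       (auto intro!: nn_integral_cong split: split_indicator)
  then show ?thesis
    using nn_integral_Icc_split_le[of "\<lambda>z. ennreal (1 / sqrt (\<bar>z\<bar> + \<epsilon>))" "-R" 0 "ennreal (2 * sqrt (R + \<epsilon>))" R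
        "ennreal (2 * sqrt (R + \<epsilon>))"] right assms
    by (simp flip: ennreal_plus)
qed

text \<open>At a simple zero the integrand is comparable to
  \<open>1 / sqrt \<bar>y - x\<bar>\<close>, which is integrable. The constant must not depend on
  \<epsilon>, because discretisation only provides weights of the form \<open>\<bar>f\<bar>\<close>
  plus a multiple of \<epsilon> and \<epsilon> tends to 0 afterwards.\<close>

lemma nn_integral_rsqrt_simple_zeros_bound:
  fixes f f' :: "real \<Rightarrow> real"
  assumes f: "\<And>x. (f has_real_derivative f' x) (at x)" and cont: "continuous_on UNIV f'"
    and nz: "\<And>x. x \<in> {l..r} \<Longrightarrow> f x \<noteq> 0 \<or> f' x \<noteq> 0"
  shows "\<exists>C\<ge>0. \<forall>\<epsilon>\<in>{0<..1}. (\<integral>\<^sup>+y. ennreal (1 / sqrt (\<bar>f y\<bar> + \<epsilon>)) * indicator {l..r} y \<partial>lborel) \<le> ennreal C"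
proof (cases "l \<le> r")
  case True
  define I where "I \<epsilon> u v = (\<integral>\<^sup>+y. ennreal (1 / sqrt (\<bar>f y\<bar> + \<epsilon>)) * indicator {u..v} y \<partial>lborel)" for \<epsilon> u v
  have [measurable]: "f \<in> borel_measurable borel"
    using f by (auto intro!: borel_measurable_continuous_onI DERIV_continuous_on)
  have "\<exists>C\<ge>0. \<forall>\<epsilon>\<in>{0<..1}. I \<epsilon> l r \<le> ennreal C"
  proof (induction rule: Bolzano[OF True])
    case (1 u v w)
    then obtain C C' where C: "C \<ge> 0" "C' \<ge> 0" "\<And>\<epsilon>. \<epsilon> \<in> {0<..1} \<Longrightarrow> I \<epsilon> u v \<le> ennreal C"
      "\<And>\<epsilon>. \<epsilon> \<in> {0<..1} \<Longrightarrow> I \<epsilon> v w \<le> ennreal C'" by blast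
    have "I \<epsilon> u w \<le> ennreal (C + C')" if "\<epsilon> \<in> {0<..1}" for \<epsilon>
      using nn_integral_Icc_split_le[of "\<lambda>y. ennreal (1 / sqrt (\<bar>f y\<bar> + \<epsilon>))" u v
          "ennreal C" w "ennreal C'"] C that
      by (simp add: I_def)
    then show ?case using C by (intro exI[of _ "C + C'"]) auto
  next
    case (2 x)
    then have "f x \<noteq> 0 \<or> f' x \<noteq> 0" using nz by auto
    from local_sign_pieces[OF f cont this] obtain d where "d > 0" and
      d: "\<And>l r. l \<le> x \<Longrightarrow> x \<le> r \<Longrightarrow> r - l < d \<Longrightarrow>
           (\<exists>e>0. \<forall>y\<in>{l..r}. \<bar>f y\<bar> \<ge> e) \<or> (f x = 0 \<and> (\<exists>e>0. \<forall>y\<in>{l..r}. \<bar>f y\<bar> \<ge> e * \<bar>y - x\<bar>))" by metis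
    have *: "\<exists>C\<ge>0. \<forall>\<epsilon>\<in>{0<..1}. I \<epsilon> u v \<le> ennreal C" if uv: "u \<le> x" "x \<le> v" "v - u < d" for u v
      using d[OF uv]
    proof
      assume "\<exists>e>0. \<forall>y\<in>{u..v}. \<bar>f y\<bar> \<ge> e"
      then obtain e where e: "e > 0" "\<And>y. y \<in> {u..v} \<Longrightarrow> \<bar>f y\<bar> \<ge> e" by blast
      have "I \<epsilon> u v \<le> ennreal (1 / sqrt e * (v - u))" if "\<epsilon> \<in> {0<..1}" for \<epsilon>
      proof -
        have "1 / sqrt (\<bar>f y\<bar> + \<epsilon>) \<le> 1 / sqrt e" if "y \<in> {u..v}" for y
          using e(1) e(2)[OF that] \<open>\<epsilon> \<in> _\<close> by (intro divide_left_mono) auto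
        then have "I \<epsilon> u v \<le> (\<integral>\<^sup>+y. ennreal (1 / sqrt e) * indicator {u..v} y \<partial>lborel)"
          unfolding I_def by (intro nn_integral_mono) (auto split: split_indicator simp del: real_sqrt_ge_zero intro!: ennreal_leI)
        also have "\<dots> = ennreal (1 / sqrt e * (v - u))"
          using uv e by (simp add: nn_integral_cmult_indicator flip: ennreal_mult)
        finally show ?thesis .
      qed
      then show ?thesis using e uv by (intro exI[of _ "1 / sqrt e * (v - u)"]) auto
    next
      assume "f x = 0 \<and> (\<exists>e>0. \<forall>y\<in>{u..v}. \<bar>f y\<bar> \<ge> e * \<bar>y - x\<bar>)"
      then obtain e where e: "e > 0" "\<And>y. y \<in> {u..v} \<Longrightarrow> \<bar>f y\<bar> \<ge> e * \<bar>y - x\<bar>" by blast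
      define R where "R = v - u"
      have R: "R \<ge> 0" using uv by (simp add: R_def)
      \<comment> \<open>Pulling the growth rate \<open>e\<close> out of the root rescales \<epsilon>
        to \<open>\<epsilon> / e\<close>; then \<epsilon> \<le> 1 gives the uniform
        constant.\<close>
      have "I \<epsilon> u v \<le> ennreal (1 / sqrt e * (4 * sqrt (R + 1 / e)))" if eps: "\<epsilon> \<in> {0<..1}" for \<epsilon>
      proof -
        have *: "1 / sqrt (\<bar>f y\<bar> + \<epsilon>) \<le> 1 / sqrt e * (1 / sqrt (\<bar>y - x\<bar> + \<epsilon> / e))" if "y \<in> {u..v}" for y
        proof -
          have "1 / sqrt e * (1 / sqrt (\<bar>y - x\<bar> + \<epsilon> / e)) = 1 / sqrt (e * \<bar>y - x\<bar> + \<epsilon>)"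
            using e by (simp add: real_sqrt_mult[symmetric] distrib_left)
          moreover have "e * \<bar>y - x\<bar> + \<epsilon> > 0" using e eps by (intro add_nonneg_pos) auto
          ultimately show ?thesis using e(2)[OF that] by (auto intro!: divide_left_mono mult_pos_pos)
        qed
        have "I \<epsilon> u v \<le> (\<integral>\<^sup>+y. ennreal (1 / sqrt e) * (ennreal (1 / sqrt (\<bar>y - x\<bar> + \<epsilon> / e)) * indicator {x - R..x + R} y) \<partial>lborel)"
          unfolding I_def
        proof (intro nn_integral_mono)
          fix y
          have "y \<in> {u..v} \<Longrightarrow> y \<in> {x - R..x + R}" using uv by (auto simp: R_def)
          then show "ennreal (1 / sqrt (\<bar>f y\<bar> + \<epsilon>)) * indicator {u..v} y
            \<le> ennreal (1 / sqrt e) * (ennreal (1 / sqrt (\<bar>y - x\<bar> + \<epsilon> / e)) * indicator {x - R..x + R} y)"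
            using * e eps by (auto split: split_indicator intro!: ennreal_leI simp flip: ennreal_mult)
        qed
        also have "\<dots> = ennreal (1 / sqrt e) * (\<integral>\<^sup>+y. (ennreal (1 / sqrt (\<bar>y - x\<bar> + \<epsilon> / e)) * indicator {x - R..x + R} y) \<partial>lborel)"
          by (intro nn_integral_cmult) auto
        also have "(\<integral>\<^sup>+y. (ennreal (1 / sqrt (\<bar>y - x\<bar> + \<epsilon> / e)) * indicator {x - R..x + R} y) \<partial>lborel)
            = (\<integral>\<^sup>+z. ennreal (1 / sqrt (\<bar>z\<bar> + \<epsilon> / e)) * indicator {-R..R} z \<partial>lborel)"
          by (subst nn_integral_real_affine[where c=1 and t=x])
            (auto intro!: nn_integral_cong split: split_indicator)
        also have "ennreal (1 / sqrt e) * \<dots> \<le> ennreal (1 / sqrt e) * ennreal (4 * sqrt (R + 1 / e))"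
        proof (rule mult_left_mono)
          have "(\<integral>\<^sup>+z. ennreal (1 / sqrt (\<bar>z\<bar> + \<epsilon> / e)) * indicator {-R..R} z \<partial>lborel)
              \<le> ennreal (4 * sqrt (R + \<epsilon> / e))"
            using R e eps by (intro nn_integral_rsqrt_le) auto
          also have "\<dots> \<le> ennreal (4 * sqrt (R + 1 / e))"
            using e eps by (intro ennreal_leI) (auto simp: divide_right_mono)
          finally show "(\<integral>\<^sup>+z. ennreal (1 / sqrt (\<bar>z\<bar> + \<epsilon> / e)) * indicator {-R..R} z \<partial>lborel)
              \<le> ennreal (4 * sqrt (R + 1 / e))" .
        qed simp
        also have "\<dots> = ennreal (1 / sqrt e * (4 * sqrt (R + 1 / e)))"
          using e R by (intro ennreal_mult[symmetric]) auto
        finally show ?thesis .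
      qed
      then show ?thesis using e R by (intro exI[of _ "1 / sqrt e * (4 * sqrt (R + 1 / e))"]) auto
    qed
    show ?case using \<open>d > 0\<close> * by blast
  qed
  then show ?thesis by (simp add: I_def)
qed (auto simp: indicator_def intro!: exI[of _ 0])

section \<open>Concentration for sums over independent Poisson counts\<close>

context prob_space begin

lemma nn_integral_nat_valued:
  fixes N :: "'a \<Rightarrow> nat" and h :: "nat \<Rightarrow> ennreal"
  assumes [measurable]: "N \<in> measurable M (count_space UNIV)"
  shows "(\<integral>\<^sup>+\<omega>. h (N \<omega>) \<partial>M) = (\<Sum>k. h k * ennreal (prob {\<omega> \<in> space M. N \<omega> = k}))"
proof -
  have "h (N \<omega>) = (\<Sum>k. h k * indicator {\<omega> \<in> space M. N \<omega> = k} \<omega>)" if "\<omega> \<in> space M" for \<omega>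
    using that by (subst suminf_finite[of "{N \<omega>}"]) auto
  then have "(\<integral>\<^sup>+\<omega>. h (N \<omega>) \<partial>M) = (\<integral>\<^sup>+\<omega>. (\<Sum>k. h k * indicator {\<omega> \<in> space M. N \<omega> = k} \<omega>) \<partial>M)"
    by (intro nn_integral_cong) auto
  also have "\<dots> = (\<Sum>k. \<integral>\<^sup>+\<omega>. h k * indicator {\<omega> \<in> space M. N \<omega> = k} \<omega> \<partial>M)"
    by (intro nn_integral_suminf) auto
  also have "\<dots> = (\<Sum>k. h k * ennreal (prob {\<omega> \<in> space M. N \<omega> = k}))"
    by (intro suminf_cong) (simp add: nn_integral_cmult_indicator emeasure_eq_measure)
  finally show ?thesis .
qed

text \<open>The Poisson weights satisfy \<open>(k + 1) * p (k + 1) = \<mu> * p k\<close>, so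
  shifting the summation index trades the factor \<open>N\<close> for one additional point. This is
  the Mecke formula for a single cell.\<close>

lemma poisson_stein_identity:
  fixes N :: "'a \<Rightarrow> nat" and h :: "nat \<Rightarrow> ennreal"
  assumes [measurable]: "N \<in> measurable M (count_space UNIV)"
    and pois: "\<And>k. prob {\<omega> \<in> space M. N \<omega> = k} = \<mu> ^ k / fact k * exp (- \<mu>)" and "\<mu> \<ge> 0"
  shows "(\<integral>\<^sup>+\<omega>. of_nat (N \<omega>) * h (N \<omega>) \<partial>M) = ennreal \<mu> * (\<integral>\<^sup>+\<omega>. h (Suc (N \<omega>)) \<partial>M)"
proof -
  define p where "p k = \<mu> ^ k / fact k * exp (- \<mu>)" for k
  have p: "p k \<ge> 0" "real (Suc k) * p (Suc k) = \<mu> * p k" for k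
    using \<open>\<mu> \<ge> 0\<close> by (auto simp: p_def field_simps simp del: of_nat_Suc)
  have "(\<integral>\<^sup>+\<omega>. of_nat (N \<omega>) * h (N \<omega>) \<partial>M) = (\<Sum>k. of_nat k * h k * ennreal (p k))"
    using nn_integral_nat_valued[of N "\<lambda>k. of_nat k * h k"] by (simp add: pois p_def)
  also have "\<dots> = (\<Sum>k. of_nat (Suc k) * h (Suc k) * ennreal (p (Suc k)))"
    using suminf_offset[of "\<lambda>k. of_nat k * h k * ennreal (p k)" 1] by simp
  also have "\<dots> = (\<Sum>k. ennreal \<mu> * (h (Suc k) * ennreal (p k)))"
  proof (intro suminf_cong)
    fix k
    have "of_nat (Suc k) * ennreal (p (Suc k)) = ennreal \<mu> * ennreal (p k)"
      unfolding ennreal_of_nat_eq_real_of_nat using p \<open>\<mu> \<ge> 0\<close>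
      by (simp del: of_nat_Suc flip: ennreal_mult)
    then show "of_nat (Suc k) * h (Suc k) * ennreal (p (Suc k)) = ennreal \<mu> * (h (Suc k) * ennreal (p k))"
      by (simp add: mult_ac)
  qed
  also have "\<dots> = ennreal \<mu> * (\<Sum>k. h (Suc k) * ennreal (p k))"
    by simp
  also have "(\<Sum>k. h (Suc k) * ennreal (p k)) = (\<integral>\<^sup>+\<omega>. h (Suc (N \<omega>)) \<partial>M)"
    using nn_integral_nat_valued[of N "\<lambda>k. h (Suc k)"] by (simp add: pois p_def)
  finally show ?thesis .
qed

text \<open>By independence the counts other than \<open>N j\<close> can be frozen and the one-cell
  identity applied to \<open>N j\<close> alone. Restricting to finitely many indices makes the space
  of configurations countable and discrete, so that an arbitrary \<open>\<phi>\<close> is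
  measurable.\<close>

lemma poisson_vector_mecke:
  fixes N :: "nat \<Rightarrow> 'a \<Rightarrow> nat" and n :: nat and \<phi> :: "(nat \<Rightarrow> nat) \<Rightarrow> ennreal"
  defines "V \<equiv> \<lambda>\<omega>. \<lambda>i\<in>{..<n}. N i \<omega>"
  assumes ind: "indep_vars (\<lambda>_. count_space UNIV) N {..<n}"
    and pois: "\<And>k. prob {\<omega> \<in> space M. N j \<omega> = k} = \<mu> ^ k / fact k * exp (- \<mu>)"
    and "\<mu> \<ge> 0" "j < n"
  shows "(\<integral>\<^sup>+\<omega>. of_nat (V \<omega> j) * \<phi> (V \<omega>) \<partial>M) = ennreal \<mu> * (\<integral>\<^sup>+\<omega>. \<phi> ((V \<omega>)(j := Suc (V \<omega> j))) \<partial>M)"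
proof -
  define I where "I = {..<n} - {j}"
  define C where "C = (count_space UNIV :: nat measure)"
  define Y where "Y = (\<lambda>\<omega>. \<lambda>i\<in>I. N i \<omega>)"
  have PI: "PiM I (\<lambda>_. C) = count_space (PiE I (\<lambda>_. UNIV))"
    unfolding C_def by (rule count_space_PiM_finite) (auto simp: I_def)
  have [measurable]: "N j \<in> measurable M C"
    using ind \<open>j < n\<close> by (auto simp: indep_vars_def C_def)
  define L where "L = PiM {j} (\<lambda>_. C)"
  \<comment> \<open>The count \<open>N j\<close> is packaged as a vector with one entry, the form in
    which independence of two disjoint blocks of the family is available.\<close>
  define X where "X = (\<lambda>\<omega>. \<lambda>i\<in>{j}. N i \<omega>)"
  have iv: "indep_var L X (PiM I (\<lambda>_. C)) Y"
    unfolding X_def Y_def L_def C_def using \<open>j < n\<close> by (intro indep_var_restrict[OF ind]) (auto simp: I_def)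
  then have [measurable]: "X \<in> measurable M L" "Y \<in> measurable M (PiM I (\<lambda>_. C))"
    by (simp_all add: indep_var_distribution_eq)
  have PL: "L = count_space (PiE {j} (\<lambda>_. UNIV))"
    unfolding C_def L_def by (rule count_space_PiM_finite) auto
  have cL: "countable (PiE {j} (\<lambda>_. UNIV :: nat set))"
    by (intro countable_PiE) auto
  have dist: "distr M L X \<Otimes>\<^sub>M distr M (PiM I (\<lambda>_. C)) Y = distr M (L \<Otimes>\<^sub>M PiM I (\<lambda>_. C)) (\<lambda>\<omega>. (X \<omega>, Y \<omega>))"
    using iv by (simp add: indep_var_distribution_eq)
  interpret Xd: prob_space "distr M L X" by (rule prob_space_distr) simp
  interpret Yd: prob_space "distr M (PiM I (\<lambda>_. C)) Y" by (rule prob_space_distr) simp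
  interpret pair_sigma_finite "distr M L X" "distr M (PiM I (\<lambda>_. C)) Y" ..
  have fubini: "(\<integral>\<^sup>+\<omega>. f (N j \<omega>) (Y \<omega>) \<partial>M) = (\<integral>\<^sup>+y. \<integral>\<^sup>+\<omega>. f (N j \<omega>) y \<partial>M \<partial>distr M (PiM I (\<lambda>_. C)) Y)"
    for f :: "nat \<Rightarrow> (nat \<Rightarrow> nat) \<Rightarrow> ennreal"
  proof -
    define F where "F = (\<lambda>z. f (fst z j) (snd z))"
    have [measurable]: "F \<in> borel_measurable (L \<Otimes>\<^sub>M PiM I (\<lambda>_. C))"
      unfolding F_def PL by (rule measurable_pair_measure_countable1[OF cL]) (auto simp: PI)
    have F': "F \<in> borel_measurable (distr M L X \<Otimes>\<^sub>M distr M (PiM I (\<lambda>_. C)) Y)"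
      by simp
    have "(\<integral>\<^sup>+\<omega>. f (N j \<omega>) (Y \<omega>) \<partial>M) = (\<integral>\<^sup>+z. F z \<partial>distr M (L \<Otimes>\<^sub>M PiM I (\<lambda>_. C)) (\<lambda>\<omega>. (X \<omega>, Y \<omega>)))"
      by (subst nn_integral_distr) (measurable, simp add: F_def X_def)
    also have "\<dots> = (\<integral>\<^sup>+y. \<integral>\<^sup>+x. F (x, y) \<partial>distr M L X \<partial>distr M (PiM I (\<lambda>_. C)) Y)"
      unfolding dist[symmetric] by (rule nn_integral_snd[OF F', symmetric])
    also have "\<dots> = (\<integral>\<^sup>+y. \<integral>\<^sup>+\<omega>. F (X \<omega>, y) \<partial>M \<partial>distr M (PiM I (\<lambda>_. C)) Y)"
    proof (intro nn_integral_cong)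
      fix y
      have "(\<lambda>x. F (x, y)) \<in> borel_measurable L" by (simp add: PL)
      then show "(\<integral>\<^sup>+x. F (x, y) \<partial>distr M L X) = (\<integral>\<^sup>+\<omega>. F (X \<omega>, y) \<partial>M)"
        by (intro nn_integral_distr) auto
    qed
    finally show ?thesis by (simp add: F_def X_def)
  qed
  have V: "V \<omega> = (Y \<omega>)(j := N j \<omega>)" for \<omega>
    using \<open>j < n\<close> by (auto simp: V_def Y_def I_def fun_eq_iff restrict_def)
  have "(\<integral>\<^sup>+\<omega>. of_nat (V \<omega> j) * \<phi> (V \<omega>) \<partial>M)
      = (\<integral>\<^sup>+y. \<integral>\<^sup>+\<omega>. of_nat (N j \<omega>) * \<phi> (y(j := N j \<omega>)) \<partial>M \<partial>distr M (PiM I (\<lambda>_. C)) Y)"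
    using fubini[of "\<lambda>k y. of_nat k * \<phi> (y(j := k))"] by (simp add: V)
  also have "\<dots> = (\<integral>\<^sup>+y. ennreal \<mu> * (\<integral>\<^sup>+\<omega>. \<phi> (y(j := Suc (N j \<omega>))) \<partial>M) \<partial>distr M (PiM I (\<lambda>_. C)) Y)"
    using pois \<open>\<mu> \<ge> 0\<close> poisson_stein_identity[of "N j" \<mu> "\<lambda>k. \<phi> (_(j := k))"]
    by (intro nn_integral_cong poisson_stein_identity) (auto simp flip: C_def)
  also have "\<dots> = ennreal \<mu> * (\<integral>\<^sup>+y. (\<integral>\<^sup>+\<omega>. \<phi> (y(j := Suc (N j \<omega>))) \<partial>M) \<partial>distr M (PiM I (\<lambda>_. C)) Y)"
    by (intro nn_integral_cmult) (auto simp: PI)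
  also have "\<dots> = ennreal \<mu> * (\<integral>\<^sup>+\<omega>. \<phi> ((V \<omega>)(j := Suc (V \<omega> j))) \<partial>M)"
    using fubini[of "\<lambda>k y. \<phi> (y(j := Suc k))"] by (simp add: V)
  finally show ?thesis .
qed

end

lemma sum_eq_ennreal_sum:
  assumes "\<And>i. i \<in> I \<Longrightarrow> f i = ennreal (g i)" "\<And>i. i \<in> I \<Longrightarrow> g i \<ge> 0"
  shows "sum f I = ennreal (sum g I)"
  using assms by (simp add: sum_ennreal cong: sum.cong)

text \<open>Discrete form of the concentration estimate: cells \<open>j < n\<close> with Poisson
  counts, \<open>W\<close> the cells of the window, \<open>x j\<close> the contribution of a point
  in cell \<open>j\<close>, and \<open>s j\<close> a positive substitute for the derivative of
  \<open>x\<close>. The term \<open>\<rho>\<close> in \<open>level\<close> leaves room for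
  discretisation errors. Three Mecke removals are made in \<open>W\<close>: the first exposes
  \<open>x j\<close> to \<open>level\<close>, the other two bound the mean of the reciprocal weight.
  The premise on \<open>k\<close> guarantees that two points are left after the first
  removal.\<close>

lemma (in prob_space) poisson_vector_concentration:
  fixes N :: "nat \<Rightarrow> 'a \<Rightarrow> nat" and x b s \<mu> :: "nat \<Rightarrow> real"
  assumes ind: "indep_vars (\<lambda>_. count_space UNIV) N {..<n}"
    and pois: "\<And>j k. j < n \<Longrightarrow> prob {\<omega> \<in> space M. N j \<omega> = k} = \<mu> j ^ k / fact k * exp (- \<mu> j)"
    and \<mu>: "\<And>j. j < n \<Longrightarrow> \<mu> j \<ge> 0"
    and W: "W \<subseteq> {..<n}" and s: "\<And>j. j \<in> W \<Longrightarrow> s j > 0"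
    and b: "\<And>j. j < n \<Longrightarrow> b j \<ge> 0" and b_W: "\<And>j. j \<in> W \<Longrightarrow> b j \<le> \<beta>"
    and level: "\<And>c r. r \<ge> 0 \<Longrightarrow> (\<Sum>j\<in>W. \<mu> j * s j * indicator {c - r<..<c + r} (x j)) \<le> C * r + \<rho>"
    and nonneg: "C \<ge> 0" "\<rho> \<ge> 0" "\<beta> \<ge> 0" and k: "k \<ge> 3"
  shows "prob {\<omega> \<in> space M. \<bar>(\<Sum>j<n. x j * N j \<omega>) - \<alpha>\<bar> < (\<Sum>j<n. b j * N j \<omega>) \<and> k \<le> (\<Sum>j\<in>W. N j \<omega>)}
      \<le> (2 * C * \<beta> + \<rho> + C * (\<Sum>j\<in>{..<n} - W. b j * \<mu> j)) * (\<Sum>j\<in>W. \<mu> j / sqrt (s j))\<^sup>2"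
proof -
  define V where "V \<omega> = (\<lambda>i\<in>{..<n}. N i \<omega>)" for \<omega>
  define e where "e j v = (v :: nat \<Rightarrow> nat)(j := Suc (v j))" for j v
  define X where "X v = (\<Sum>j<n. x j * real (v j))" for v :: "nat \<Rightarrow> nat"
  define B where "B v = (\<Sum>j<n. b j * real (v j))" for v :: "nat \<Rightarrow> nat"
  define BO where "BO v = (\<Sum>j\<in>{..<n} - W. b j * real (v j))" for v :: "nat \<Rightarrow> nat"
  define S where "S v = (\<Sum>j\<in>W. s j * real (v j))" for v :: "nat \<Rightarrow> nat"
  define \<gamma> where "\<gamma> v = (\<Sum>j\<in>W. v j)" for v :: "nat \<Rightarrow> nat"
  define A where "A v \<longleftrightarrow> \<bar>X v - \<alpha>\<bar> < B v \<and> k \<le> \<gamma> v" for v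
  \<comment> \<open>Cutting off below two points keeps the mean of \<open>1 / S\<close> under
    control: with a single point it would involve \<open>1 / s j\<close>, whose sum against
    \<open>\<mu> j\<close> need not stay bounded under refinement.\<close>
  define G where "G v = (if \<gamma> v \<ge> 2 then 1 / S v else 0)" for v
  define \<Lambda> where "\<Lambda> = (\<Sum>j\<in>W. \<mu> j / sqrt (s j))"
  let ?I = "\<integral>\<^sup>+\<omega>. ennreal (\<gamma> (V \<omega>) * G (V \<omega>)) \<partial>M"
  let ?O = "\<Sum>j\<in>{..<n} - W. b j * \<mu> j"
  let ?near = "\<lambda>v j. indicator {(\<alpha> - X v) - (\<beta> + B v)<..<(\<alpha> - X v) + (\<beta> + B v)} (x j) :: real"
  let ?w = "\<lambda>j v. ennreal (if A (e j v) then s j / S (e j v) else 0)"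
  have finW: "finite W" using W finite_subset by blast
  have mecke: "(\<integral>\<^sup>+\<omega>. of_nat (V \<omega> j) * \<phi> (V \<omega>) \<partial>M) = ennreal (\<mu> j) * (\<integral>\<^sup>+\<omega>. \<phi> (e j (V \<omega>)) \<partial>M)"
    if "j < n" for j \<phi>
    using poisson_vector_mecke[OF ind pois \<mu>] that by (simp add: V_def e_def)
  have [measurable]: "(\<lambda>\<omega>. N j \<omega>) \<in> measurable M (count_space UNIV)" if "j < n" for j
    using ind that by (auto simp: indep_vars_def)
  have V_meas [measurable]: "(\<lambda>\<omega>. \<phi> (V \<omega>)) \<in> borel_measurable M" for \<phi> :: "(nat \<Rightarrow> nat) \<Rightarrow> ennreal"
  proof -
    have "V \<in> measurable M (PiM {..<n} (\<lambda>_. count_space UNIV))"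
      unfolding V_def by (intro measurable_restrict) auto
    then have "V \<in> measurable M (count_space (PiE {..<n} (\<lambda>_. UNIV)))"
      by (simp add: count_space_PiM_finite)
    then show ?thesis by (rule measurable_compose) auto
  qed
  have add_e: "(\<Sum>i\<in>J. c i * real (e j v i)) = (\<Sum>i\<in>J. c i * real (v i)) + (if j \<in> J then c j else 0)"
    if "finite J" for J c j v
  proof -
    have "(\<Sum>i\<in>J. c i * real (e j v i)) = (\<Sum>i\<in>J. c i * real (v i) + (if i = j then c j else 0))"
      by (intro sum.cong) (auto simp: e_def algebra_simps)
    then show ?thesis using that by (simp add: sum.distrib)
  qed
  have X_e: "X (e j v) = X v + x j" and B_e: "B (e j v) = B v + b j" if "j < n" for j v
    using that by (simp_all add: X_def B_def add_e)
  have S_e: "S (e j v) = S v + s j" if "j \<in> W" for j v using that finW by (simp add: S_def add_e)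
  have real_\<gamma>: "real (\<gamma> v) = (\<Sum>j\<in>W. 1 * real (v j))" for v by (simp add: \<gamma>_def)
  have \<gamma>_e: "\<gamma> (e j v) = Suc (\<gamma> v)" if "j \<in> W" for j v
  proof -
    have "real (\<gamma> (e j v)) = real (Suc (\<gamma> v))" using that finW unfolding real_\<gamma> by (simp only: add_e) (simp add: real_\<gamma>)
    then show ?thesis by simp
  qed
  have S_nonneg: "S v \<ge> 0" for v using s by (auto simp: S_def less_imp_le intro!: sum_nonneg mult_nonneg_nonneg)
  have S_pos: "S v > 0" if "\<gamma> v > 0" for v
  proof -
    have "\<exists>j\<in>W. v j \<noteq> 0" using that by (intro ccontr[where P = "\<exists>j\<in>W. v j \<noteq> 0"]) (simp add: \<gamma>_def)
    then obtain j where "j \<in> W" "v j > 0" by auto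
    then have "0 < s j * real (v j)" using s by auto
    also have "\<dots> \<le> S v" unfolding S_def using \<open>j \<in> W\<close> finW s
      by (intro member_le_sum) (auto simp: less_imp_le intro!: mult_nonneg_nonneg)
    finally show ?thesis .
  qed
  have G_nonneg: "G v \<ge> 0" for v using S_nonneg by (simp add: G_def)
  have B_nonneg: "B v \<ge> 0" "BO v \<ge> 0" for v
    using b by (auto simp: B_def BO_def intro!: sum_nonneg)
  have B_le: "B v \<le> \<beta> * \<gamma> v + BO v" for v
  proof -
    have "B v = (\<Sum>j\<in>W. b j * real (v j)) + BO v"
      using W unfolding B_def BO_def by (subst sum.subset_diff[of W]) auto
    also have "(\<Sum>j\<in>W. b j * real (v j)) \<le> (\<Sum>j\<in>W. \<beta> * real (v j))"
      using b_W by (intro sum_mono mult_right_mono) auto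
    also have "\<dots> = \<beta> * \<gamma> v" by (simp add: \<gamma>_def sum_distrib_left)
    finally show ?thesis by simp
  qed

  \<comment> \<open>The counts in \<open>W\<close>, weighted by \<open>s j / S\<close>, sum to one; the weight \<open>s j\<close> compensates the
    singularity of the law of \<open>x\<close> at its critical points.\<close>
  have "emeasure M {\<omega> \<in> space M. A (V \<omega>)} = (\<integral>\<^sup>+\<omega>. (if A (V \<omega>) then 1 else 0) \<partial>M)"
  proof -
    have [measurable]: "{\<omega> \<in> space M. A (V \<omega>)} \<in> events"
    proof -
      have "{\<omega> \<in> space M. A (V \<omega>)} = (\<lambda>\<omega>. (if A (V \<omega>) then 1 else 0 :: ennreal)) -` {1} \<inter> space M"
        by (auto split: if_splits)
      also have "\<dots> \<in> events" by (rule measurable_sets[OF V_meas]) simp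
      finally show ?thesis .
    qed
    have "emeasure M {\<omega> \<in> space M. A (V \<omega>)} = (\<integral>\<^sup>+\<omega>. indicator {\<omega> \<in> space M. A (V \<omega>)} \<omega> \<partial>M)" by simp
    also have "\<dots> = (\<integral>\<^sup>+\<omega>. (if A (V \<omega>) then 1 else 0) \<partial>M)" by (intro nn_integral_cong) auto
    finally show ?thesis .
  qed
  also have "\<dots> \<le> (\<integral>\<^sup>+\<omega>. (\<Sum>j\<in>W. of_nat (V \<omega> j) * ennreal (if A (V \<omega>) then s j / S (V \<omega>) else 0)) \<partial>M)"
  proof (intro nn_integral_mono)
    fix \<omega>
    have "1 \<le> (\<Sum>j\<in>W. of_nat (V \<omega> j) * ennreal (s j / S (V \<omega>)))" if "A (V \<omega>)"
    proof -
      have "S (V \<omega>) > 0" using that k by (intro S_pos) (auto simp: A_def)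
      then have "1 = (\<Sum>j\<in>W. real (V \<omega> j) * (s j / S (V \<omega>)))"
        by (simp add: S_def sum_divide_distrib[symmetric] mult.commute)
      also have "ennreal \<dots> = (\<Sum>j\<in>W. of_nat (V \<omega> j) * ennreal (s j / S (V \<omega>)))"
        using s S_nonneg by (intro sum_eq_ennreal_sum[symmetric])
          (auto simp: ennreal_of_nat_eq_real_of_nat less_imp_le simp flip: ennreal_mult)
      finally show ?thesis by simp
    qed
    then show "(if A (V \<omega>) then 1 else 0) \<le> (\<Sum>j\<in>W. of_nat (V \<omega> j) * ennreal (if A (V \<omega>) then s j / S (V \<omega>) else 0))"
      by auto
  qed
  also have "\<dots> = (\<Sum>j\<in>W. ennreal (\<mu> j) * (\<integral>\<^sup>+\<omega>. ?w j (V \<omega>) \<partial>M))"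
    using W by (subst nn_integral_sum) (auto simp: intro!: V_meas sum.cong mecke[of _ "\<lambda>v. ennreal (if A v then s _ / S v else 0)"])
  also have "\<dots> = (\<integral>\<^sup>+\<omega>. (\<Sum>j\<in>W. ennreal (\<mu> j) * ?w j (V \<omega>)) \<partial>M)"
    by (subst nn_integral_sum) (auto simp: nn_integral_cmult V_meas intro!: V_meas)
  \<comment> \<open>If adding a point in cell \<open>j\<close> to \<open>v\<close> yields a
    configuration in \<open>A\<close>, then \<open>v\<close> has at least two points in
    \<open>W\<close>, its weight \<open>S v\<close> is no larger than before, and \<open>x j\<close>
    lies within \<open>\<beta> + B v\<close> of \<open>\<alpha> - X v\<close>. That interval does
    not depend on \<open>j\<close>, so \<open>level\<close> applies to the sum over
    \<open>j\<close>.\<close>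
  also have "\<dots> \<le> (\<integral>\<^sup>+\<omega>. ennreal ((2 * C * \<beta> + \<rho>) * (\<gamma> (V \<omega>) * G (V \<omega>)) + C * (BO (V \<omega>) * G (V \<omega>))) \<partial>M)"
  proof (intro nn_integral_mono)
    fix \<omega>
    define v where "v = V \<omega>"
    have le: "(if A (e j v) then s j / S (e j v) else 0)
        \<le> G v * (s j * ?near v j)" if "j \<in> W" for j
    proof (cases "A (e j v)")
      case True
      have jn: "j < n" using that W by auto
      have "\<gamma> v \<ge> 2" using True k that by (simp add: A_def \<gamma>_e)
      moreover have "x j \<in> {(\<alpha> - X v) - (\<beta> + B v)<..<(\<alpha> - X v) + (\<beta> + B v)}"
        using True b_W[OF that] by (auto simp: A_def X_e[OF jn] B_e[OF jn] abs_less_iff)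
      moreover have "s j / S (e j v) \<le> s j / S v"
        using s[OF that] S_pos[of v] \<open>\<gamma> v \<ge> 2\<close> by (intro divide_left_mono) (auto simp: S_e[OF that])
      ultimately show ?thesis using True by (simp add: G_def)
    next
      case False
      then show ?thesis using G_nonneg s[OF that] by (auto intro!: mult_nonneg_nonneg)
    qed
    have "(\<Sum>j\<in>W. ennreal (\<mu> j) * ?w j v)
       = ennreal (\<Sum>j\<in>W. \<mu> j * (if A (e j v) then s j / S (e j v) else 0))"
      using W \<mu> s S_nonneg by (intro sum_eq_ennreal_sum) (auto simp: less_imp_le subset_iff simp flip: ennreal_mult)
    also have "\<dots> \<le> ennreal (\<Sum>j\<in>W. \<mu> j * (G v * (s j * ?near v j)))"
      using W \<mu> by (intro ennreal_leI sum_mono mult_left_mono le) auto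
    also have "(\<Sum>j\<in>W. \<mu> j * (G v * (s j * ?near v j)))
        = G v * (\<Sum>j\<in>W. \<mu> j * s j * ?near v j)"
      by (simp add: sum_distrib_left mult_ac)
    also have "\<dots> \<le> G v * (C * (\<beta> + B v) + \<rho>)"
      using nonneg B_nonneg by (intro mult_left_mono level G_nonneg) auto
    \<comment> \<open>One \<open>C * \<beta>\<close> comes from the removed point and one from the
      remaining points of \<open>W\<close>. Multiplying the constant terms by
      \<open>\<gamma> v\<close>, which is at least 1 where \<open>G v\<close> is nonzero, leaves a
      single expectation to estimate.\<close>
    also have "\<dots> \<le> (2 * C * \<beta> + \<rho>) * (\<gamma> v * G v) + C * (BO v * G v)"
    proof (cases "\<gamma> v \<ge> 2")
      case True
      then have "C * \<beta> \<le> C * \<beta> * \<gamma> v" "\<rho> \<le> \<rho> * \<gamma> v"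
        using nonneg mult_left_mono[of 1 "real (\<gamma> v)" "C * \<beta>"] mult_left_mono[of 1 "real (\<gamma> v)" \<rho>] by auto
      moreover have "C * B v \<le> C * (\<beta> * \<gamma> v + BO v)" using B_le nonneg by (intro mult_left_mono) auto
      ultimately have "C * (\<beta> + B v) + \<rho> \<le> (2 * C * \<beta> + \<rho>) * \<gamma> v + C * BO v" by (simp add: algebra_simps)
      from mult_left_mono[OF this G_nonneg] show ?thesis by (simp add: algebra_simps)
    qed (simp add: G_def)
    finally show "(\<Sum>j\<in>W. ennreal (\<mu> j) * ?w j (V \<omega>))
      \<le> ennreal ((2 * C * \<beta> + \<rho>) * (\<gamma> (V \<omega>) * G (V \<omega>)) + C * (BO (V \<omega>) * G (V \<omega>)))"
      unfolding v_def[symmetric] by (simp add: ennreal_leI)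
  qed
  also have "\<dots> = ennreal (2 * C * \<beta> + \<rho>) * ?I
      + ennreal C * (\<integral>\<^sup>+\<omega>. ennreal (BO (V \<omega>) * G (V \<omega>)) \<partial>M)"
    using nonneg G_nonneg B_nonneg
    by (simp add: ennreal_plus ennreal_mult nn_integral_add nn_integral_cmult V_meas)
  \<comment> \<open>A point outside \<open>W\<close> does not change \<open>G\<close>, so the Mecke
    formula there merely splits off the mean of the outside tolerance.\<close>
  also have "(\<integral>\<^sup>+\<omega>. ennreal (BO (V \<omega>) * G (V \<omega>)) \<partial>M)
      \<le> ennreal ?O * ?I"
  proof -
    have G_e: "G (e j v) = G v" if "j \<notin> W" for j v
    proof -
      have "e j v i = v i" if "i \<in> W" for i using that \<open>j \<notin> W\<close> by (auto simp: e_def)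
      then show ?thesis by (simp add: G_def S_def \<gamma>_def)
    qed
    have "(\<integral>\<^sup>+\<omega>. ennreal (BO (V \<omega>) * G (V \<omega>)) \<partial>M)
        = (\<integral>\<^sup>+\<omega>. (\<Sum>j\<in>{..<n} - W. ennreal (b j) * (of_nat (V \<omega> j) * ennreal (G (V \<omega>)))) \<partial>M)"
    proof (intro nn_integral_cong)
      fix \<omega>
      show "ennreal (BO (V \<omega>) * G (V \<omega>)) = (\<Sum>j\<in>{..<n} - W. ennreal (b j) * (of_nat (V \<omega> j) * ennreal (G (V \<omega>))))"
        unfolding BO_def sum_distrib_right using b G_nonneg
        by (intro sum_eq_ennreal_sum[symmetric])
          (auto simp: ennreal_of_nat_eq_real_of_nat mult.assoc simp flip: ennreal_mult)
    qed
    also have "\<dots> = (\<Sum>j\<in>{..<n} - W. ennreal (b j) * (ennreal (\<mu> j) * (\<integral>\<^sup>+\<omega>. ennreal (G (V \<omega>)) \<partial>M)))"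
      by (subst nn_integral_sum)
        (auto simp: nn_integral_cmult V_meas mecke[of _ "\<lambda>v. ennreal (G v)"] G_e intro!: V_meas sum.cong)
    also have "\<dots> = ennreal ?O * (\<integral>\<^sup>+\<omega>. ennreal (G (V \<omega>)) \<partial>M)"
    proof -
      have "ennreal ?O = (\<Sum>j\<in>{..<n} - W. ennreal (b j) * ennreal (\<mu> j))"
        using b \<mu> by (intro sum_eq_ennreal_sum[symmetric]) (auto simp flip: ennreal_mult)
      then show ?thesis by (simp add: sum_distrib_right mult.assoc)
    qed
    also have "(\<integral>\<^sup>+\<omega>. ennreal (G (V \<omega>)) \<partial>M) \<le> ?I"
      using S_nonneg by (intro nn_integral_mono ennreal_leI) (auto simp: G_def intro!: divide_right_mono)
    finally show ?thesis by (simp add: mult_left_mono)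
  qed
  also have "ennreal (2 * C * \<beta> + \<rho>) * ?I
      + ennreal C * (ennreal ?O * ?I)
    = ennreal (2 * C * \<beta> + \<rho> + C * ?O) * ?I"
  proof -
    have "2 * C * \<beta> + \<rho> \<ge> 0" "?O \<ge> 0"
      using nonneg b \<mu> by (auto intro!: sum_nonneg)
    then have "ennreal (2 * C * \<beta> + \<rho> + C * ?O)
        = ennreal (2 * C * \<beta> + \<rho>) + ennreal C * ennreal ?O"
      using nonneg(1) by (simp only: ennreal_plus ennreal_mult mult_nonneg_nonneg)
    then show ?thesis by (simp only: distrib_right mult.assoc)
  qed
  also have "?I \<le> ennreal (\<Lambda>\<^sup>2)"
  proof -
    \<comment> \<open>The bound \<open>\<gamma> * G \<le> \<gamma> * (\<gamma> - 1) / S\<close>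
      prepares two removals: after the first, \<open>\<gamma> - 1\<close> has become
      \<open>\<gamma>\<close>, again a sum over the points of \<open>W\<close>. The denominator then
      ends up as \<open>S + s l + s i\<close>.\<close>
    define \<phi> where "\<phi> v = ennreal ((real (\<gamma> v) - 1) / S v)" for v
    define \<psi> where "\<psi> i v = ennreal (1 / (S v + s i))" for i v
    have "?I \<le> (\<integral>\<^sup>+\<omega>. (\<Sum>i\<in>W. of_nat (V \<omega> i) * \<phi> (V \<omega>)) \<partial>M)"
    proof (intro nn_integral_mono)
      fix \<omega>
      define v where "v = V \<omega>"
      have "ennreal (\<gamma> v * G v) \<le> of_nat (\<gamma> v) * \<phi> v"
        using S_pos[of v] unfolding G_def \<phi>_def ennreal_of_nat_eq_real_of_nat
        by (auto simp: field_simps simp flip: ennreal_mult intro!: ennreal_leI)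
      then show "ennreal (\<gamma> (V \<omega>) * G (V \<omega>)) \<le> (\<Sum>i\<in>W. of_nat (V \<omega> i) * \<phi> (V \<omega>))"
        unfolding v_def[symmetric] by (simp add: \<gamma>_def sum_distrib_right)
    qed
    also have "\<dots> = (\<Sum>i\<in>W. ennreal (\<mu> i) * (\<integral>\<^sup>+\<omega>. \<phi> (e i (V \<omega>)) \<partial>M))"
      using W by (subst nn_integral_sum) (auto intro!: V_meas sum.cong mecke)
    also have "\<dots> = (\<Sum>i\<in>W. ennreal (\<mu> i) * (\<integral>\<^sup>+\<omega>. (\<Sum>l\<in>W. of_nat (V \<omega> l) * \<psi> i (V \<omega>)) \<partial>M))"
    proof (intro sum.cong refl arg_cong2[where f = "(*)"] nn_integral_cong)
      fix i \<omega> assume i: "i \<in> W"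
      show "\<phi> (e i (V \<omega>)) = (\<Sum>l\<in>W. of_nat (V \<omega> l) * \<psi> i (V \<omega>))"
      proof -
        have "(\<Sum>l\<in>W. of_nat (V \<omega> l) * \<psi> i (V \<omega>)) = of_nat (\<gamma> (V \<omega>)) * \<psi> i (V \<omega>)"
          by (simp add: \<gamma>_def sum_distrib_right)
        also have "\<dots> = ennreal (real (\<gamma> (V \<omega>)) * (1 / (S (V \<omega>) + s i)))"
          unfolding \<psi>_def ennreal_of_nat_eq_real_of_nat using S_nonneg[of "V \<omega>"] s[OF i]
          by (intro ennreal_mult[symmetric]) auto
        finally show ?thesis by (simp add: \<phi>_def \<gamma>_e[OF i] S_e[OF i])
      qed
    qed
    also have "\<dots> = (\<Sum>i\<in>W. ennreal (\<mu> i) * (\<Sum>l\<in>W. ennreal (\<mu> l) * (\<integral>\<^sup>+\<omega>. \<psi> i (e l (V \<omega>)) \<partial>M)))"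
      using W by (subst nn_integral_sum) (auto intro!: V_meas sum.cong mecke arg_cong2[where f = "(*)"])
    \<comment> \<open>The arithmetic-geometric mean inequality decouples \<open>i\<close> from
      \<open>l\<close>, and the double sum becomes the square of \<open>\<Lambda>\<close>.\<close>
    also have "\<dots> \<le> (\<Sum>i\<in>W. ennreal (\<mu> i) * (\<Sum>l\<in>W. ennreal (\<mu> l) * ennreal (1 / (sqrt (s i) * sqrt (s l)))))"
    proof (intro sum_mono mult_left_mono)
      fix i l assume il: "i \<in> W" "l \<in> W"
      have "1 / (S v + s l + s i) \<le> 1 / (sqrt (s i) * sqrt (s l))" for v
      proof -
        have "sqrt (s i) * sqrt (s l) \<le> (s i + s l) / 2"
          using arith_geo_mean_sqrt[of "s i" "s l"] s il by (auto simp: real_sqrt_mult less_imp_le)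
        then show ?thesis using s[OF il(1)] s[OF il(2)] S_nonneg[of v]
          by (intro divide_left_mono) auto
      qed
      then have "(\<integral>\<^sup>+\<omega>. \<psi> i (e l (V \<omega>)) \<partial>M) \<le> (\<integral>\<^sup>+\<omega>. ennreal (1 / (sqrt (s i) * sqrt (s l))) \<partial>M)"
        unfolding \<psi>_def S_e[OF il(2)] by (intro nn_integral_mono ennreal_leI) auto
      then show "(\<integral>\<^sup>+\<omega>. \<psi> i (e l (V \<omega>)) \<partial>M) \<le> ennreal (1 / (sqrt (s i) * sqrt (s l)))"
        by (simp add: emeasure_space_1)
    qed auto
    also have "\<dots> = ennreal (\<Sum>i\<in>W. \<mu> i * (\<Sum>l\<in>W. \<mu> l * (1 / (sqrt (s i) * sqrt (s l)))))"
    proof -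
      have "(\<Sum>l\<in>W. ennreal (\<mu> l) * ennreal (1 / (sqrt (s i) * sqrt (s l)))) = ennreal (\<Sum>l\<in>W. \<mu> l * (1 / (sqrt (s i) * sqrt (s l))))"
        if "i \<in> W" for i
        using W \<mu> s that by (intro sum_eq_ennreal_sum)
          (auto simp: less_imp_le subset_iff simp flip: ennreal_mult)
      moreover have "(\<Sum>l\<in>W. \<mu> l * (1 / (sqrt (s i) * sqrt (s l)))) \<ge> 0" if "i \<in> W" for i
        using W \<mu> s that by (intro sum_nonneg) (auto simp: less_imp_le subset_iff)
      ultimately show ?thesis
        using W \<mu> by (intro sum_eq_ennreal_sum) (auto simp: subset_iff simp flip: ennreal_mult)
    qed
    also have "(\<Sum>i\<in>W. \<mu> i * (\<Sum>l\<in>W. \<mu> l * (1 / (sqrt (s i) * sqrt (s l))))) = \<Lambda>\<^sup>2"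
    proof -
      have "(\<Sum>i\<in>W. \<mu> i * (\<Sum>l\<in>W. \<mu> l * (1 / (sqrt (s i) * sqrt (s l)))))
          = (\<Sum>i\<in>W. \<Sum>l\<in>W. (\<mu> i / sqrt (s i)) * (\<mu> l / sqrt (s l)))"
        by (simp add: sum_distrib_left)
      then show ?thesis by (simp only: \<Lambda>_def power2_eq_square sum_product)
    qed
    finally show ?thesis .
  qed
  also have "ennreal (2 * C * \<beta> + \<rho> + C * ?O) * ennreal (\<Lambda>\<^sup>2)
      = ennreal ((2 * C * \<beta> + \<rho> + C * ?O) * \<Lambda>\<^sup>2)"
    using nonneg b \<mu> by (intro ennreal_mult[symmetric]) (auto intro!: sum_nonneg add_nonneg_nonneg mult_nonneg_nonneg)
  finally have "emeasure M {\<omega> \<in> space M. A (V \<omega>)} \<le> ennreal ((2 * C * \<beta> + \<rho> + C * ?O) * \<Lambda>\<^sup>2)"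
    by this (auto intro!: mult_left_mono add_left_mono)
  moreover have "A (V \<omega>) \<longleftrightarrow> \<bar>(\<Sum>j<n. x j * N j \<omega>) - \<alpha>\<bar> < (\<Sum>j<n. b j * N j \<omega>) \<and> k \<le> (\<Sum>j\<in>W. N j \<omega>)" for \<omega>
    using W by (auto simp: A_def X_def B_def \<gamma>_def V_def subset_iff intro!: sum.cong)
  moreover have "(2 * C * \<beta> + \<rho> + C * ?O) * \<Lambda>\<^sup>2 \<ge> 0"
    using nonneg b \<mu> by (intro mult_nonneg_nonneg add_nonneg_nonneg sum_nonneg) auto
  ultimately show ?thesis
    by (simp add: emeasure_eq_measure \<Lambda>_def ennreal_le_iff)
qed

section \<open>Sums over the points of a Poisson process\<close>

text \<open>Full and truncated shot noise and all random tolerances have this shape. Without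
  absolute summability the value is 0, so statements about infinitely many points hold only almost
  surely.\<close>

definition point_sum :: "('i \<Rightarrow> 'w \<Rightarrow> real) \<Rightarrow> real set \<Rightarrow> (real \<Rightarrow> real) \<Rightarrow> 'w \<Rightarrow> real" where
  "point_sum \<tau> D f \<omega> = (\<Sum>\<^sub>\<infinity>i\<in>{i. \<tau> i \<omega> \<in> D}. f (\<tau> i \<omega>))"

text \<open>No summability is assumed because both sides default to 0 together: for real families,
  summable and absolutely summable coincide. The integral form gives measurability in
  \<open>\<omega>\<close> and dominated convergence.\<close>

lemma point_sum_eq_integral:
  "point_sum \<tau> D f \<omega> = (\<integral>i. indicator D (\<tau> i \<omega>) * f (\<tau> i \<omega>) \<partial>count_space UNIV)"
proof -
  define h where "h i = indicator D (\<tau> i \<omega>) * f (\<tau> i \<omega>)" for i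
  have "point_sum \<tau> D f \<omega> = infsum h UNIV"
    unfolding point_sum_def h_def by (intro infsum_cong_neutral) auto
  also have "\<dots> = (\<integral>i. h i \<partial>count_space UNIV)"
  proof (cases "integrable (count_space UNIV) h")
    case True
    then have "Infinite_Set_Sum.abs_summable_on h UNIV" by (simp add: abs_summable_on_def)
    from infsetsum_infsum[OF this] show ?thesis unfolding infsetsum_def by (rule sym)
  next
    case False
    then have "\<not> h summable_on UNIV"
      using summable_on_iff_abs_summable_on_real[of h UNIV] abs_summable_equivalent[of h UNIV]
      by (simp add: abs_summable_on_def)
    then show ?thesis using False by (simp add: infsum_not_exists not_integrable_integral_eq)
  qed
  finally show ?thesis by (simp add: h_def)
qed

section \<open>Measurability and first moments of point sums\<close>

context homogeneous_poisson_process begin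

declare random_points [measurable]

lemma measurable_point_count [measurable]:
  assumes "A \<in> sets borel" "emeasure lborel A < \<infinity>"
  shows "point_count \<tau> A \<in> measurable P (count_space UNIV)"
proof -
  have "indep_vars (\<lambda>_. count_space UNIV) (\<lambda>j. point_count \<tau> A) {..<1::nat}"
    using assms by (intro indep_counts) (auto simp: disjoint_family_on_def)
  then show ?thesis by (auto simp: indep_vars_def)
qed

lemma sigma_finite_index: "sigma_finite_measure (count_space (UNIV :: 'i set))"
  by (rule sigma_finite_measure_count_space_countable) simp

lemma measurable_point_pair: "(\<lambda>(i, \<omega>). \<tau> i \<omega>) \<in> borel_measurable (count_space UNIV \<Otimes>\<^sub>M P)"
  by (rule measurable_pair_measure_countable1) (simp_all add: random_points)

lemma measurable_point_pair_compose:
  assumes "F \<in> measurable borel N"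
  shows "(\<lambda>(\<omega>, i). F (\<tau> i \<omega>)) \<in> measurable (P \<Otimes>\<^sub>M count_space UNIV) N"
proof -
  have "(\<lambda>z. F (case z of (\<omega>, i) \<Rightarrow> case (i, \<omega>) of (i, \<omega>) \<Rightarrow> \<tau> i \<omega>)) \<in> measurable (P \<Otimes>\<^sub>M count_space UNIV) N"
    by (rule measurable_compose[OF measurable_pair_swap[OF measurable_point_pair] assms])
  also have "(\<lambda>z. F (case z of (\<omega>, i) \<Rightarrow> case (i, \<omega>) of (i, \<omega>) \<Rightarrow> \<tau> i \<omega>)) = (\<lambda>(\<omega>, i). F (\<tau> i \<omega>))"
    by (rule ext) (simp add: split_beta)
  finally show ?thesis .
qed

lemma measurable_point_sum [measurable]:
  assumes [measurable]: "D \<in> sets borel" "f \<in> borel_measurable borel"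
  shows "point_sum \<tau> D f \<in> borel_measurable P"
proof -
  interpret sigma_finite_measure "count_space (UNIV :: 'i set)" by (rule sigma_finite_index)
  have "(\<lambda>u. indicator D u * f u) \<in> borel_measurable borel" by measurable
  from borel_measurable_lebesgue_integral[OF measurable_point_pair_compose[OF this]]
  show ?thesis unfolding point_sum_eq_integral[abs_def] .
qed

text \<open>The mean of a Poisson count is the one-cell Mecke identity for a constant function.
  Almost sure finiteness enters because \<open>card\<close> and the counting integral differ on
  infinite sets.\<close>

lemma expected_point_count:
  assumes A: "A \<in> sets borel" "emeasure lborel A < \<infinity>"
  shows "(\<integral>\<^sup>+\<omega>. (\<integral>\<^sup>+i. indicator A (\<tau> i \<omega>) \<partial>count_space UNIV) \<partial>P) = ennreal rate * emeasure lborel A"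
proof -
  have "(\<integral>\<^sup>+i. indicator A (\<tau> i \<omega>) \<partial>count_space UNIV) = of_nat (point_count \<tau> A \<omega>)" if "finite {i. \<tau> i \<omega> \<in> A}" for \<omega>
  proof -
    have "(\<integral>\<^sup>+i. indicator A (\<tau> i \<omega>) \<partial>count_space UNIV) = (\<integral>\<^sup>+i. indicator {i. \<tau> i \<omega> \<in> A} i \<partial>count_space UNIV)"
      by (intro nn_integral_cong) (simp add: indicator_def)
    then show ?thesis using that by (simp add: point_count_def)
  qed
  then have "(\<integral>\<^sup>+\<omega>. (\<integral>\<^sup>+i. indicator A (\<tau> i \<omega>) \<partial>count_space UNIV) \<partial>P) = (\<integral>\<^sup>+\<omega>. of_nat (point_count \<tau> A \<omega>) * 1 \<partial>P)"
    using finite_count[OF A] by (intro nn_integral_cong_AE) (auto elim: eventually_mono)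
  also have "\<dots> = ennreal (rate * measure lborel A) * (\<integral>\<^sup>+\<omega>. 1 \<partial>P)"
    by (rule poisson_stein_identity[of "point_count \<tau> A" "rate * measure lborel A" "\<lambda>_. 1",
        OF measurable_point_count[OF A] poisson_count[OF A]]) (use rate_pos in simp)
  also have "\<dots> = ennreal rate * emeasure lborel A"
  proof -
    have "emeasure lborel A = ennreal (measure lborel A)"
      using A(2) by (intro emeasure_eq_ennreal_measure) auto
    then show ?thesis using rate_pos by (simp add: emeasure_space_1 ennreal_mult)
  qed
  finally show ?thesis .
qed

text \<open>The intensity measure \<open>\<nu>\<close>, the image of counting measure times
  \<open>P\<close> under all points, is \<open>rate\<close> times Lebesgue measure; integrating
  \<open>f\<close> against it gives the formula at once.\<close>

lemma campbell_formula:
  assumes [measurable]: "f \<in> borel_measurable borel"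
  shows "(\<integral>\<^sup>+\<omega>. (\<integral>\<^sup>+i. f (\<tau> i \<omega>) \<partial>count_space UNIV) \<partial>P) = ennreal rate * (\<integral>\<^sup>+u. f u \<partial>lborel)"
proof -
  interpret I: sigma_finite_measure "count_space (UNIV :: 'i set)" by (rule sigma_finite_index)
  interpret IP: pair_sigma_finite "count_space (UNIV :: 'i set)" P ..
  define \<nu> where "\<nu> = distr (count_space UNIV \<Otimes>\<^sub>M P) borel (\<lambda>(i, \<omega>). \<tau> i \<omega>)"
  have [simp]: "sets \<nu> = sets borel" by (simp add: \<nu>_def)
  have \<nu>: "(\<integral>\<^sup>+u. h u \<partial>\<nu>) = (\<integral>\<^sup>+\<omega>. (\<integral>\<^sup>+i. h (\<tau> i \<omega>) \<partial>count_space UNIV) \<partial>P)"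
    if [measurable]: "h \<in> borel_measurable borel" for h
  proof -
    have m: "(\<lambda>z. h (case z of (i, \<omega>) \<Rightarrow> \<tau> i \<omega>)) \<in> borel_measurable (count_space UNIV \<Otimes>\<^sub>M P)"
      by (rule measurable_compose[OF measurable_point_pair that])
    have "(\<integral>\<^sup>+u. h u \<partial>\<nu>) = (\<integral>\<^sup>+z. h (case z of (i, \<omega>) \<Rightarrow> \<tau> i \<omega>) \<partial>(count_space UNIV \<Otimes>\<^sub>M P))"
      unfolding \<nu>_def by (intro nn_integral_distr measurable_point_pair) auto
    also have "\<dots> = (\<integral>\<^sup>+\<omega>. (\<integral>\<^sup>+i. h (\<tau> i \<omega>) \<partial>count_space UNIV) \<partial>P)"
      by (subst IP.nn_integral_snd[OF m, symmetric]) simp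
    finally show ?thesis .
  qed
  \<comment> \<open>Lebesgue measure is determined by its values on open intervals, where the mean
    counts are known.\<close>
  have "lborel = scale_measure (ennreal (1 / rate)) \<nu>"
  proof (rule lborel_eqI)
    fix l u :: real assume "\<And>b. b \<in> Basis \<Longrightarrow> l \<bullet> b \<le> u \<bullet> b"
    then have lu: "l \<le> u" by simp
    have "emeasure \<nu> {l<..<u} = (\<integral>\<^sup>+x. indicator {l<..<u} x \<partial>\<nu>)" by simp
    also have "\<dots> = ennreal rate * ennreal (u - l)"
      using lu by (subst \<nu>) (auto simp: expected_point_count)
    finally show "emeasure (scale_measure (ennreal (1 / rate)) \<nu>) (box l u) = (\<Prod>b\<in>Basis. (u - l) \<bullet> b)"
      using rate_pos lu by (simp flip: ennreal_mult)
  qed simp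
  then have "(\<integral>\<^sup>+u. f u \<partial>lborel) = (\<integral>\<^sup>+u. f u \<partial>scale_measure (ennreal (1 / rate)) \<nu>)"
    by (rule arg_cong)
  also have "\<dots> = ennreal (1 / rate) * (\<integral>\<^sup>+u. f u \<partial>\<nu>)"
    by (rule nn_integral_scale_measure) (simp add: measurable_cong_sets[OF \<open>sets \<nu> = sets borel\<close> refl])
  finally have "(\<integral>\<^sup>+u. f u \<partial>lborel) = ennreal (1 / rate) * (\<integral>\<^sup>+u. f u \<partial>\<nu>)" .
  then have "ennreal rate * (\<integral>\<^sup>+u. f u \<partial>lborel) = (\<integral>\<^sup>+u. f u \<partial>\<nu>)"
    using rate_pos by (simp flip: ennreal_mult mult.assoc)
  then show ?thesis by (simp add: \<nu>)
qed

text \<open>By the mean formula the sum of \<open>\<bar>f\<bar>\<close> over the points has finite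
  expectation, hence is finite almost surely.\<close>

lemma AE_abs_summable:
  fixes f :: "real \<Rightarrow> real"
  assumes "integrable lborel f"
  shows "AE \<omega> in P. (\<lambda>i. \<bar>f (\<tau> i \<omega>)\<bar>) summable_on UNIV"
proof -
  interpret I: sigma_finite_measure "count_space (UNIV :: 'i set)" by (rule sigma_finite_index)
  have [measurable]: "f \<in> borel_measurable borel" using borel_measurable_integrable[OF assms] by simp
  have "(\<lambda>u. ennreal \<bar>f u\<bar>) \<in> borel_measurable borel" by measurable
  from I.borel_measurable_nn_integral[OF measurable_point_pair_compose[OF this]]
  have [measurable]: "(\<lambda>\<omega>. \<integral>\<^sup>+i. ennreal \<bar>f (\<tau> i \<omega>)\<bar> \<partial>count_space UNIV) \<in> borel_measurable P" .
  have "(\<integral>\<^sup>+\<omega>. (\<integral>\<^sup>+i. ennreal \<bar>f (\<tau> i \<omega>)\<bar> \<partial>count_space UNIV) \<partial>P) \<noteq> \<infinity>"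
    using assms campbell_formula[of "\<lambda>u. ennreal \<bar>f u\<bar>"]
    by (simp add: integrable_iff_bounded ennreal_mult_eq_top_iff)
  then have "AE \<omega> in P. (\<integral>\<^sup>+i. ennreal \<bar>f (\<tau> i \<omega>)\<bar> \<partial>count_space UNIV) \<noteq> \<infinity>"
    by (intro nn_integral_PInf_AE) auto
  then show ?thesis
  proof eventually_elim
    case (elim \<omega>)
    then have "integrable (count_space UNIV) (\<lambda>i. f (\<tau> i \<omega>))"
      by (simp add: integrable_iff_bounded top.not_eq_extremum)
    then have "Infinite_Set_Sum.abs_summable_on (\<lambda>i. f (\<tau> i \<omega>)) UNIV" by (simp add: abs_summable_on_def)
    then show ?case unfolding abs_summable_equivalent[symmetric] by simp
  qed
qed

end

section \<open>Concentration for shot noise\<close>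

text \<open>\<open>q\<close> numbers the cells and \<open>p\<close> picks their right endpoints. The
  half-open cells form a genuine partition of \<open>{-M<..M}\<close>; the lost endpoint
  \<open>- M\<close> carries almost surely no point.\<close>

lemma interval_grid:
  fixes M \<delta> :: real
  assumes "M > 0" "\<delta> > 0"
  obtains n and q :: "real \<Rightarrow> nat" and p :: "nat \<Rightarrow> real"
  where "q \<in> measurable borel (count_space UNIV)"
    and "\<And>u. u \<in> {-M<..M} \<Longrightarrow> q u < n \<and> \<bar>p (q u) - u\<bar> < \<delta>"
    and "\<And>j. j < n \<Longrightarrow> p j \<in> {-M..M}"
proof -
  define n where "n = nat \<lceil>2 * M / \<delta>\<rceil> + 1"
  have "2 * M / \<delta> < real n" unfolding n_def using assms by linarith
  moreover have "n > 0" by (simp add: n_def)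
  ultimately have n: "2 * M / n < \<delta>" "n > 0" using assms by (auto simp: pos_divide_less_eq mult.commute)
  define q where "q u = nat (\<lceil>(u + M) * n / (2 * M)\<rceil> - 1)" for u :: real
  define p where "p j = - M + 2 * M * (real j + 1) / n" for j :: nat
  show thesis
  proof (rule that[of q n p])
    show "q \<in> measurable borel (count_space UNIV)" unfolding q_def by measurable
  next
    fix u assume u: "u \<in> {-M<..M}"
    define y where "y = (u + M) * n / (2 * M)"
    have "(u + M) * n \<le> 2 * M * n" using u by (intro mult_right_mono) auto
    then have y: "0 < y" "y \<le> n" using u assms n by (simp_all add: y_def pos_divide_le_eq mult.commute)
    then have c: "1 \<le> \<lceil>y\<rceil>" "\<lceil>y\<rceil> \<le> int n" by (simp_all add: ceiling_le_iff)
    have q: "real (q u) = real_of_int \<lceil>y\<rceil> - 1" "q u < n" using c n by (auto simp: q_def y_def[symmetric])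
    have "p (q u) - u = 2 * M / n * (\<lceil>y\<rceil> - y)"
      unfolding p_def q using assms n by (simp add: y_def field_simps)
    moreover have "0 \<le> \<lceil>y\<rceil> - y" "\<lceil>y\<rceil> - y \<le> 1" by linarith+
    ultimately have "\<bar>p (q u) - u\<bar> \<le> 2 * M / n * 1"
      using assms by (simp only: abs_mult) (intro mult_mono, auto)
    then show "q u < n \<and> \<bar>p (q u) - u\<bar> < \<delta>" using q n by simp
  next
    fix j assume "j < n"
    then have "real j + 1 \<le> real n" by linarith
    then have "2 * M * (real j + 1) \<le> 2 * M * n" using assms by (intro mult_left_mono) auto
    then have "2 * M * (real j + 1) / n \<le> 2 * M" using n by (simp add: pos_divide_le_eq)
    moreover have "0 \<le> 2 * M * (real j + 1) / n" using assms by simp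
    ultimately show "p j \<in> {-M..M}" unfolding p_def by simp
  qed
qed

text \<open>Disjointness makes the left side the integral of a step function below \<open>h\<close>.
  It converts the sums over cells back into the integrals that are known to be bounded.\<close>

lemma step_sum_le_nn_integral:
  fixes A :: "'j \<Rightarrow> real set" and h :: "real \<Rightarrow> real"
  assumes J: "finite J" and A: "\<And>j. j \<in> J \<Longrightarrow> A j \<in> sets borel" "\<And>j. j \<in> J \<Longrightarrow> emeasure lborel (A j) < \<infinity>"
    "\<And>j. j \<in> J \<Longrightarrow> A j \<subseteq> D" "disjoint_family_on A J"
    and c: "\<And>j. j \<in> J \<Longrightarrow> c j \<ge> 0" "\<And>j u. j \<in> J \<Longrightarrow> u \<in> A j \<Longrightarrow> c j \<le> h u"
    and H: "(\<integral>\<^sup>+u. ennreal (h u) * indicator D u \<partial>lborel) \<le> ennreal H" "H \<ge> 0"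
  shows "(\<Sum>j\<in>J. c j * measure lborel (A j)) \<le> H"
proof -
  have "ennreal (\<Sum>j\<in>J. c j * measure lborel (A j)) = (\<Sum>j\<in>J. ennreal (c j) * emeasure lborel (A j))"
  proof (intro sum_eq_ennreal_sum[symmetric])
    fix j assume j: "j \<in> J"
    then have "emeasure lborel (A j) = ennreal (measure lborel (A j))"
      using A(2)[OF j] by (intro emeasure_eq_ennreal_measure) auto
    then show "ennreal (c j) * emeasure lborel (A j) = ennreal (c j * measure lborel (A j))"
      using c(1)[OF j] by (simp add: ennreal_mult)
  qed (use c(1) in auto)
  also have "\<dots> = (\<Sum>j\<in>J. (\<integral>\<^sup>+u. ennreal (c j) * indicator (A j) u \<partial>lborel))"
    using A(1) by (intro sum.cong refl) (simp add: nn_integral_cmult_indicator)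
  also have "\<dots> = (\<integral>\<^sup>+u. (\<Sum>j\<in>J. ennreal (c j) * indicator (A j) u) \<partial>lborel)"
    using A(1) by (intro nn_integral_sum[symmetric]) (auto intro!: borel_measurable_times_ennreal borel_measurable_indicator)
  also have "\<dots> \<le> (\<integral>\<^sup>+u. ennreal (h u) * indicator D u \<partial>lborel)"
  proof (intro nn_integral_mono)
    fix u
    show "(\<Sum>j\<in>J. ennreal (c j) * indicator (A j) u) \<le> ennreal (h u) * indicator D u"
    proof (cases "\<exists>j\<in>J. u \<in> A j")
      case True
      then obtain j where j: "j \<in> J" "u \<in> A j" by blast
      have "u \<notin> A i" if "i \<in> J" "i \<noteq> j" for i
        using A(4) j that by (auto simp: disjoint_family_on_def)
      then have "{i \<in> J. u \<in> A i} = {j}" using j by auto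
      then have "(\<Sum>i\<in>J. ennreal (c i) * indicator (A i) u) = ennreal (c j)"
        using J by simp
      moreover have "u \<in> D" using A(3)[OF j(1)] j(2) by blast
      ultimately show ?thesis using ennreal_leI[OF c(2)[OF j]] by simp
    qed auto
  qed
  also note H(1)
  finally show ?thesis using H(2) by simp
qed

section \<open>From cell counts to continuous functions of the points\<close>

context homogeneous_poisson_process begin

lemma point_sum_eq_sum:
  assumes "finite {i. \<tau> i \<omega> \<in> D}"
  shows "point_sum \<tau> D f \<omega> = (\<Sum>i | \<tau> i \<omega> \<in> D. f (\<tau> i \<omega>))"
  using assms by (simp add: point_sum_def)

lemma sum_cells:
  assumes "finite {i. \<tau> i \<omega> \<in> D}" and "\<And>u. u \<in> D \<Longrightarrow> q u \<in> J" and "finite J"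
  shows "(\<Sum>j\<in>J. c j * real (point_count \<tau> {u \<in> D. q u = j} \<omega>)) = (\<Sum>i | \<tau> i \<omega> \<in> D. c (q (\<tau> i \<omega>)))"
proof -
  have "(\<Sum>j\<in>J. c j * real (point_count \<tau> {u \<in> D. q u = j} \<omega>))
      = (\<Sum>j\<in>J. \<Sum>i | i \<in> {i. \<tau> i \<omega> \<in> D} \<and> q (\<tau> i \<omega>) = j. c (q (\<tau> i \<omega>)))"
    by (intro sum.cong refl) (simp add: point_count_def)
  also have "\<dots> = (\<Sum>i | \<tau> i \<omega> \<in> D. c (q (\<tau> i \<omega>)))"
    using assms by (intro sum.group) auto
  finally show ?thesis .
qed

text \<open>The count of a null set is Poisson with rate 0, and \<open>0 ^ 0 = 1\<close> makes the
  value 0 certain. Finiteness excludes the case in which \<open>card\<close> is 0 for an infinite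
  set.\<close>

lemma AE_not_point: "AE \<omega> in P. \<forall>i. \<tau> i \<omega> \<noteq> x"
proof -
  have "prob {\<omega> \<in> space P. point_count \<tau> {x} \<omega> = 0} = 1"
    by (subst poisson_count) auto
  then have "AE \<omega> in P. \<omega> \<in> {\<omega> \<in> space P. point_count \<tau> {x} \<omega> = 0}"
    by (rule AE_prob_1)
  moreover have "AE \<omega> in P. finite {i. \<tau> i \<omega> \<in> {x}}"
    by (intro finite_count) auto
  ultimately show ?thesis
    by eventually_elim (auto simp: point_count_def)
qed


text \<open>Here \<open>x1\<close> plays the derivative of \<open>x\<close>, seen only through
  \<open>level\<close> and \<open>rsqrt\<close>. Replacing each point by the representative of its
  cell changes \<open>x\<close> by less than \<epsilon> per point; raising the tolerance by a
  multiple of \<epsilon> per point compensates, however many points there are. Then \<epsilon> tends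
  to 0.\<close>

lemma window_concentration_strict:
  fixes x x1 b :: "real \<Rightarrow> real"
  assumes T: "0 < T" "T \<le> M"
    and cont: "continuous_on UNIV x" "continuous_on UNIV x1" "continuous_on UNIV b"
    and b: "\<And>u. b u \<ge> 0" "\<And>u. u \<in> {-T..T} \<Longrightarrow> b u \<le> \<beta>"
    and level: "\<And>c r. r \<ge> 0 \<Longrightarrow>
      (\<integral>\<^sup>+u. ennreal (indicator {c - r<..<c + r} (x u) * \<bar>x1 u\<bar>) * indicator {-T..T} u \<partial>lborel) \<le> ennreal (C1 * r)"
    and rsqrt: "\<And>\<epsilon>. 0 < \<epsilon> \<Longrightarrow> \<epsilon> \<le> 1 \<Longrightarrow>
      (\<integral>\<^sup>+u. ennreal (1 / sqrt (\<bar>x1 u\<bar> + \<epsilon>)) * indicator {-T..T} u \<partial>lborel) \<le> ennreal C3"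
    and C: "C1 \<ge> 0" "C3 \<ge> 0" and k: "k \<ge> 3"
    and J: "(\<integral>\<^sup>+u. ennreal (b u) * indicator ({-M..M} - {-T..T}) u \<partial>lborel) \<le> ennreal J" "J \<ge> 0"
  shows "prob {\<omega> \<in> space P. \<bar>point_sum \<tau> {-M..M} x \<omega> - \<alpha>\<bar> < point_sum \<tau> {-M..M} b \<omega> \<and> k \<le> point_count \<tau> {-T..T} \<omega>}
      \<le> rate * C1 * (2 * \<beta> + rate * J) * (rate * C3)\<^sup>2" (is "prob ?E \<le> _")
proof -
  define bound where "bound \<epsilon> = (2 * (rate * C1) * (\<beta> + 3 * \<epsilon>) + rate * (C1 * \<epsilon> + 6 * \<epsilon> * T)
      + rate * C1 * (rate * (J + 6 * \<epsilon> * M))) * (rate * C3)\<^sup>2" for \<epsilon>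
  have [measurable]: "x \<in> borel_measurable borel" "x1 \<in> borel_measurable borel" "b \<in> borel_measurable borel"
    using cont by (auto intro: borel_measurable_continuous_onI)
  have "b 0 \<le> \<beta>" using T by (intro b(2)) auto
  then have \<beta>: "\<beta> \<ge> 0" using b(1)[of 0] by simp
  have approx: "prob ?E \<le> bound \<epsilon>" if \<epsilon>: "0 < \<epsilon>" "\<epsilon> \<le> 1" for \<epsilon>
  proof -
    have unif: "\<exists>\<delta>>0. \<forall>u\<in>{-M..M}. \<forall>v\<in>{-M..M}. \<bar>v - u\<bar> < \<delta> \<longrightarrow> \<bar>f v - f u\<bar> < \<epsilon>"
      if "continuous_on UNIV f" for f :: "real \<Rightarrow> real"
    proof -
      have "uniformly_continuous_on {-M..M} f"
        using that by (intro compact_uniformly_continuous) (auto intro: continuous_on_subset)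
      then show ?thesis using \<epsilon> unfolding uniformly_continuous_on_def dist_real_def by blast
    qed
    obtain d1 where d1: "d1 > 0" "\<forall>u\<in>{-M..M}. \<forall>v\<in>{-M..M}. \<bar>v - u\<bar> < d1 \<longrightarrow> \<bar>x v - x u\<bar> < \<epsilon>"
      using unif[OF cont(1)] by blast
    obtain d2 where d2: "d2 > 0" "\<forall>u\<in>{-M..M}. \<forall>v\<in>{-M..M}. \<bar>v - u\<bar> < d2 \<longrightarrow> \<bar>x1 v - x1 u\<bar> < \<epsilon>"
      using unif[OF cont(2)] by blast
    obtain d3 where d3: "d3 > 0" "\<forall>u\<in>{-M..M}. \<forall>v\<in>{-M..M}. \<bar>v - u\<bar> < d3 \<longrightarrow> \<bar>b v - b u\<bar> < \<epsilon>"
      using unif[OF cont(3)] by blast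
    define \<delta> where "\<delta> = min d1 (min d2 d3)"
    have M\<delta>: "M > 0" "\<delta> > 0" using T d1(1) d2(1) d3(1) by (auto simp: \<delta>_def)
    obtain n and q0 :: "real \<Rightarrow> nat" and p0 :: "nat \<Rightarrow> real" where
      [measurable]: "q0 \<in> measurable borel (count_space UNIV)"
      and q0: "\<And>u. u \<in> {-M<..M} \<Longrightarrow> q0 u < n \<and> \<bar>p0 (q0 u) - u\<bar> < \<delta>"
      and p0: "\<And>j. j < n \<Longrightarrow> p0 j \<in> {-M..M}" by (rule interval_grid[OF M\<delta>], rule that) blast+
    define D where "D = {-M<..M}"
    \<comment> \<open>Shifting the cell numbers outside the window by \<open>n\<close> ensures that
      no cell straddles its boundary, at the cost of \<open>2 * n\<close> indices.\<close>
    define q where "q u = (if \<bar>u\<bar> \<le> T then q0 u else n + q0 u)" for u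
    define p where "p j = p0 (if j < n then j else j - n)" for j
    define A where "A j = {u \<in> D. q u = j}" for j
    \<comment> \<open>Empty cells are dropped: bounding \<open>bs j\<close> in terms of
      \<open>\<beta>\<close> requires some \<open>u\<close> of the window in cell \<open>j\<close>,
      since the representative \<open>p j\<close> may itself lie outside.\<close>
    define W where "W = {j. j < n \<and> A j \<noteq> {}}"
    define xs where "xs j = x (p j)" for j
    \<comment> \<open>One \<open>\<epsilon>\<close> absorbs the discretisation error of \<open>b\<close>, the other that of \<open>x\<close>; likewise in \<open>s\<close>
      one makes it dominate \<open>\<bar>x1\<bar>\<close> and the other keeps it away from 0.\<close>
    define bs where "bs j = b (p j) + 2 * \<epsilon>" for j
    define s where "s j = \<bar>x1 (p j)\<bar> + 2 * \<epsilon>" for j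
    define \<mu> where "\<mu> j = rate * measure lborel (A j)" for j
    have [measurable]: "q \<in> measurable borel (count_space UNIV)" unfolding q_def by measurable
    have D_sub: "u \<in> D \<Longrightarrow> u \<in> {-M..M}" for u by (auto simp: D_def)
    have q_less: "q u < 2 * n" and p_q: "p (q u) \<in> {-M..M}" "\<bar>p (q u) - u\<bar> < \<delta>" if "u \<in> D" for u
      using q0[of u] p0[of "q0 u"] that by (auto simp: q_def p_def D_def)
    have close: "\<bar>x (p (q u)) - x u\<bar> < \<epsilon>" "\<bar>x1 (p (q u)) - x1 u\<bar> < \<epsilon>" "\<bar>b (p (q u)) - b u\<bar> < \<epsilon>"
      if "u \<in> D" for u
      using d1(2) d2(2) d3(2) D_sub[OF that] p_q(1)[OF that] p_q(2)[OF that] by (auto simp: \<delta>_def)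
    have A_sets: "A j \<in> sets borel" for j
    proof -
      have "A j = {u \<in> space borel. u \<in> D \<and> q u = j}" by (auto simp: A_def)
      also have "\<dots> \<in> sets borel" unfolding D_def by measurable
      finally show ?thesis .
    qed
    have A_fin: "emeasure lborel (A j) < \<infinity>" for j
    proof -
      have "emeasure lborel (A j) \<le> emeasure lborel D" by (intro emeasure_mono) (auto simp: A_def D_def)
      also have "\<dots> < \<infinity>" using T by (simp add: D_def)
      finally show ?thesis .
    qed
    have A_disj: "disjoint_family_on A I" for I by (auto simp: disjoint_family_on_def A_def)
    have A_W: "A j \<subseteq> {-T..T}" if "j \<in> W" for j
      using that by (auto simp: W_def A_def q_def split: if_splits)
    have A_O: "A j \<subseteq> {-M..M} - {-T..T}" if "j \<in> {..<2 * n} - W" for j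
    proof
      fix u assume u: "u \<in> A j"
      then have "j \<ge> n" using that by (auto simp: W_def)
      then show "u \<in> {-M..M} - {-T..T}" using u q0[of u] by (auto simp: A_def q_def D_def split: if_splits)
    qed
    have finW: "finite W" by (simp add: W_def)
    have s_pos: "s j > 0" for j using \<epsilon> by (auto simp: s_def)
    have bs_nonneg: "bs j \<ge> 0" for j using b(1) \<epsilon> by (auto simp: bs_def)
    have bs_le: "bs j \<le> b u + 3 * \<epsilon>" if "u \<in> A j" for u j
      using close(3)[of u] that by (auto simp: A_def bs_def)
    have \<mu>_nonneg: "\<mu> j \<ge> 0" for j using rate_pos by (simp add: \<mu>_def)
    have level_sum: "(\<Sum>j\<in>W. \<mu> j * s j * indicator {c - r<..<c + r} (xs j)) \<le> rate * C1 * r + rate * (C1 * \<epsilon> + 6 * \<epsilon> * T)"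
      if "r \<ge> 0" for c r
    proof -
      \<comment> \<open>Going from \<open>p j\<close> to \<open>u\<close> moves \<open>x\<close> by
        less than \<epsilon>, hence the larger radius, and leaves \<open>s j\<close> at most
        \<open>\<bar>x1 u\<bar> + 3 * \<epsilon>\<close>; over the window of length
        \<open>2 * T\<close> the excess integrates to \<open>6 * \<epsilon> * T\<close>.\<close>
      define h where "h u = indicator {c - (r + \<epsilon>)<..<c + (r + \<epsilon>)} (x u) * \<bar>x1 u\<bar> + 3 * \<epsilon>" for u
      have "(\<integral>\<^sup>+u. ennreal (h u) * indicator {-T..T} u \<partial>lborel)
          = (\<integral>\<^sup>+u. ennreal (indicator {c - (r + \<epsilon>)<..<c + (r + \<epsilon>)} (x u) * \<bar>x1 u\<bar>) * indicator {-T..T} u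
              + ennreal (3 * \<epsilon>) * indicator {-T..T} u \<partial>lborel)"
        using \<epsilon> unfolding h_def by (intro nn_integral_cong) (simp add: ennreal_plus distrib_right)
      also have "\<dots> = (\<integral>\<^sup>+u. ennreal (indicator {c - (r + \<epsilon>)<..<c + (r + \<epsilon>)} (x u) * \<bar>x1 u\<bar>) * indicator {-T..T} u \<partial>lborel)
              + (\<integral>\<^sup>+u. ennreal (3 * \<epsilon>) * indicator {-T..T} u \<partial>lborel)"
        by (intro nn_integral_add) auto
      also have "\<dots> \<le> ennreal (C1 * (r + \<epsilon>)) + ennreal (3 * \<epsilon> * (2 * T))"
        using that \<epsilon> T by (intro add_mono level) (simp_all add: nn_integral_cmult_indicator flip: ennreal_mult)
      also have "\<dots> = ennreal (C1 * (r + \<epsilon>) + 6 * \<epsilon> * T)"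
        using that \<epsilon> T C by (simp flip: ennreal_plus)
      finally have h: "(\<integral>\<^sup>+u. ennreal (h u) * indicator {-T..T} u \<partial>lborel) \<le> ennreal (C1 * (r + \<epsilon>) + 6 * \<epsilon> * T)" .
      have "(\<Sum>j\<in>W. (s j * indicator {c - r<..<c + r} (xs j)) * measure lborel (A j)) \<le> C1 * (r + \<epsilon>) + 6 * \<epsilon> * T"
      proof (rule step_sum_le_nn_integral[OF finW A_sets A_fin A_W A_disj _ _ h])
        fix j u assume "j \<in> W" and u: "u \<in> A j"
        have "\<bar>xs j - x u\<bar> < \<epsilon>" "s j \<le> \<bar>x1 u\<bar> + 3 * \<epsilon>"
          using close[of u] u by (auto simp: A_def xs_def s_def)
        then show "s j * indicator {c - r<..<c + r} (xs j) \<le> h u"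
          using \<epsilon> by (auto simp: h_def split: split_indicator)
      qed (use s_pos that \<epsilon> T C in \<open>auto simp: less_imp_le\<close>)
      from mult_left_mono[OF this, of rate] show ?thesis
        using rate_pos by (simp add: sum_distrib_left \<mu>_def mult_ac distrib_left)
    qed
    have rsqrt_sum: "(\<Sum>j\<in>W. \<mu> j / sqrt (s j)) \<le> rate * C3"
    proof -
      have "(\<Sum>j\<in>W. (1 / sqrt (s j)) * measure lborel (A j)) \<le> C3"
      proof (rule step_sum_le_nn_integral[OF finW A_sets A_fin A_W A_disj _ _ rsqrt[OF \<epsilon>]])
        fix j u assume "j \<in> W" and u: "u \<in> A j"
        have "\<bar>x1 u\<bar> + \<epsilon> \<le> s j" using close[of u] u by (auto simp: A_def s_def)
        moreover have "0 < \<bar>x1 u\<bar> + \<epsilon>" using \<epsilon> by linarith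
        ultimately show "1 / sqrt (s j) \<le> 1 / sqrt (\<bar>x1 u\<bar> + \<epsilon>)"
          using s_pos[of j] by (intro divide_left_mono) auto
      qed (use s_pos C in \<open>auto simp: less_imp_le\<close>)
      from mult_left_mono[OF this, of rate] show ?thesis
        using rate_pos by (simp add: sum_distrib_left \<mu>_def mult_ac)
    qed
    have outside_sum: "(\<Sum>j\<in>{..<2 * n} - W. bs j * \<mu> j) \<le> rate * (J + 6 * \<epsilon> * M)"
    proof -
      have "(\<integral>\<^sup>+u. ennreal (b u + 3 * \<epsilon>) * indicator ({-M..M} - {-T..T}) u \<partial>lborel)
          \<le> (\<integral>\<^sup>+u. ennreal (b u) * indicator ({-M..M} - {-T..T}) u + ennreal (3 * \<epsilon>) * indicator {-M..M} u \<partial>lborel)"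
        using b(1) \<epsilon> by (intro nn_integral_mono) (auto simp: ennreal_plus split: split_indicator)
      also have "\<dots> = (\<integral>\<^sup>+u. ennreal (b u) * indicator ({-M..M} - {-T..T}) u \<partial>lborel)
          + (\<integral>\<^sup>+u. ennreal (3 * \<epsilon>) * indicator {-M..M} u \<partial>lborel)"
        by (intro nn_integral_add) auto
      also have "\<dots> \<le> ennreal J + ennreal (3 * \<epsilon> * (2 * M))"
        using \<epsilon> T by (intro add_mono J) (simp_all add: nn_integral_cmult_indicator flip: ennreal_mult)
      also have "\<dots> = ennreal (J + 6 * \<epsilon> * M)"
        using \<epsilon> T J(2) by (simp flip: ennreal_plus)
      finally have h: "(\<integral>\<^sup>+u. ennreal (b u + 3 * \<epsilon>) * indicator ({-M..M} - {-T..T}) u \<partial>lborel) \<le> ennreal (J + 6 * \<epsilon> * M)" .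
      have "(\<Sum>j\<in>{..<2 * n} - W. bs j * measure lborel (A j)) \<le> J + 6 * \<epsilon> * M"
        by (rule step_sum_le_nn_integral[OF _ A_sets A_fin A_O A_disj _ _ h])
          (use bs_nonneg bs_le \<epsilon> T J(2) in auto)
      from mult_left_mono[OF this, of rate] show ?thesis
        using rate_pos by (simp add: sum_distrib_left \<mu>_def mult_ac)
    qed
    have outside_nonneg: "0 \<le> (\<Sum>j\<in>{..<2 * n} - W. bs j * \<mu> j)"
      by (intro sum_nonneg mult_nonneg_nonneg bs_nonneg \<mu>_nonneg)
    have "prob {\<omega> \<in> space P. \<bar>(\<Sum>j<2 * n. xs j * point_count \<tau> (A j) \<omega>) - \<alpha>\<bar> < (\<Sum>j<2 * n. bs j * point_count \<tau> (A j) \<omega>)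
           \<and> k \<le> (\<Sum>j\<in>W. point_count \<tau> (A j) \<omega>)}
        \<le> (2 * (rate * C1) * (\<beta> + 3 * \<epsilon>) + rate * (C1 * \<epsilon> + 6 * \<epsilon> * T) + rate * C1 * (\<Sum>j\<in>{..<2 * n} - W. bs j * \<mu> j))
           * (\<Sum>j\<in>W. \<mu> j / sqrt (s j))\<^sup>2" (is "prob ?F \<le> _")
    proof (rule poisson_vector_concentration)
      show "indep_vars (\<lambda>_. count_space UNIV) (\<lambda>j. point_count \<tau> (A j)) {..<2 * n}"
        using A_sets A_fin A_disj by (intro indep_counts) auto
      show "prob {\<omega> \<in> space P. point_count \<tau> (A j) \<omega> = k} = \<mu> j ^ k / fact k * exp (- \<mu> j)" for j k
        unfolding \<mu>_def using A_sets A_fin by (intro poisson_count)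
      show "bs j \<le> \<beta> + 3 * \<epsilon>" if "j \<in> W" for j
      proof -
        obtain u where u: "u \<in> A j" using \<open>j \<in> W\<close> by (auto simp: W_def)
        with A_W[OF that] have "b u \<le> \<beta>" by (intro b(2)) auto
        with bs_le[OF u] show ?thesis by simp
      qed
    qed (use \<mu>_nonneg s_pos bs_nonneg level_sum rate_pos C \<epsilon> T \<beta> k in \<open>auto simp: W_def\<close>)
    also have "\<dots> \<le> bound \<epsilon>"
      unfolding bound_def
    proof (intro mult_mono power_mono add_left_mono mult_left_mono)
      show "0 \<le> (\<Sum>j\<in>W. \<mu> j / sqrt (s j))"
        using \<mu>_nonneg s_pos by (intro sum_nonneg) (auto simp: less_imp_le)
    qed (use outside_nonneg outside_sum rsqrt_sum rate_pos C \<epsilon> T \<beta> J(2) in auto)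
    finally have "prob ?F \<le> bound \<epsilon>" .
    \<comment> \<open>Off the null events of infinitely many points in \<open>{-M..M}\<close> or a
      point at \<open>- M\<close>, the strict inequality for point sums implies the one for cell
      sums.\<close>
    moreover have "prob ?E \<le> prob ?F"
    proof (rule finite_measure_mono_AE)
      have [measurable]: "point_count \<tau> (A j) \<in> measurable P (count_space UNIV)" for j
        using A_sets A_fin by (intro measurable_point_count)
      show "?F \<in> events" by measurable
      have "AE \<omega> in P. finite {i. \<tau> i \<omega> \<in> {-M..M}}"
        using T by (intro finite_count) auto
      then show "AE \<omega> in P. \<omega> \<in> ?E \<longrightarrow> \<omega> \<in> ?F"
        using AE_not_point[of "- M"]
      proof eventually_elim
        case (elim \<omega>)
        have D_eq: "{i. \<tau> i \<omega> \<in> {-M..M}} = {i. \<tau> i \<omega> \<in> D}"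
          using elim(2) by (auto simp: D_def le_less)
        then have fin: "finite {i. \<tau> i \<omega> \<in> D}" using elim(1) by simp
        have ps: "point_sum \<tau> {-M..M} f \<omega> = (\<Sum>i | \<tau> i \<omega> \<in> D. f (\<tau> i \<omega>))" for f
          using elim(1) by (simp only: point_sum_eq_sum D_eq)
        have cells: "(\<Sum>j<2 * n. c j * point_count \<tau> (A j) \<omega>) = (\<Sum>i | \<tau> i \<omega> \<in> D. c (q (\<tau> i \<omega>)))"
          for c :: "nat \<Rightarrow> real"
          unfolding A_def using q_less by (intro sum_cells fin) auto
        have "(\<Sum>j\<in>W. point_count \<tau> (A j) \<omega>) = point_count \<tau> {-T..T} \<omega>"
        proof -
          have "real (\<Sum>j\<in>W. point_count \<tau> (A j) \<omega>) = (\<Sum>j\<in>W. 1 * real (point_count \<tau> {u \<in> D \<inter> {-T..T}. q u = j} \<omega>))"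
          proof -
            have "A j = {u \<in> D \<inter> {-T..T}. q u = j}" if "j \<in> W" for j
              using A_W[OF that] by (auto simp: A_def)
            then show ?thesis by simp
          qed
          also have "\<dots> = (\<Sum>i | \<tau> i \<omega> \<in> D \<inter> {-T..T}. 1)"
          proof (intro sum_cells finW)
            show "finite {i. \<tau> i \<omega> \<in> D \<inter> {-T..T}}" by (rule finite_subset[OF _ fin]) auto
            show "q u \<in> W" if "u \<in> D \<inter> {-T..T}" for u
              using that q0[of u] by (auto simp: W_def A_def q_def D_def)
          qed
          also have "{i. \<tau> i \<omega> \<in> D \<inter> {-T..T}} = {i. \<tau> i \<omega> \<in> {-T..T}}"
            using elim(2) T by (auto simp: D_def le_less)
          finally have "real (\<Sum>j\<in>W. point_count \<tau> (A j) \<omega>) = real (point_count \<tau> {-T..T} \<omega>)"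
            by (simp add: point_count_def)
          then show ?thesis by (rule of_nat_eq_iff[THEN iffD1])
        qed
        moreover have "\<bar>(\<Sum>j<2 * n. xs j * point_count \<tau> (A j) \<omega>) - \<alpha>\<bar> < (\<Sum>j<2 * n. bs j * point_count \<tau> (A j) \<omega>)"
          if "\<omega> \<in> ?E"
        proof -
          have "\<bar>(\<Sum>i | \<tau> i \<omega> \<in> D. xs (q (\<tau> i \<omega>))) - (\<Sum>i | \<tau> i \<omega> \<in> D. x (\<tau> i \<omega>))\<bar>
              \<le> (\<Sum>i | \<tau> i \<omega> \<in> D. \<epsilon>)"
            unfolding sum_subtractf[symmetric] xs_def
            by (intro order_trans[OF sum_abs] sum_mono) (use close(1) in \<open>auto intro: less_imp_le\<close>)
          moreover have "(\<Sum>i | \<tau> i \<omega> \<in> D. b (\<tau> i \<omega>)) + (\<Sum>i | \<tau> i \<omega> \<in> D. \<epsilon>) \<le> (\<Sum>i | \<tau> i \<omega> \<in> D. bs (q (\<tau> i \<omega>)))"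
            unfolding sum.distrib[symmetric]
          proof (intro sum_mono)
            fix i assume "i \<in> {i. \<tau> i \<omega> \<in> D}"
            with close(3)[of "\<tau> i \<omega>"] show "b (\<tau> i \<omega>) + \<epsilon> \<le> bs (q (\<tau> i \<omega>))" by (auto simp: bs_def)
          qed
          moreover have "\<bar>(\<Sum>i | \<tau> i \<omega> \<in> D. x (\<tau> i \<omega>)) - \<alpha>\<bar> < (\<Sum>i | \<tau> i \<omega> \<in> D. b (\<tau> i \<omega>))"
            using that by (simp add: ps)
          ultimately show ?thesis unfolding cells by linarith
        qed
        ultimately show ?case by auto
      qed
    qed
    ultimately show ?thesis by linarith
  qed
  have "(bound \<longlongrightarrow> bound 0) (at_right 0)"
    unfolding bound_def by (intro tendsto_intros)
  moreover have "\<forall>\<^sub>F \<epsilon> in at_right 0. prob ?E \<le> bound \<epsilon>"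
    unfolding eventually_at_right_field using approx by (intro exI[of _ 1]) auto
  ultimately have "prob ?E \<le> bound 0"
    by (intro tendsto_lowerbound) auto
  then show ?thesis by (simp add: bound_def algebra_simps)
qed

end

section \<open>Crossings and sign changes on dyadic grids\<close>

definition dyadic_pt :: "real \<Rightarrow> real \<Rightarrow> nat \<Rightarrow> nat \<Rightarrow> real" where
  "dyadic_pt a b m k = a + (b - a) * k / 2 ^ m"

text \<open>A grid value equal to \<alpha> yields no sign change. This keeps the count below the
  number of crossings, since a crossing at a shared grid point is never counted twice.\<close>

definition sign_changes :: "(real \<Rightarrow> real) \<Rightarrow> real \<Rightarrow> real \<Rightarrow> real \<Rightarrow> nat \<Rightarrow> nat" where
  "sign_changes f \<alpha> a b m =
     card {k. k < 2 ^ m \<and> (f (dyadic_pt a b m k) - \<alpha>) * (f (dyadic_pt a b m (Suc k)) - \<alpha>) < 0}"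

section \<open>Deterministic comparison of crossings with sign changes\<close>

context
  fixes a b :: real
  assumes ab: "a \<le> b"
begin

private abbreviation "t \<equiv> dyadic_pt a b"

lemma dyadic_pt_0: "t m 0 = a" and dyadic_pt_last: "t m (2 ^ m) = b"
  by (simp_all add: dyadic_pt_def)

lemma dyadic_pt_mono: "j \<le> k \<Longrightarrow> t m j \<le> t m k"
  using ab by (auto simp: dyadic_pt_def intro!: divide_right_mono mult_left_mono)

lemma dyadic_pt_mem: "k \<le> 2 ^ m \<Longrightarrow> t m k \<in> {a..b}"
  using dyadic_pt_mono[of 0 k m] dyadic_pt_mono[of k "2 ^ m" m] by (simp add: dyadic_pt_0 dyadic_pt_last)

lemma dyadic_pt_Suc: "t m (Suc k) - t m k = (b - a) / 2 ^ m"
  by (simp add: dyadic_pt_def field_simps)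

lemma dyadic_pt_double: "t (Suc m) (2 * k) = t m k"
  by (simp add: dyadic_pt_def)

lemma dyadic_cell_exists:
  assumes "s \<in> {a..b}"
  obtains k where "k < 2 ^ m" "s \<in> {t m k..t m (Suc k)}"
proof -
  define S where "S = {k. k < 2 ^ m \<and> t m k \<le> s}"
  have S: "finite S" "0 \<in> S" using assms by (auto simp: S_def dyadic_pt_0)
  define k where "k = Max S"
  have k: "k \<in> S" using S by (auto simp: k_def intro!: Max_in)
  have "s \<le> t m (Suc k)"
  proof (cases "Suc k < 2 ^ m")
    case True
    have "Suc k \<notin> S" using Max_ge[OF S(1), of "Suc k"] by (auto simp: k_def)
    then show ?thesis using True by (auto simp: S_def)
  next
    case False
    then have "Suc k = 2 ^ m" using k by (simp add: S_def)
    then show ?thesis using assms by (simp add: dyadic_pt_last)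
  qed
  with k that show thesis by (auto simp: S_def)
qed

lemma of_nat_le_crossings:
  assumes "finite F" "F \<subseteq> {s \<in> S. f s = \<alpha>}"
  shows "of_nat (card F) \<le> crossings f \<alpha> S"
proof -
  have "of_nat (card F) = emeasure (count_space UNIV) F" using assms(1) by simp
  also have "\<dots> \<le> crossings f \<alpha> S" unfolding crossings_def using assms(2) by (intro emeasure_mono) auto
  finally show ?thesis .
qed

text \<open>Testing on finite sets of crossings treats the infinite case too: arbitrarily large
  finite subsets force \<open>c\<close> to be infinite.\<close>

lemma crossings_le:
  assumes "\<And>F. finite F \<Longrightarrow> F \<subseteq> {s \<in> S. f s = \<alpha>} \<Longrightarrow> of_nat (card F) \<le> c"
  shows "crossings f \<alpha> S \<le> c"
proof (cases "finite {s \<in> S. f s = \<alpha>}")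
  case True
  then show ?thesis using assms[OF True] by (simp add: crossings_def)
next
  case False
  have "of_nat n \<le> c" for n
  proof -
    obtain F where "finite F" "card F = n" "F \<subseteq> {s \<in> S. f s = \<alpha>}"
      using infinite_arbitrarily_large[OF False] by blast
    then show ?thesis using assms by blast
  qed
  then have "\<not> c < \<top>" using ennreal_Ex_less_of_nat[of c] by (auto simp: not_less[symmetric])
  then have "c = \<top>" by (simp add: not_less top_unique)
  then show ?thesis by simp
qed

text \<open>The intermediate value theorem gives a crossing in each sign-changing cell. It is
  interior because both end values differ from \<alpha>, so different cells give different
  crossings.\<close>

lemma sign_changes_le_crossings:
  assumes cont: "continuous_on {a..b} f"
  shows "of_nat (sign_changes f \<alpha> a b m) \<le> crossings f \<alpha> {a..b}"
proof -
  define S where "S = {k. k < 2 ^ m \<and> (f (t m k) - \<alpha>) * (f (t m (Suc k)) - \<alpha>) < 0}"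
  have "\<exists>s. t m k < s \<and> s < t m (Suc k) \<and> f s = \<alpha>" if k: "k \<in> S" for k
  proof -
    have le: "t m k \<le> t m (Suc k)" by (rule dyadic_pt_mono) simp
    have "t m k \<in> {a..b}" "t m (Suc k) \<in> {a..b}"
      using k dyadic_pt_mem[of k m] dyadic_pt_mem[of "Suc k" m] by (simp_all add: S_def)
    then have c: "continuous_on {t m k..t m (Suc k)} f" by (intro continuous_on_subset[OF cont]) auto
    have "(f (t m k) < \<alpha> \<and> \<alpha> < f (t m (Suc k))) \<or> (f (t m (Suc k)) < \<alpha> \<and> \<alpha> < f (t m k))"
      using k by (auto simp: S_def mult_less_0_iff)
    then have "\<exists>s\<ge>t m k. s \<le> t m (Suc k) \<and> f s = \<alpha>" "f (t m k) \<noteq> \<alpha>" "f (t m (Suc k)) \<noteq> \<alpha>"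
      using IVT'[OF _ _ le c, of \<alpha>] IVT2'[OF _ _ le c, of \<alpha>] by auto
    then show ?thesis by (metis order_le_less)
  qed
  then obtain s where s: "\<And>k. k \<in> S \<Longrightarrow> t m k < s k \<and> s k < t m (Suc k) \<and> f (s k) = \<alpha>" by metis
  have lt: "s j < s k" if "j \<in> S" "k \<in> S" "j < k" for j k
    using s[OF that(1)] s[OF that(2)] dyadic_pt_mono[of "Suc j" k m] that(3) by auto
  have inj: "inj_on s S"
    by (rule inj_onI) (metis lt less_irrefl linorder_neqE_nat)
  have "s k \<in> {a..b}" if "k \<in> S" for k
    using s[OF that] dyadic_pt_mem[of k m] dyadic_pt_mem[of "Suc k" m] that by (auto simp: S_def)
  then have "of_nat (card (s ` S)) \<le> crossings f \<alpha> {a..b}"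
    using s by (intro of_nat_le_crossings) (auto simp: S_def)
  then show ?thesis unfolding sign_changes_def S_def[symmetric] by (simp add: card_image[OF inj])
qed

text \<open>Once the mesh is below the smallest gap in a finite set of crossings, these lie in
  distinct cells. Each such cell changes sign, or the interpolation error \<open>B\<close> forces an
  end value to within \<open>B\<close> of \<alpha>. The lower limit is the form to which Fatou's
  lemma applies.\<close>

lemma crossings_le_liminf:
  fixes B :: "nat \<Rightarrow> nat \<Rightarrow> real"
  assumes interp: "\<And>m k s. k < 2 ^ m \<Longrightarrow> s \<in> {t m k..t m (Suc k)} \<Longrightarrow>
      min (f (t m k)) (f (t m (Suc k))) - B m k \<le> f s \<and> f s \<le> max (f (t m k)) (f (t m (Suc k))) + B m k"
  shows "crossings f \<alpha> {a..b} \<le> liminf (\<lambda>m. of_nat (sign_changes f \<alpha> a b m +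
      card {k. k < 2 ^ m \<and> (\<bar>f (t m k) - \<alpha>\<bar> \<le> B m k \<or> \<bar>f (t m (Suc k)) - \<alpha>\<bar> \<le> B m k)}))"
    (is "_ \<le> ?L")
proof (rule crossings_le)
  fix F assume F: "finite F" "F \<subseteq> {s \<in> {a..b}. f s = \<alpha>}"
  have "(\<lambda>m. (b - a) / 2 ^ m) \<longlonglongrightarrow> 0" by real_asymp
  then have "\<forall>\<^sub>F m in sequentially. (b - a) / 2 ^ m < g" if "g > 0" for g
    using that by (rule order_tendstoD)
  then have "\<forall>\<^sub>F m in sequentially. \<forall>x\<in>F. \<forall>y\<in>F. x \<noteq> y \<longrightarrow> (b - a) / 2 ^ m < \<bar>x - y\<bar>"
    using F(1) by (intro eventually_ball_finite ballI) auto
  then have "\<forall>\<^sub>F m in sequentially. of_nat (card F) \<le> (of_nat (sign_changes f \<alpha> a b m + card {k. k < 2 ^ m \<and>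
        (\<bar>f (t m k) - \<alpha>\<bar> \<le> B m k \<or> \<bar>f (t m (Suc k)) - \<alpha>\<bar> \<le> B m k)}) :: ennreal)"
  proof (rule eventually_mono)
    fix m assume gap: "\<forall>x\<in>F. \<forall>y\<in>F. x \<noteq> y \<longrightarrow> (b - a) / 2 ^ m < \<bar>x - y\<bar>"
    define S where "S = {k. k < 2 ^ m \<and> (f (t m k) - \<alpha>) * (f (t m (Suc k)) - \<alpha>) < 0}"
    define Z where "Z = {k. k < 2 ^ m \<and> (\<bar>f (t m k) - \<alpha>\<bar> \<le> B m k \<or> \<bar>f (t m (Suc k)) - \<alpha>\<bar> \<le> B m k)}"
    have "\<exists>k. k < 2 ^ m \<and> s \<in> {t m k..t m (Suc k)}" if "s \<in> F" for s
      using that F(2) dyadic_cell_exists[of s m] by blast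
    then obtain \<kappa> where \<kappa>: "\<And>s. s \<in> F \<Longrightarrow> \<kappa> s < 2 ^ m \<and> s \<in> {t m (\<kappa> s)..t m (Suc (\<kappa> s))}" by metis
    have "inj_on \<kappa> F"
    proof (rule inj_onI, rule ccontr)
      fix x y assume xy: "x \<in> F" "y \<in> F" "\<kappa> x = \<kappa> y" "x \<noteq> y"
      have "\<bar>x - y\<bar> \<le> t m (Suc (\<kappa> x)) - t m (\<kappa> x)" using \<kappa>[OF xy(1)] \<kappa>[OF xy(2)] xy(3) by auto
      moreover have "(b - a) / 2 ^ m < \<bar>x - y\<bar>" using gap xy by blast
      ultimately show False by (simp add: dyadic_pt_Suc)
    qed
    moreover have "\<kappa> ` F \<subseteq> S \<union> Z"
    proof
      fix k assume "k \<in> \<kappa> ` F"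
      then obtain s where s: "s \<in> F" "k = \<kappa> s" by blast
      have k: "k < 2 ^ m" "s \<in> {t m k..t m (Suc k)}" and fs: "f s = \<alpha>" using \<kappa>[OF s(1)] s F(2) by auto
      show "k \<in> S \<union> Z"
      proof (cases "k \<in> Z")
        case False
        then have far: "\<bar>f (t m k) - \<alpha>\<bar> > B m k" "\<bar>f (t m (Suc k)) - \<alpha>\<bar> > B m k"
          using k by (auto simp: Z_def)
        \<comment> \<open>Were both end values on one side and farther than \<open>B\<close> away,
          \<open>interp\<close> would keep \<open>f s\<close> off \<alpha>.\<close>
        have "(f (t m k) < \<alpha> \<and> \<alpha> < f (t m (Suc k))) \<or> (f (t m (Suc k)) < \<alpha> \<and> \<alpha> < f (t m k))"
          using interp[OF k] far fs by linarith
        then show ?thesis using k by (auto simp: S_def mult_less_0_iff)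
      qed auto
    qed
    ultimately have "card F \<le> card (S \<union> Z)"
      by (intro card_inj_on_le) (auto simp: S_def Z_def)
    also have "\<dots> \<le> card S + card Z" by (rule card_Un_le)
    finally show "of_nat (card F) \<le> (of_nat (sign_changes f \<alpha> a b m + card {k. k < 2 ^ m \<and>
        (\<bar>f (t m k) - \<alpha>\<bar> \<le> B m k \<or> \<bar>f (t m (Suc k)) - \<alpha>\<bar> \<le> B m k)}) :: ennreal)"
      unfolding sign_changes_def S_def Z_def of_nat_le_iff .
  qed
  then show "of_nat (card F) \<le> ?L"
    by (rule Liminf_bounded)
qed

text \<open>With end values off \<alpha>, a midpoint either preserves the number of changes in a
  cell or adds two. It adds two only if it lies across \<alpha> from both ends, and then the
  interpolation bound places it within \<open>B k\<close> of \<alpha>.\<close>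

lemma sign_changes_refine:
  assumes interp: "\<And>k s. k < 2 ^ m \<Longrightarrow> s \<in> {t m k..t m (Suc k)} \<Longrightarrow>
      min (f (t m k)) (f (t m (Suc k))) - B k \<le> f s \<and> f s \<le> max (f (t m k)) (f (t m (Suc k))) + B k"
    and nz: "\<And>k. k \<le> 2 ^ m \<Longrightarrow> f (t m k) \<noteq> \<alpha>"
  shows "sign_changes f \<alpha> a b (Suc m) \<le> sign_changes f \<alpha> a b m +
      2 * card {k. k < 2 ^ m \<and> \<bar>f (t (Suc m) (2 * k + 1)) - \<alpha>\<bar> \<le> B k}"
proof -
  define c where "c m k \<longleftrightarrow> (f (t m k) - \<alpha>) * (f (t m (Suc k)) - \<alpha>) < 0" for m k
  define Z where "Z k \<longleftrightarrow> \<bar>f (t (Suc m) (2 * k + 1)) - \<alpha>\<bar> \<le> B k" for k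
  have card_eq: "card {k. k < n \<and> Q k} = (\<Sum>k<n. of_bool (Q k))" for n :: nat and Q
    by (simp add: of_bool_def sum.If_cases Int_def)
  have pairs: "(\<Sum>k<2 * n. h k) = (\<Sum>k<n. h (2 * k) + h (2 * k + 1))" for n and h :: "nat \<Rightarrow> nat"
    by (induction n) auto
  have "of_bool (c (Suc m) (2 * k)) + of_bool (c (Suc m) (2 * k + 1)) \<le> (of_bool (c m k) + 2 * of_bool (Z k) :: nat)"
    if k: "k < 2 ^ m" for k
  proof -
    define l r s where "l = f (t m k)" and "r = f (t m (Suc k))" and "s = f (t (Suc m) (2 * k + 1))"
    have eq: "t (Suc m) (Suc (2 * k + 1)) = t m (Suc k)" using dyadic_pt_double[of m "Suc k"] by simp
    have "t (Suc m) (2 * k + 1) \<in> {t m k..t m (Suc k)}"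
      using dyadic_pt_mono[of "2 * k" "2 * k + 1" "Suc m"] dyadic_pt_mono[of "2 * k + 1" "Suc (2 * k + 1)" "Suc m"]
      by (auto simp: eq[simplified] dyadic_pt_double)
    then have i: "min l r - B k \<le> s" "s \<le> max l r + B k" using interp[OF k] by (auto simp: l_def r_def s_def)
    have nz': "l \<noteq> \<alpha>" "r \<noteq> \<alpha>" using nz[of k] nz[of "Suc k"] k by (auto simp: l_def r_def)
    have c1: "c (Suc m) (2 * k) \<longleftrightarrow> (l < \<alpha> \<and> \<alpha> < s) \<or> (s < \<alpha> \<and> \<alpha> < l)"
      by (auto simp: c_def l_def s_def dyadic_pt_double mult_less_0_iff)
    have c2: "c (Suc m) (2 * k + 1) \<longleftrightarrow> (s < \<alpha> \<and> \<alpha> < r) \<or> (r < \<alpha> \<and> \<alpha> < s)"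
      unfolding c_def eq by (auto simp: r_def s_def mult_less_0_iff)
    have c3: "c m k \<longleftrightarrow> (l < \<alpha> \<and> \<alpha> < r) \<or> (r < \<alpha> \<and> \<alpha> < l)"
      by (auto simp: c_def l_def r_def mult_less_0_iff)
    have Z: "Z k \<longleftrightarrow> \<bar>s - \<alpha>\<bar> \<le> B k" by (simp add: Z_def s_def)
    have "Z k" if "c (Suc m) (2 * k)" "c (Suc m) (2 * k + 1)"
      using that i unfolding c1 c2 Z by linarith
    moreover have "c m k" if "c (Suc m) (2 * k) \<noteq> c (Suc m) (2 * k + 1)"
      using that nz' unfolding c1 c2 c3 by linarith
    ultimately show ?thesis by (cases "c (Suc m) (2 * k)"; cases "c (Suc m) (2 * k + 1)") auto
  qed
  then have "(\<Sum>k<2 ^ m. of_bool (c (Suc m) (2 * k)) + of_bool (c (Suc m) (2 * k + 1)))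
      \<le> (\<Sum>k<2 ^ m. of_bool (c m k) + 2 * of_bool (Z k) :: nat)"
    by (intro sum_mono) auto
  then show ?thesis
    unfolding sign_changes_def c_def[symmetric] Z_def[symmetric] card_eq
    by (simp add: pairs sum.distrib sum_distrib_left)
qed

end

section \<open>Interpolation errors and absolutely summable point sums\<close>

text \<open>Increments of \<open>G\<close> are the variation of a primitive of \<open>h\<close>.
  They bound oscillations pointwise and, viewed as functions of a shift, are continuous and
  integrable whenever \<open>h\<close> is, which makes them usable as tolerances.\<close>

lemma antiderivative_abs:
  fixes h :: "real \<Rightarrow> real"
  assumes "continuous_on UNIV h"
  obtains G where "\<And>x. (G has_real_derivative \<bar>h x\<bar>) (at x)"
proof -
  have "\<exists>G. \<forall>x::real. - \<infinity> < ereal x \<longrightarrow> ereal x < \<infinity> \<longrightarrow> (G has_vector_derivative \<bar>h x\<bar>) (at x)"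
  proof (rule einterval_antiderivative)
    show "isCont (\<lambda>x. \<bar>h x\<bar>) x" for x
      using assms by (intro continuous_intros) (simp add: continuous_on_eq_continuous_at)
  qed simp
  then show thesis using that by (auto simp: has_real_derivative_iff_has_vector_derivative)
qed

lemma abs_diff_le_antiderivative:
  fixes f h G :: "real \<Rightarrow> real"
  assumes f: "\<And>x. (f has_real_derivative h x) (at x)" and G: "\<And>x. (G has_real_derivative \<bar>h x\<bar>) (at x)"
    and xy: "x \<in> {l..r}" "y \<in> {l..r}"
  shows "\<bar>f x - f y\<bar> \<le> G r - G l"
proof -
  have mono: "G u \<le> G v" if "u \<le> v" for u v
    by (rule DERIV_nonneg_imp_nondecreasing[OF that]) (use G in force)
  have *: "\<bar>f v - f u\<bar> \<le> G v - G u" if "u \<le> v" for u v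
  proof -
    have "G u - f u \<le> G v - f v"
      by (rule DERIV_nonneg_imp_nondecreasing[OF that]) (auto intro!: exI derivative_eq_intros f G)
    moreover have "G u + f u \<le> G v + f v"
      by (rule DERIV_nonneg_imp_nondecreasing[OF that]) (auto intro!: exI derivative_eq_intros f G)
    ultimately show ?thesis by linarith
  qed
  show ?thesis
    using *[of x y] *[of y x] mono[of l x] mono[of l y] mono[of x r] mono[of y r] xy by (cases "x \<le> y") auto
qed

text \<open>For \<open>l = r\<close> the interpolation weight is \<open>0 / 0 = 0\<close>.\<close>

lemma interpolation_error:
  fixes f f1 f2 G :: "real \<Rightarrow> real"
  assumes f: "\<And>x. (f has_real_derivative f1 x) (at x)" and f1: "\<And>x. (f1 has_real_derivative f2 x) (at x)"
    and G: "\<And>x. (G has_real_derivative \<bar>f2 x\<bar>) (at x)" and s: "l \<le> s" "s \<le> r"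
  shows "\<bar>f s - (f l + (s - l) / (r - l) * (f r - f l))\<bar> \<le> (r - l) * (G r - G l)"
proof (cases "s = l")
  case True
  have "0 \<le> G r - G l" using abs_diff_le_antiderivative[OF f1 G, of l l r l] s by auto
  then show ?thesis using True s by simp
next
  case False
  with s have lt: "l < s" "l < r" by auto
  \<comment> \<open>The chord slopes over \<open>{l..r}\<close> and \<open>{l..s}\<close> are values
    of \<open>f1\<close>; the interpolation error is \<open>s - l\<close> times their
    difference.\<close>
  obtain z where z: "l < z" "z < r" "f r - f l = (r - l) * f1 z" using MVT2[OF lt(2) f] by blast
  obtain w where w: "l < w" "w < s" "f s - f l = (s - l) * f1 w" using MVT2[OF lt(1) f] by blast
  have "f s - (f l + (s - l) / (r - l) * (f r - f l)) = (s - l) * (f1 w - f1 z)"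
  proof -
    have "(s - l) / (r - l) * (f r - f l) = (s - l) * f1 z" using lt by (simp add: z(3))
    then show ?thesis using w(3) by (simp add: right_diff_distrib)
  qed
  then have "\<bar>f s - (f l + (s - l) / (r - l) * (f r - f l))\<bar> = (s - l) * \<bar>f1 w - f1 z\<bar>"
    using lt by (simp add: abs_mult)
  also have "\<dots> \<le> (r - l) * (G r - G l)"
    using lt s w z by (intro mult_mono abs_diff_le_antiderivative[OF f1 G]) auto
  finally show ?thesis .
qed

lemma nn_integral_reflect:
  fixes h :: "real \<Rightarrow> ennreal"
  assumes [measurable]: "h \<in> borel_measurable borel"
  shows "(\<integral>\<^sup>+u. h (t - u) \<partial>lborel) = (\<integral>\<^sup>+u. h u \<partial>lborel)"
  using nn_integral_real_affine[of h "-1" t] by simp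

lemma integrable_reflect:
  fixes h :: "real \<Rightarrow> real"
  assumes "integrable lborel h"
  shows "integrable lborel (\<lambda>u. h (t - u))"
  using lborel_integrable_real_affine[OF assms, of "-1" t] by simp

text \<open>The increment is the integral of \<open>\<bar>h (s - u)\<bar>\<close> over
  \<open>s\<close> in \<open>{l..r}\<close>; exchanging the integrals and reflecting produces the
  norm of \<open>h\<close> once for each \<open>s\<close>. This is how integrability of the kernel
  derivatives controls distant points.\<close>

lemma nn_integral_antiderivative_increment:
  fixes h G :: "real \<Rightarrow> real"
  assumes cont: "continuous_on UNIV h" and G: "\<And>x. (G has_real_derivative \<bar>h x\<bar>) (at x)" and "l \<le> r"
  shows "(\<integral>\<^sup>+u. ennreal (G (r - u) - G (l - u)) \<partial>lborel) = ennreal (r - l) * (\<integral>\<^sup>+u. ennreal \<bar>h u\<bar> \<partial>lborel)"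
proof -
  have [measurable]: "h \<in> borel_measurable borel" using cont by (rule borel_measurable_continuous_onI)
  have "ennreal (G (r - u) - G (l - u)) = (\<integral>\<^sup>+s. ennreal \<bar>h (s - u)\<bar> * indicator {l..r} s \<partial>lborel)" for u
  proof -
    have "(\<integral>\<^sup>+s. ennreal \<bar>h (s - u)\<bar> * indicator {l..r} s \<partial>lborel) = ennreal (G (r - u) - G (l - u))"
    proof (rule nn_integral_FTC_Icc[where F = "\<lambda>s. G (s - u)"])
      fix s
      have "((\<lambda>s. s - u) has_real_derivative 1) (at s)" by (auto intro!: derivative_eq_intros)
      from DERIV_chain'[OF this G] show "((\<lambda>s. G (s - u)) has_real_derivative \<bar>h (s - u)\<bar>) (at s)"
        by simp
    qed (use \<open>l \<le> r\<close> in auto)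
    then show ?thesis ..
  qed
  then have "(\<integral>\<^sup>+u. ennreal (G (r - u) - G (l - u)) \<partial>lborel)
      = (\<integral>\<^sup>+u. (\<integral>\<^sup>+s. ennreal \<bar>h (s - u)\<bar> * indicator {l..r} s \<partial>lborel) \<partial>lborel)" by simp
  also have "\<dots> = (\<integral>\<^sup>+s. (\<integral>\<^sup>+u. ennreal \<bar>h (s - u)\<bar> * indicator {l..r} s \<partial>lborel) \<partial>lborel)"
    by (rule lborel_pair.Fubini') measurable
  also have "\<dots> = (\<integral>\<^sup>+s. (\<integral>\<^sup>+u. ennreal \<bar>h u\<bar> \<partial>lborel) * indicator {l..r} s \<partial>lborel)"
  proof (intro nn_integral_cong)
    fix s
    show "(\<integral>\<^sup>+u. ennreal \<bar>h (s - u)\<bar> * indicator {l..r} s \<partial>lborel) = (\<integral>\<^sup>+u. ennreal \<bar>h u\<bar> \<partial>lborel) * indicator {l..r} s"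
      using nn_integral_reflect[of "\<lambda>u. ennreal \<bar>h u\<bar>" s] by (subst nn_integral_multc) auto
  qed
  also have "\<dots> = ennreal (r - l) * (\<integral>\<^sup>+u. ennreal \<bar>h u\<bar> \<partial>lborel)"
    using \<open>l \<le> r\<close> by (subst nn_integral_cmult_indicator) (auto simp: mult.commute)
  finally show ?thesis .
qed

section \<open>Pathwise rules for sums over points\<close>

context
  fixes \<tau> :: "'i \<Rightarrow> 'w \<Rightarrow> real" and \<omega> :: 'w
begin

lemma summable_at_points_subset:
  fixes f :: "real \<Rightarrow> real"
  assumes "(\<lambda>i. f (\<tau> i \<omega>)) summable_on UNIV"
  shows "(\<lambda>i. f (\<tau> i \<omega>)) summable_on {i. \<tau> i \<omega> \<in> D}"
  using summable_on_subset_banach[OF assms] by simp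

lemma point_sum_linear:
  assumes "(\<lambda>i. f (\<tau> i \<omega>)) summable_on UNIV" "(\<lambda>i. h (\<tau> i \<omega>)) summable_on UNIV"
  shows "point_sum \<tau> D (\<lambda>u. f u + c * h u) \<omega> = point_sum \<tau> D f \<omega> + c * point_sum \<tau> D h \<omega>"
  unfolding point_sum_def using assms[THEN summable_at_points_subset[where D = D]]
  by (subst infsum_add) (auto simp: infsum_cmult_right intro: summable_on_cmult_right)

lemma point_sum_mono:
  assumes "(\<lambda>i. f (\<tau> i \<omega>)) summable_on UNIV" "(\<lambda>i. h (\<tau> i \<omega>)) summable_on UNIV" "\<And>u. f u \<le> h u"
  shows "point_sum \<tau> D f \<omega> \<le> point_sum \<tau> D h \<omega>"
  unfolding point_sum_def using assms(1,2)[THEN summable_at_points_subset[where D = D]] assms(3)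
  by (intro infsum_mono) auto

lemma summable_at_points_dominated:
  fixes f h :: "real \<Rightarrow> real"
  assumes "(\<lambda>i. h (\<tau> i \<omega>)) summable_on UNIV" "\<And>u. \<bar>f u\<bar> \<le> h u"
  shows "(\<lambda>i. f (\<tau> i \<omega>)) summable_on UNIV"
proof -
  have "(\<lambda>i. norm (f (\<tau> i \<omega>))) summable_on UNIV"
    by (rule summable_on_comparison_test[OF assms(1)]) (use assms(2) in auto)
  then show ?thesis by (rule abs_summable_summable)
qed

lemma abs_point_sum_le:
  assumes "(\<lambda>i. h (\<tau> i \<omega>)) summable_on UNIV" "\<And>u. \<bar>f u\<bar> \<le> h u"
  shows "\<bar>point_sum \<tau> D f \<omega>\<bar> \<le> point_sum \<tau> D h \<omega>"
proof -
  have s: "(\<lambda>i. f (\<tau> i \<omega>)) summable_on UNIV" using assms by (rule summable_at_points_dominated)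
  have "point_sum \<tau> D f \<omega> \<le> point_sum \<tau> D h \<omega>"
    by (rule point_sum_mono[OF s assms(1)]) (use assms(2) in \<open>simp add: abs_le_iff\<close>)
  moreover have "point_sum \<tau> D (\<lambda>u. - f u) \<omega> \<le> point_sum \<tau> D h \<omega>"
    by (rule point_sum_mono[OF summable_on_uminus[THEN iffD2, OF s] assms(1)]) (use assms(2) in \<open>simp add: abs_le_iff\<close>)
  moreover have "point_sum \<tau> D (\<lambda>u. - f u) \<omega> = - point_sum \<tau> D f \<omega>"
    by (simp add: point_sum_def infsum_uminus)
  ultimately show ?thesis by linarith
qed

lemma point_sum_tendsto:
  assumes "(\<lambda>i. f (\<tau> i \<omega>)) summable_on UNIV"
  shows "(\<lambda>n. point_sum \<tau> {- (M + real n)..M + real n} f \<omega>) \<longlonglongrightarrow> point_sum \<tau> UNIV f \<omega>"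
proof -
  have "(\<lambda>i. norm (f (\<tau> i \<omega>))) summable_on UNIV"
    by (rule summable_on_iff_abs_summable_on_real[THEN iffD1, OF assms])
  then have i: "integrable (count_space UNIV) (\<lambda>i. f (\<tau> i \<omega>))"
    using abs_summable_equivalent[of "\<lambda>i. f (\<tau> i \<omega>)" UNIV] by (simp add: abs_summable_on_def)
  show ?thesis
    unfolding point_sum_eq_integral
  proof (rule integral_dominated_convergence[where w = "\<lambda>i. \<bar>f (\<tau> i \<omega>)\<bar>"])
    show "integrable (count_space UNIV) (\<lambda>i. \<bar>f (\<tau> i \<omega>)\<bar>)" using i by (rule integrable_abs)
    show "AE i in count_space UNIV. (\<lambda>n. indicator {- (M + real n)..M + real n} (\<tau> i \<omega>) * f (\<tau> i \<omega>))
        \<longlonglongrightarrow> indicator UNIV (\<tau> i \<omega>) * f (\<tau> i \<omega>)"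
    proof (intro AE_I2 tendsto_eventually)
      fix i
      obtain N :: nat where "\<bar>\<tau> i \<omega>\<bar> - M \<le> real N" using real_arch_simple by blast
      then show "\<forall>\<^sub>F n in sequentially. indicator {- (M + real n)..M + real n} (\<tau> i \<omega>) * f (\<tau> i \<omega>)
          = indicator UNIV (\<tau> i \<omega>) * f (\<tau> i \<omega>)"
        by (intro eventually_sequentiallyI[of N]) (auto split: split_indicator)
    qed
    show "AE i in count_space UNIV. norm (indicator {- (M + real n)..M + real n} (\<tau> i \<omega>) * f (\<tau> i \<omega>)) \<le> \<bar>f (\<tau> i \<omega>)\<bar>" for n
      by (auto split: split_indicator)
  qed auto
qed

end

section \<open>Shot noise with many points in the window\<close>

text \<open>The interval \<open>{a - T..b + T}\<close> contains every \<open>t - u\<close> with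
  \<open>t\<close> in \<open>{a..b}\<close> and \<open>u\<close> in the window, so the kernel has
  only simple critical points as seen from the window.\<close>

locale shot_noise_window = homogeneous_poisson_process P rate \<tau>
  for P :: "'w measure" and rate :: real and \<tau> :: "'i::countable \<Rightarrow> 'w \<Rightarrow> real" +
  fixes g g1 g2 :: "real \<Rightarrow> real" and T a b :: real and k0 :: nat
  assumes g: "\<And>x. (g has_real_derivative g1 x) (at x)"
    and g1: "\<And>x. (g1 has_real_derivative g2 x) (at x)"
    and g2: "continuous_on UNIV g2"
    and integrable_kernel: "integrable lborel g" "integrable lborel g1" "integrable lborel g2"
    and T_pos: "T > 0" and ab: "a \<le> b" and k0: "k0 \<ge> 3"
    and simple_critical_points: "\<And>s. s \<in> {a - T..b + T} \<Longrightarrow> g1 s \<noteq> 0 \<or> g2 s \<noteq> 0"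
begin

text \<open>Truncated and full processes are handled together so that every constant is uniform in
  the truncation. Each region contains the window \<open>{-T..T}\<close>.\<close>

definition region :: "real set \<Rightarrow> bool" where
  "region D \<longleftrightarrow> D = UNIV \<or> (\<exists>M\<ge>T. D = {-M..M})"

definition many :: "'w set" where
  "many = {\<omega> \<in> space P. k0 \<le> point_count \<tau> {-T..T} \<omega>}"

definition noise :: "real set \<Rightarrow> real \<Rightarrow> 'w \<Rightarrow> real" where
  "noise D t = point_sum \<tau> D (\<lambda>u. g (t - u))"

abbreviation strict_event :: "real set \<Rightarrow> real \<Rightarrow> real \<Rightarrow> (real \<Rightarrow> real) \<Rightarrow> 'w set" where
  "strict_event D t \<alpha> c \<equiv> {\<omega> \<in> space P. \<bar>noise D t \<omega> - \<alpha>\<bar> < point_sum \<tau> D c \<omega> \<and> \<omega> \<in> many}"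

abbreviation outside_mass :: "(real \<Rightarrow> real) \<Rightarrow> ennreal" where
  "outside_mass c \<equiv> \<integral>\<^sup>+u. ennreal (c u) * indicator (- {-T..T}) u \<partial>lborel"

text \<open>Tolerances per point for which the concentration bound is a multiple of
  \<open>\<beta> + J\<close>: \<open>\<beta>\<close> controls the window and \<open>J\<close> the
  mass outside. Continuity is for discretisation, integrability for almost sure summability on the
  whole line.\<close>

definition admissible :: "(real \<Rightarrow> real) \<Rightarrow> real \<Rightarrow> real \<Rightarrow> bool" where
  "admissible c \<beta> J \<longleftrightarrow> continuous_on UNIV c \<and> integrable lborel c \<and> (\<forall>u. c u \<ge> 0) \<and> (\<forall>u\<in>{-T..T}. c u \<le> \<beta>)
     \<and> J \<ge> 0 \<and> outside_mass c \<le> ennreal J"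

abbreviation near_event :: "real set \<Rightarrow> real \<Rightarrow> real \<Rightarrow> ('w \<Rightarrow> real) \<Rightarrow> 'w set" where
  "near_event D t \<alpha> h \<equiv> {\<omega> \<in> space P. \<bar>noise D t \<omega> - \<alpha>\<bar> \<le> h \<omega> \<and> \<omega> \<in> many}"

abbreviation sign_change_event :: "real set \<Rightarrow> real \<Rightarrow> real \<Rightarrow> real \<Rightarrow> 'w set" where
  "sign_change_event D s t \<alpha> \<equiv>
     {\<omega> \<in> space P. (noise D s \<omega> - \<alpha>) * (noise D t \<omega> - \<alpha>) < 0 \<and> \<omega> \<in> many}"

lemma cont_g: "continuous_on S g" and cont_g1: "continuous_on S g1"
  using DERIV_continuous_on[OF g] DERIV_continuous_on[OF g1] by (auto intro: continuous_on_subset)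

lemma borel_kernel [measurable]: "g \<in> borel_measurable borel" "g1 \<in> borel_measurable borel" "g2 \<in> borel_measurable borel"
  using cont_g cont_g1 g2 by (auto intro: borel_measurable_continuous_onI)

lemma borel_shift [measurable]: "(\<lambda>u. g (t - u)) \<in> borel_measurable borel"
  by measurable

lemma region_borel [measurable]: "region D \<Longrightarrow> D \<in> sets borel"
  by (auto simp: region_def)

lemma noise_measurable [measurable]: "region D \<Longrightarrow> noise D t \<in> borel_measurable P"
  unfolding noise_def by (intro measurable_point_sum region_borel borel_shift)

lemma many_sets [measurable]: "many \<in> events"
proof -
  have [measurable]: "point_count \<tau> {-T..T} \<in> measurable P (count_space UNIV)"
    by (intro measurable_point_count) (auto simp: emeasure_lborel_Icc_eq)
  show ?thesis unfolding many_def by measurable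
qed

lemma admissible_measurable [measurable_dest]: "admissible c \<beta> J \<Longrightarrow> c \<in> borel_measurable borel"
  by (auto simp: admissible_def intro: borel_measurable_continuous_onI)

lemma admissible_\<beta>: "admissible c \<beta> J \<Longrightarrow> \<beta> \<ge> 0"
  using T_pos by (auto simp: admissible_def intro: order_trans[of 0 "c 0" \<beta>])

lemma AE_summable_shift: "AE \<omega> in P. (\<lambda>i. g (t - \<tau> i \<omega>)) summable_on UNIV"
  using AE_abs_summable[OF integrable_reflect[OF integrable_kernel(1)], of t]
  by eventually_elim (simp add: abs_summable_summable)

lemma AE_summable_admissible: "admissible c \<beta> J \<Longrightarrow> AE \<omega> in P. (\<lambda>i. c (\<tau> i \<omega>)) summable_on UNIV"
  using AE_abs_summable[of c] by (simp add: admissible_def)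

text \<open>Reflecting \<open>u\<close> to \<open>t - u\<close> carries the window into
  \<open>{a - T..b + T}\<close>, so the two kernel integrals are bounded by the same constants for
  all \<open>t\<close>.\<close>

lemma strict_window_bound:
  "\<exists>K\<ge>0. \<forall>M t \<alpha> c \<beta> J. T \<le> M \<longrightarrow> t \<in> {a..b} \<longrightarrow> admissible c \<beta> J \<longrightarrow>
     prob (strict_event {-M..M} t \<alpha> c) \<le> K * (\<beta> + J)"
proof -
  obtain C1 where C1: "C1 \<ge> 0" "\<And>c r. r \<ge> 0 \<Longrightarrow>
      (\<integral>\<^sup>+y. ennreal (indicator {c - r<..<c + r} (g y) * \<bar>g1 y\<bar>) * indicator {a - T..b + T} y \<partial>lborel) \<le> ennreal (C1 * r)"
    using weighted_level_set_bound[OF g g1 g2 simple_critical_points] by blast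
  obtain C3 where C3: "C3 \<ge> 0" "\<forall>\<epsilon>\<in>{0<..1}.
      (\<integral>\<^sup>+y. ennreal (1 / sqrt (\<bar>g1 y\<bar> + \<epsilon>)) * indicator {a - T..b + T} y \<partial>lborel) \<le> ennreal C3"
    using nn_integral_rsqrt_simple_zeros_bound[OF g1 g2 simple_critical_points] by blast
  have shift: "(\<integral>\<^sup>+u. h (t - u) * indicator {-T..T} u \<partial>lborel) \<le> (\<integral>\<^sup>+y. h y * indicator {a - T..b + T} y \<partial>lborel)"
    if [measurable]: "h \<in> borel_measurable borel" and t: "t \<in> {a..b}" for t and h :: "real \<Rightarrow> ennreal"
  proof -
    have "(\<integral>\<^sup>+u. h (t - u) * indicator {-T..T} u \<partial>lborel) \<le> (\<integral>\<^sup>+u. h (t - u) * indicator {a - T..b + T} (t - u) \<partial>lborel)"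
      using t by (intro nn_integral_mono) (auto split: split_indicator)
    also have "\<dots> = (\<integral>\<^sup>+y. h y * indicator {a - T..b + T} y \<partial>lborel)"
      by (rule nn_integral_reflect[of "\<lambda>y. h y * indicator {a - T..b + T} y"]) measurable
    finally show ?thesis .
  qed
  \<comment> \<open>From
    \<open>2 * \<beta> + rate * J \<le> (2 + rate) * (\<beta> + J)\<close>.\<close>
  define K where "K = rate * C1 * (2 + rate) * (rate * C3)\<^sup>2"
  have "K \<ge> 0" using rate_pos C1 by (simp add: K_def)
  moreover have "prob (strict_event {-M..M} t \<alpha> c) \<le> K * (\<beta> + J)"
    if M: "T \<le> M" and t: "t \<in> {a..b}" and c: "admissible c \<beta> J" for M t \<alpha> c \<beta> J
  proof -
    have [measurable]: "c \<in> borel_measurable borel" using c by (rule admissible_measurable)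
    have "(\<integral>\<^sup>+u. ennreal (c u) * indicator ({-M..M} - {-T..T}) u \<partial>lborel)
        \<le> outside_mass c"
      by (intro nn_integral_mono) (auto split: split_indicator)
    also have "\<dots> \<le> ennreal J" using c by (simp add: admissible_def)
    finally have J: "(\<integral>\<^sup>+u. ennreal (c u) * indicator ({-M..M} - {-T..T}) u \<partial>lborel) \<le> ennreal J" .
    have "prob {\<omega> \<in> space P. \<bar>point_sum \<tau> {-M..M} (\<lambda>u. g (t - u)) \<omega> - \<alpha>\<bar> < point_sum \<tau> {-M..M} c \<omega> \<and> k0 \<le> point_count \<tau> {-T..T} \<omega>}
        \<le> rate * C1 * (2 * \<beta> + rate * J) * (rate * C3)\<^sup>2"
    proof (rule window_concentration_strict[where ?x1.0 = "\<lambda>u. g1 (t - u)"])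
      show "continuous_on UNIV (\<lambda>u. g (t - u))" "continuous_on UNIV (\<lambda>u. g1 (t - u))"
        by (auto intro!: continuous_on_compose2[OF cont_g[of UNIV]] continuous_on_compose2[OF cont_g1[of UNIV]] continuous_intros)
      show "(\<integral>\<^sup>+u. ennreal (indicator {d - r<..<d + r} (g (t - u)) * \<bar>g1 (t - u)\<bar>) * indicator {-T..T} u \<partial>lborel) \<le> ennreal (C1 * r)"
        if "r \<ge> 0" for d r
        by (rule order_trans[OF shift[of "\<lambda>y. ennreal (indicator {d - r<..<d + r} (g y) * \<bar>g1 y\<bar>)"] C1(2)]) (use t that in auto)
      show "(\<integral>\<^sup>+u. ennreal (1 / sqrt (\<bar>g1 (t - u)\<bar> + \<epsilon>)) * indicator {-T..T} u \<partial>lborel) \<le> ennreal C3"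
        if "0 < \<epsilon>" "\<epsilon> \<le> 1" for \<epsilon>
        by (rule order_trans[OF shift[of "\<lambda>y. ennreal (1 / sqrt (\<bar>g1 y\<bar> + \<epsilon>))"] C3(2)[THEN bspec]]) (use t that in auto)
    qed (use M T_pos c J C1 C3 k0 in \<open>auto simp: admissible_def\<close>)
    also have "\<dots> \<le> rate * C1 * ((2 + rate) * (\<beta> + J)) * (rate * C3)\<^sup>2"
      using rate_pos C1(1) admissible_\<beta>[OF c] c
      by (intro mult_right_mono mult_left_mono) (auto simp: algebra_simps admissible_def)
    also have "\<dots> = K * (\<beta> + J)" by (simp add: K_def)
    finally show ?thesis by (simp add: noise_def many_def conj_ac cong: conj_cong)
  qed
  ultimately show ?thesis by blast
qed

text \<open>A continuous bump equal to 1 on the window and 0 beyond distance 1 from it. With at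
  least one point in the window its point sum is at least 1, so a multiple of it dominates a fixed
  tolerance.\<close>

definition cutoff :: "real \<Rightarrow> real" where
  "cutoff u = max 0 (min 1 (T + 1 - \<bar>u\<bar>))"

lemma cutoff: "0 \<le> cutoff u" "cutoff u \<le> 1" "u \<in> {-T..T} \<Longrightarrow> cutoff u = 1" "\<bar>u\<bar> \<ge> T + 1 \<Longrightarrow> cutoff u = 0"
  by (auto simp: cutoff_def)

lemma admissible_add_cutoff:
  assumes "admissible c \<beta> J" "\<epsilon> \<ge> 0"
  shows "admissible (\<lambda>u. c u + \<epsilon> * cutoff u) (\<beta> + \<epsilon>) (J + 2 * \<epsilon>)"
proof -
  have cont: "continuous_on UNIV cutoff" unfolding cutoff_def by (intro continuous_intros)
  then have [measurable]: "cutoff \<in> borel_measurable borel" by (rule borel_measurable_continuous_onI)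
  have [measurable]: "c \<in> borel_measurable borel" using assms(1) by (rule admissible_measurable)
  have int: "integrable lborel cutoff"
  proof (rule Bochner_Integration.integrable_bound[of _ "\<lambda>u. indicator {-(T + 1)..T + 1} u :: real"])
    show "AE u in lborel. norm (cutoff u) \<le> norm (indicator {-(T + 1)..T + 1} u :: real)"
      using cutoff by (intro AE_I2) (auto split: split_indicator)
    show "integrable lborel (indicator {-(T + 1)..T + 1} :: real \<Rightarrow> real)"
      by (intro integrable_real_indicator) (auto simp: emeasure_lborel_Icc_eq)
  qed auto
  have "(\<integral>\<^sup>+u. ennreal (c u + \<epsilon> * cutoff u) * indicator (- {-T..T}) u \<partial>lborel)
      \<le> (\<integral>\<^sup>+u. ennreal (c u) * indicator (- {-T..T}) u + ennreal \<epsilon> * indicator ({-(T + 1)..-T} \<union> {T..T + 1}) u \<partial>lborel)"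
  proof (intro nn_integral_mono)
    fix u
    have "ennreal (c u + \<epsilon> * cutoff u) = ennreal (c u) + ennreal (\<epsilon> * cutoff u)"
      using assms cutoff(1) by (intro ennreal_plus) (auto simp: admissible_def)
    moreover have "\<epsilon> * cutoff u \<le> \<epsilon>" using cutoff(2)[of u] assms(2) by (simp add: mult_left_le)
    ultimately show "ennreal (c u + \<epsilon> * cutoff u) * indicator (- {-T..T}) u
        \<le> ennreal (c u) * indicator (- {-T..T}) u + ennreal \<epsilon> * indicator ({-(T + 1)..-T} \<union> {T..T + 1}) u"
      using cutoff(4)[of u] by (auto split: split_indicator intro!: ennreal_leI)
  qed
  also have "\<dots> = outside_mass c + ennreal \<epsilon> * emeasure lborel ({-(T + 1)..-T} \<union> {T..T + 1})"
    by (subst nn_integral_add) (auto simp: nn_integral_cmult_indicator)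
  \<comment> \<open>Two ramps of unit length: the source of the
    \<open>2 * \<epsilon>\<close>.\<close>
  also have "emeasure lborel ({-(T + 1)..-T} \<union> {T..T + 1}) \<le> ennreal 2"
  proof -
    have "emeasure lborel ({-(T + 1)..-T} \<union> {T..T + 1}) \<le> emeasure lborel {-(T + 1)..-T} + emeasure lborel {T..T + 1}"
      by (intro emeasure_subadditive) auto
    then show ?thesis by simp
  qed
  also have "outside_mass c \<le> ennreal J"
    using assms by (simp add: admissible_def)
  also have "ennreal J + ennreal \<epsilon> * ennreal 2 = ennreal (J + 2 * \<epsilon>)"
    using assms by (simp add: admissible_def ennreal_plus ennreal_mult' mult.commute)
  finally have "(\<integral>\<^sup>+u. ennreal (c u + \<epsilon> * cutoff u) * indicator (- {-T..T}) u \<partial>lborel) \<le> ennreal (J + 2 * \<epsilon>)"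
    by this (auto intro!: add_mono mult_left_mono)
  then show ?thesis
    using assms cutoff cont int unfolding admissible_def
    by (auto intro!: continuous_intros Bochner_Integration.integrable_add integrable_mult_right add_nonneg_nonneg mult_nonneg_nonneg)
qed

text \<open>A strict inequality that holds on the whole line holds eventually on growing windows,
  where the point sums converge. Fatou's lemma then carries the window bound over with the same
  \<open>K\<close>.\<close>

lemma strict_region_bound:
  "\<exists>K\<ge>0. \<forall>D t \<alpha> c \<beta> J. region D \<longrightarrow> t \<in> {a..b} \<longrightarrow> admissible c \<beta> J \<longrightarrow>
     prob (strict_event D t \<alpha> c) \<le> K * (\<beta> + J)"
proof -
  obtain K where K: "K \<ge> 0" "\<And>M t \<alpha> c \<beta> J. T \<le> M \<Longrightarrow> t \<in> {a..b} \<Longrightarrow> admissible c \<beta> J \<Longrightarrow>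
     prob (strict_event {-M..M} t \<alpha> c) \<le> K * (\<beta> + J)"
    using strict_window_bound by blast
  have "prob (strict_event UNIV t \<alpha> c) \<le> K * (\<beta> + J)"
    (is "prob ?A \<le> _") if t: "t \<in> {a..b}" and c: "admissible c \<beta> J" for t \<alpha> c \<beta> J
  proof -
    define D where "D n = {-(T + real n)..T + real n}" for n :: nat
    define A where "A n = {\<omega> \<in> space P. \<bar>noise (D n) t \<omega> - \<alpha>\<bar> < point_sum \<tau> (D n) c \<omega> \<and> \<omega> \<in> many}" for n
    have D: "region (D n)" "region UNIV" for n by (auto simp: region_def D_def intro!: exI[of _ "T + real n"])
    have [measurable]: "c \<in> borel_measurable borel" using c by (rule admissible_measurable)
    have m [measurable]: "point_sum \<tau> S c \<in> borel_measurable P" "noise S t \<in> borel_measurable P" if "region S" for S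
      using that by (auto intro!: measurable_point_sum noise_measurable region_borel)
    have A_sets [measurable]: "A n \<in> events" for n unfolding A_def using m[OF D(1)] by measurable
    have A'_sets [measurable]: "?A \<in> events" using m[OF D(2)] by measurable
    have "emeasure P ?A = (\<integral>\<^sup>+\<omega>. indicator ?A \<omega> \<partial>P)" by simp
    also have "\<dots> \<le> (\<integral>\<^sup>+\<omega>. liminf (\<lambda>n. indicator (A n) \<omega>) \<partial>P)"
    proof (rule nn_integral_mono_AE)
      show "AE \<omega> in P. indicator ?A \<omega> \<le> liminf (\<lambda>n. indicator (A n) \<omega> :: ennreal)"
        using AE_summable_shift[of t] AE_summable_admissible[OF c]
      proof eventually_elim
        case (elim \<omega>)
        have "(\<lambda>n. point_sum \<tau> (D n) c \<omega> - \<bar>noise (D n) t \<omega> - \<alpha>\<bar>) \<longlonglongrightarrow> point_sum \<tau> UNIV c \<omega> - \<bar>noise UNIV t \<omega> - \<alpha>\<bar>"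
          unfolding D_def noise_def using point_sum_tendsto[where \<tau> = \<tau> and \<omega> = \<omega> and f = "\<lambda>u. g (t - u)", OF elim(1)]
            point_sum_tendsto[where \<tau> = \<tau> and \<omega> = \<omega> and f = c, OF elim(2)]
          by (intro tendsto_intros)
        then have "\<forall>\<^sub>F n in sequentially. 0 < point_sum \<tau> (D n) c \<omega> - \<bar>noise (D n) t \<omega> - \<alpha>\<bar>" if "\<omega> \<in> ?A"
          using that by (intro order_tendstoD) auto
        then have "\<forall>\<^sub>F n in sequentially. indicator ?A \<omega> \<le> (indicator (A n) \<omega> :: ennreal)"
        proof (cases "\<omega> \<in> ?A")
          case True
          then show ?thesis using \<open>\<omega> \<in> ?A \<Longrightarrow> _\<close>[OF True] by (auto elim!: eventually_mono simp: A_def)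
        qed simp
        then show ?case by (rule Liminf_bounded)
      qed
    qed
    also have "\<dots> \<le> liminf (\<lambda>n. \<integral>\<^sup>+\<omega>. indicator (A n) \<omega> \<partial>P)"
      by (rule nn_integral_liminf) simp
    also have "\<dots> \<le> liminf (\<lambda>n. ennreal (K * (\<beta> + J)))"
    proof (intro Liminf_mono always_eventually allI)
      fix n
      have "prob (A n) \<le> K * (\<beta> + J)" unfolding A_def D_def by (rule K(2)) (use t c in auto)
      then show "(\<integral>\<^sup>+\<omega>. indicator (A n) \<omega> \<partial>P) \<le> ennreal (K * (\<beta> + J))"
        by (simp add: emeasure_eq_measure ennreal_leI)
    qed
    also have "\<dots> = ennreal (K * (\<beta> + J))" by (simp add: Liminf_const)
    finally show ?thesis
      using K(1) admissible_\<beta>[OF c] c by (simp add: emeasure_eq_measure admissible_def)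
  qed
  with K show ?thesis unfolding region_def by (intro exI[of _ K]) auto
qed

lemma admissible_cutoff: "\<epsilon> \<ge> 0 \<Longrightarrow> admissible (\<lambda>u. \<epsilon> * cutoff u) \<epsilon> (2 * \<epsilon>)"
  using admissible_add_cutoff[of "\<lambda>u. 0" 0 0 \<epsilon>] by (simp add: admissible_def)

lemma point_sum_cutoff_ge:
  assumes "region D" "\<omega> \<in> many" and summable: "(\<lambda>i. cutoff (\<tau> i \<omega>)) summable_on UNIV"
  shows "1 \<le> point_sum \<tau> D cutoff \<omega>"
proof -
  have "point_count \<tau> {-T..T} \<omega> \<noteq> 0" using assms(2) k0 by (auto simp: many_def)
  then have "{i. \<tau> i \<omega> \<in> {-T..T}} \<noteq> {}" unfolding point_count_def by (metis card.empty)
  then obtain i where i: "\<tau> i \<omega> \<in> {-T..T}" by blast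
  then have iD: "\<tau> i \<omega> \<in> D" using assms(1) by (auto simp: region_def)
  have "(\<Sum>\<^sub>\<infinity>j\<in>{i}. cutoff (\<tau> j \<omega>)) \<le> point_sum \<tau> D cutoff \<omega>"
    unfolding point_sum_def
    using iD cutoff(1) summable_at_points_subset[where \<tau> = \<tau> and \<omega> = \<omega> and f = cutoff and D = D, OF summable]
    by (intro infsum_mono_neutral) auto
  then show ?thesis using cutoff(3)[OF i] by simp
qed

text \<open>Adding \<open>\<epsilon> * cutoff\<close> to the tolerance turns the weak inequality
  into a strict one on \<open>many\<close>, where the bump sums to a positive number. It raises
  \<open>\<beta> + J\<close> by only \<open>3 * \<epsilon>\<close>, which tends to 0.\<close>

lemma hit_probability:
  "\<exists>K\<ge>0. \<forall>D t \<alpha> c \<beta> J. region D \<longrightarrow> t \<in> {a..b} \<longrightarrow> admissible c \<beta> J \<longrightarrow>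
     prob (near_event D t \<alpha> (point_sum \<tau> D c)) \<le> K * (\<beta> + J)"
proof -
  obtain K where K: "K \<ge> 0" "\<And>D t \<alpha> c \<beta> J. region D \<Longrightarrow> t \<in> {a..b} \<Longrightarrow> admissible c \<beta> J \<Longrightarrow>
     prob (strict_event D t \<alpha> c) \<le> K * (\<beta> + J)"
    using strict_region_bound by blast
  have "prob (near_event D t \<alpha> (point_sum \<tau> D c)) \<le> K * (\<beta> + J)"
    (is "prob ?A \<le> _") if D: "region D" and t: "t \<in> {a..b}" and c: "admissible c \<beta> J" for D t \<alpha> c \<beta> J
  proof -
    have "prob ?A \<le> K * (\<beta> + J + 3 * \<epsilon>)" if "\<epsilon> > 0" for \<epsilon>
    proof -
      define c' where "c' u = c u + \<epsilon> * cutoff u" for u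
      have c': "admissible c' (\<beta> + \<epsilon>) (J + 2 * \<epsilon>)"
        unfolding c'_def using c that by (intro admissible_add_cutoff) auto
      have cut: "admissible cutoff 1 2" using admissible_cutoff[of 1] by simp
      have [measurable]: "c' \<in> borel_measurable borel" using c' by (rule admissible_measurable)
      have [measurable]: "point_sum \<tau> D c' \<in> borel_measurable P" "noise D t \<in> borel_measurable P"
        using D by (auto intro!: measurable_point_sum noise_measurable region_borel)
      have "prob ?A \<le> prob (strict_event D t \<alpha> c')"
      proof (rule finite_measure_mono_AE)
        show "(strict_event D t \<alpha> c') \<in> events" by measurable
        show "AE \<omega> in P. \<omega> \<in> ?A \<longrightarrow> \<omega> \<in> (strict_event D t \<alpha> c')"
          using AE_summable_admissible[OF c] AE_summable_admissible[OF cut]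
        proof eventually_elim
          case (elim \<omega>)
          have "point_sum \<tau> D cutoff \<omega> > 0" if "\<omega> \<in> many"
            using point_sum_cutoff_ge[OF D that elim(2)] by simp
          moreover have "point_sum \<tau> D c' \<omega> = point_sum \<tau> D c \<omega> + \<epsilon> * point_sum \<tau> D cutoff \<omega>"
            unfolding c'_def by (rule point_sum_linear[where \<tau> = \<tau> and \<omega> = \<omega> and f = c and h = cutoff, OF elim])
          ultimately show ?case using \<open>\<epsilon> > 0\<close> by (auto simp: less_le_trans intro: le_less_trans)
        qed
      qed
      also have "\<dots> \<le> K * ((\<beta> + \<epsilon>) + (J + 2 * \<epsilon>))" by (rule K(2)[OF D t c'])
      finally show ?thesis by (simp add: algebra_simps)
    qed
    then have "\<forall>\<^sub>F \<epsilon> in at_right 0. prob ?A \<le> K * (\<beta> + J + 3 * \<epsilon>)"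
      unfolding eventually_at_right_field by (intro exI[of _ 1]) auto
    moreover have "((\<lambda>\<epsilon>. K * (\<beta> + J + 3 * \<epsilon>)) \<longlongrightarrow> K * (\<beta> + J + 3 * 0)) (at_right 0)"
      by (intro tendsto_intros)
    ultimately have "prob ?A \<le> K * (\<beta> + J + 3 * 0)" by (intro tendsto_lowerbound) auto
    then show ?thesis by simp
  qed
  with K(1) show ?thesis by blast
qed

end

lemma integrable_antiderivative_increment:
  fixes h G :: "real \<Rightarrow> real"
  assumes cont: "continuous_on UNIV h" and G: "\<And>x. (G has_real_derivative \<bar>h x\<bar>) (at x)" and "l \<le> r"
    and int: "integrable lborel h"
  shows "integrable lborel (\<lambda>u. G (r - u) - G (l - u))"
proof (rule integrableI_nonneg)
  have [measurable]: "G \<in> borel_measurable borel"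
    by (intro borel_measurable_continuous_onI DERIV_continuous_on[OF G])
  show "(\<lambda>u. G (r - u) - G (l - u)) \<in> borel_measurable lborel" by measurable
  show "AE u in lborel. 0 \<le> G (r - u) - G (l - u)"
  proof (intro AE_I2)
    fix u
    show "0 \<le> G (r - u) - G (l - u)"
      using DERIV_nonneg_imp_nondecreasing[of "l - u" "r - u" G] G \<open>l \<le> r\<close> by force
  qed
  show "(\<integral>\<^sup>+u. ennreal (G (r - u) - G (l - u)) \<partial>lborel) < \<infinity>"
    using int nn_integral_antiderivative_increment[OF cont G \<open>l \<le> r\<close>]
    by (simp add: integrable_iff_bounded ennreal_mult_less_top)
qed

section \<open>Fixed tolerances, path regularity and tolerances of cells\<close>

context shot_noise_window begin

definition hit_const :: real where
  "hit_const = (SOME K. K \<ge> 0 \<and> (\<forall>D t \<alpha> c \<beta> J. region D \<longrightarrow> t \<in> {a..b} \<longrightarrow> admissible c \<beta> J \<longrightarrow>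
     prob (near_event D t \<alpha> (point_sum \<tau> D c)) \<le> K * (\<beta> + J)))"

lemma hit_const_nonneg: "hit_const \<ge> 0"
  and hit_bound: "region D \<Longrightarrow> t \<in> {a..b} \<Longrightarrow> admissible c \<beta> J \<Longrightarrow>
     prob (near_event D t \<alpha> (point_sum \<tau> D c)) \<le> hit_const * (\<beta> + J)"
  using someI_ex[OF hit_probability] unfolding hit_const_def by blast+

text \<open>On \<open>many\<close> the point sum of \<open>\<delta> * cutoff\<close> is at least
  \<open>\<delta>\<close>; this tolerance has \<open>\<beta> = \<delta>\<close> and outside mass at
  most \<open>2 * \<delta>\<close>.\<close>

lemma noise_near_bound:
  assumes D: "region D" and t: "t \<in> {a..b}" and "\<delta> \<ge> 0"
  shows "prob (near_event D t \<alpha> (\<lambda>_. \<delta>)) \<le> hit_const * (3 * \<delta>)"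
proof -
  define c where "c u = \<delta> * cutoff u" for u
  have c: "admissible c \<delta> (2 * \<delta>)" unfolding c_def using assms(3) by (rule admissible_cutoff)
  have [measurable]: "c \<in> borel_measurable borel" using c by (rule admissible_measurable)
  have [measurable]: "point_sum \<tau> D c \<in> borel_measurable P" "noise D t \<in> borel_measurable P"
    using D by (auto intro!: measurable_point_sum noise_measurable region_borel)
  have cut: "admissible cutoff 1 2" using admissible_cutoff[of 1] by simp
  have "prob (near_event D t \<alpha> (\<lambda>_. \<delta>))
      \<le> prob (near_event D t \<alpha> (point_sum \<tau> D c))"
  proof (rule finite_measure_mono_AE)
    show "(near_event D t \<alpha> (point_sum \<tau> D c)) \<in> events" by measurable
    show "AE \<omega> in P. \<omega> \<in> (near_event D t \<alpha> (\<lambda>_. \<delta>)) \<longrightarrow>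
        \<omega> \<in> (near_event D t \<alpha> (point_sum \<tau> D c))"
      using AE_summable_admissible[OF cut]
    proof eventually_elim
      case (elim \<omega>)
      have "point_sum \<tau> D c \<omega> = \<delta> * point_sum \<tau> D cutoff \<omega>"
        unfolding c_def point_sum_def by (simp add: infsum_cmult_right')
      moreover have "\<delta> * 1 \<le> \<delta> * point_sum \<tau> D cutoff \<omega>" if "\<omega> \<in> many"
        using assms(3) by (intro mult_left_mono point_sum_cutoff_ge D that elim)
      ultimately show ?case by auto
    qed
  qed
  also have "\<dots> \<le> hit_const * (\<delta> + 2 * \<delta>)" by (rule hit_bound[OF D t c])
  finally show ?thesis by simp
qed

lemma AE_noise_neq:
  assumes D: "region D" and t: "t \<in> {a..b}"
  shows "AE \<omega> in P. \<omega> \<in> many \<longrightarrow> noise D t \<omega> \<noteq> \<alpha>"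
proof -
  have [measurable]: "noise D t \<in> borel_measurable P" using D by (rule noise_measurable)
  have s: "(near_event D t \<alpha> (\<lambda>_. 0)) \<in> events" by measurable
  have "prob (near_event D t \<alpha> (\<lambda>_. 0)) = 0"
    using noise_near_bound[OF D t, of 0 \<alpha>] measure_nonneg[of P] by (simp add: order_antisym)
  then have "AE \<omega> in P. \<omega> \<notin> (near_event D t \<alpha> (\<lambda>_. 0))"
    using s by (intro AE_not_in) (auto simp: null_sets_def emeasure_eq_measure)
  then show ?thesis using AE_space by eventually_elim auto
qed

text \<open>A single integrable function dominates \<open>g (t - u)\<close> for all \<open>t\<close>
  in \<open>{a..b}\<close>: the value at \<open>a\<close> plus the variation of \<open>g\<close> up
  to \<open>b - u\<close>. Hence one null set serves uncountably many times, and the Weierstrass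
  test gives continuity.\<close>

lemma AE_summable_continuous:
  "AE \<omega> in P. (\<forall>t\<in>{a..b}. (\<lambda>i. g (t - \<tau> i \<omega>)) summable_on UNIV) \<and> (\<forall>D. continuous_on {a..b} (\<lambda>t. noise D t \<omega>))"
proof -
  obtain G where G: "\<And>x. (G has_real_derivative \<bar>g1 x\<bar>) (at x)"
    using antiderivative_abs[OF cont_g1] by blast
  define c where "c u = \<bar>g (a - u)\<bar> + (G (b - u) - G (a - u))" for u
  have dom: "\<bar>g (t - u)\<bar> \<le> c u" if "t \<in> {a..b}" for t u
    using abs_diff_le_antiderivative[OF g G, of "t - u" "a - u" "b - u" "a - u"] that by (auto simp: c_def)
  have "integrable lborel c"
    unfolding c_def using integrable_reflect[OF integrable_kernel(1)]
    by (intro Bochner_Integration.integrable_add integrable_abs integrable_antiderivative_increment[OF cont_g1 G ab integrable_kernel(2)])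
  from AE_abs_summable[OF this] show ?thesis
  proof eventually_elim
    case (elim \<omega>)
    have "c u \<ge> 0" for u using dom[of a u] ab by (auto intro: order_trans[OF abs_ge_zero])
    then have c: "(\<lambda>i. c (\<tau> i \<omega>)) summable_on UNIV" using elim by simp
    have "continuous_on {a..b} (\<lambda>t. noise D t \<omega>)" for D
      unfolding noise_def point_sum_def
    proof (rule uniform_limit_theorem)
      show "uniform_limit {a..b} (\<lambda>F t. \<Sum>i\<in>F. g (t - \<tau> i \<omega>)) (\<lambda>t. \<Sum>\<^sub>\<infinity>i\<in>{i. \<tau> i \<omega> \<in> D}. g (t - \<tau> i \<omega>))
          (finite_subsets_at_top {i. \<tau> i \<omega> \<in> D})"
        using dom by (intro Weierstrass_m_test_general[where M = "\<lambda>i. c (\<tau> i \<omega>)"]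
            summable_at_points_subset[where \<tau> = \<tau> and \<omega> = \<omega> and f = c, OF c]) auto
      show "\<forall>\<^sub>F F in finite_subsets_at_top {i. \<tau> i \<omega> \<in> D}. continuous_on {a..b} (\<lambda>t. \<Sum>i\<in>F. g (t - \<tau> i \<omega>))"
        by (intro always_eventually allI continuous_on_sum continuous_on_compose2[OF cont_g[of UNIV]] continuous_intros) auto
    qed simp
    moreover have "(\<lambda>i. g (t - \<tau> i \<omega>)) summable_on UNIV" if "t \<in> {a..b}" for t
      by (rule summable_at_points_dominated[where \<tau> = \<tau> and \<omega> = \<omega> and f = "\<lambda>u. g (t - u)", OF c]) (rule dom[OF that])
    ultimately show ?case by blast
  qed
qed

text \<open>Source of the quadratic cell probability: one factor \<open>r - l\<close> stands in the
  interpolation error, the other comes from the variation of the first derivative, bounded by the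
  supremum of \<open>\<bar>g2\<bar>\<close> for points in the window and by its integral
  outside.\<close>

lemma cell_admissible:
  assumes G: "\<And>x. (G has_real_derivative \<bar>g2 x\<bar>) (at x)"
  obtains L where "L \<ge> 0" and "\<And>l r. a \<le> l \<Longrightarrow> l \<le> r \<Longrightarrow> r \<le> b \<Longrightarrow>
    \<exists>\<beta> J. admissible (\<lambda>u. (r - l) * (G (r - u) - G (l - u))) \<beta> J \<and> \<beta> + J \<le> L * (r - l)\<^sup>2"
proof -
  have "continuous_on {a - T..b + T} (\<lambda>x. \<bar>g2 x\<bar>)"
    by (rule continuous_on_rabs[OF continuous_on_subset[OF g2]]) simp
  then have "\<exists>z\<in>{a - T..b + T}. \<forall>x\<in>{a - T..b + T}. \<bar>g2 x\<bar> \<le> \<bar>g2 z\<bar>"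
    using ab T_pos by (intro continuous_attains_sup) auto
  then obtain z where z: "\<And>x. x \<in> {a - T..b + T} \<Longrightarrow> \<bar>g2 x\<bar> \<le> \<bar>g2 z\<bar>" by blast
  define S where "S = \<bar>g2 z\<bar>"
  have S: "\<And>x. x \<in> {a - T..b + T} \<Longrightarrow> \<bar>g2 x\<bar> \<le> S" "S \<ge> 0"
    unfolding S_def using z by auto
  define I where "I = (LINT u|lborel. \<bar>g2 u\<bar>)"
  have I: "I \<ge> 0" "(\<integral>\<^sup>+u. ennreal \<bar>g2 u\<bar> \<partial>lborel) = ennreal I"
    unfolding I_def using integrable_kernel(3) by (auto intro!: nn_integral_eq_integral integral_nonneg)
  show thesis
  proof (rule that[of "S + I"])
    show "S + I \<ge> 0" using S(2) I by simp
    fix l r assume lr: "a \<le> l" "l \<le> r" "r \<le> b"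
    define c where "c u = (r - l) * (G (r - u) - G (l - u))" for u
    have mono: "G (l - u) \<le> G (r - u)" for u
      using DERIV_nonneg_imp_nondecreasing[of "l - u" "r - u" G] G lr by force
    have contG: "continuous_on UNIV G" by (rule DERIV_continuous_on[OF G])
    then have [measurable]: "G \<in> borel_measurable borel" by (rule borel_measurable_continuous_onI)
    have "admissible c ((r - l) * ((r - l) * S)) ((r - l) * ((r - l) * I))"
      unfolding admissible_def
    proof (intro conjI allI ballI)
      show "continuous_on UNIV c" unfolding c_def
        by (intro continuous_intros continuous_on_compose2[OF contG]) auto
      show "integrable lborel c" unfolding c_def
        using lr by (intro integrable_mult_right integrable_antiderivative_increment[OF g2 G _ integrable_kernel(3)]) auto
      show "0 \<le> c u" for u using mono[of u] lr by (simp add: c_def)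
      show "c u \<le> (r - l) * ((r - l) * S)" if u: "u \<in> {-T..T}" for u
      proof (cases "l = r")
        case False
        then obtain z where z: "l - u < z" "z < r - u" "G (r - u) - G (l - u) = ((r - u) - (l - u)) * \<bar>g2 z\<bar>"
          using MVT2[of "l - u" "r - u" G "\<lambda>x. \<bar>g2 x\<bar>"] G lr by auto
        have "\<bar>g2 z\<bar> \<le> S" using z u lr by (intro S(1)) auto
        then show ?thesis unfolding c_def z(3) using lr by (simp add: mult_left_mono)
      qed (simp add: c_def)
      show "0 \<le> (r - l) * ((r - l) * I)" using lr I by simp
      have "outside_mass c \<le> (\<integral>\<^sup>+u. ennreal (r - l) * ennreal (G (r - u) - G (l - u)) \<partial>lborel)"
        using lr by (intro nn_integral_mono) (auto simp: c_def ennreal_mult' split: split_indicator)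
      also have "\<dots> = ennreal (r - l) * (ennreal (r - l) * ennreal I)"
        using lr nn_integral_antiderivative_increment[OF g2 G lr(2)] I(2) by (subst nn_integral_cmult) auto
      also have "\<dots> = ennreal ((r - l) * ((r - l) * I))" using lr I by (simp add: ennreal_mult)
      finally show "outside_mass c \<le> ennreal ((r - l) * ((r - l) * I))" .
    qed
    then show "\<exists>\<beta> J. admissible (\<lambda>u. (r - l) * (G (r - u) - G (l - u))) \<beta> J \<and> \<beta> + J \<le> (S + I) * (r - l)\<^sup>2"
      unfolding c_def by (intro exI conjI) (auto simp: power2_eq_square algebra_simps)
  qed
qed

end

section \<open>Expected crossings\<close>

context shot_noise_window begin

text \<open>The crossing count is only compared from both sides with measurable functions, through
  monotonicity of the integral, so its own measurability never enters.\<close>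

definition expected_crossings :: "real set \<Rightarrow> real \<Rightarrow> ennreal" where
  "expected_crossings D \<alpha> = (\<integral>\<^sup>+\<omega>. crossings (\<lambda>t. noise D t \<omega>) \<alpha> {a..b} * indicator many \<omega> \<partial>P)"

definition expected_sign_changes :: "real set \<Rightarrow> real \<Rightarrow> nat \<Rightarrow> real" where
  "expected_sign_changes D \<alpha> m = (\<Sum>k<2 ^ m. prob (sign_change_event D (dyadic_pt a b m k) (dyadic_pt a b m (Suc k)) \<alpha>))"

lemma card_indicator_many:
  fixes R :: "nat \<Rightarrow> 'w \<Rightarrow> bool"
  assumes "\<omega> \<in> space P"
  shows "of_nat (card {k. k < n \<and> R k \<omega>}) * indicator many \<omega>
      = (\<Sum>k<n. indicator {\<omega> \<in> space P. R k \<omega> \<and> \<omega> \<in> many} \<omega> :: ennreal)"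
proof (cases "\<omega> \<in> many")
  case True
  have "(\<Sum>k<n. indicator {\<omega> \<in> space P. R k \<omega> \<and> \<omega> \<in> many} \<omega> :: ennreal) = (\<Sum>k<n. if R k \<omega> then 1 else 0)"
    using assms True by (intro sum.cong) auto
  then show ?thesis using True by (simp add: sum.If_cases Int_def)
qed simp

lemma measurable_card_many:
  fixes R :: "nat \<Rightarrow> 'w \<Rightarrow> bool"
  assumes "\<And>k. k < n \<Longrightarrow> {\<omega> \<in> space P. R k \<omega> \<and> \<omega> \<in> many} \<in> events"
  shows "(\<lambda>\<omega>. of_nat (card {k. k < n \<and> R k \<omega>}) * indicator many \<omega> :: ennreal) \<in> borel_measurable P"
proof (rule measurable_cong[THEN iffD2])
  show "(\<lambda>\<omega>. \<Sum>k<n. indicator {\<omega> \<in> space P. R k \<omega> \<and> \<omega> \<in> many} \<omega> :: ennreal) \<in> borel_measurable P"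
    by (rule borel_measurable_sum) (auto intro!: borel_measurable_indicator assms)
qed (rule card_indicator_many)

lemma nn_integral_card:
  fixes R :: "nat \<Rightarrow> 'w \<Rightarrow> bool"
  assumes "\<And>k. k < n \<Longrightarrow> {\<omega> \<in> space P. R k \<omega> \<and> \<omega> \<in> many} \<in> events"
  shows "(\<integral>\<^sup>+\<omega>. of_nat (card {k. k < n \<and> R k \<omega>}) * indicator many \<omega> \<partial>P)
    = ennreal (\<Sum>k<n. prob {\<omega> \<in> space P. R k \<omega> \<and> \<omega> \<in> many})"
proof -
  have "(\<integral>\<^sup>+\<omega>. of_nat (card {k. k < n \<and> R k \<omega>}) * indicator many \<omega> \<partial>P)
      = (\<integral>\<^sup>+\<omega>. (\<Sum>k<n. indicator {\<omega> \<in> space P. R k \<omega> \<and> \<omega> \<in> many} \<omega>) \<partial>P)"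
    by (intro nn_integral_cong card_indicator_many)
  also have "\<dots> = (\<Sum>k<n. \<integral>\<^sup>+\<omega>. indicator {\<omega> \<in> space P. R k \<omega> \<and> \<omega> \<in> many} \<omega> \<partial>P)"
    by (rule nn_integral_sum) (auto intro!: borel_measurable_indicator assms)
  also have "\<dots> = (\<Sum>k<n. emeasure P {\<omega> \<in> space P. R k \<omega> \<and> \<omega> \<in> many})"
    by (intro sum.cong refl nn_integral_indicator assms) auto
  also have "\<dots> = ennreal (\<Sum>k<n. prob {\<omega> \<in> space P. R k \<omega> \<and> \<omega> \<in> many})"
    by (intro sum_eq_ennreal_sum) (auto simp: emeasure_eq_measure)
  finally show ?thesis .
qed

lemma sign_change_sets [measurable]:
  assumes "region D"
  shows "(sign_change_event D s t \<alpha>) \<in> events"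
proof -
  have [measurable]: "noise D s \<in> borel_measurable P" "noise D t \<in> borel_measurable P"
    using assms by (simp_all add: noise_measurable)
  show ?thesis by measurable
qed

lemma expected_sign_changes_eq:
  assumes "region D"
  shows "(\<integral>\<^sup>+\<omega>. of_nat (sign_changes (\<lambda>t. noise D t \<omega>) \<alpha> a b m) * indicator many \<omega> \<partial>P)
    = ennreal (expected_sign_changes D \<alpha> m)"
  unfolding sign_changes_def expected_sign_changes_def using assms by (intro nn_integral_card sign_change_sets)

text \<open>The lower bound is pathwise. For the upper bound, Fatou's lemma compares with
  arbitrarily fine grids, and a telescoping correction makes the expected sign changes monotone
  under refinement, which brings the comparison back to the given \<open>m\<close>.\<close>

lemma crossings_approx:
  "\<exists>L\<ge>0. \<forall>D \<alpha> m. region D \<longrightarrow>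
     ennreal (expected_sign_changes D \<alpha> m) \<le> expected_crossings D \<alpha> \<and>
     expected_crossings D \<alpha> \<le> ennreal (expected_sign_changes D \<alpha> m + L / 2 ^ m)"
proof -
  obtain G where G: "\<And>x. (G has_real_derivative \<bar>g2 x\<bar>) (at x)"
    using antiderivative_abs[OF g2] by blast
  obtain L where L: "L \<ge> 0" "\<And>l r. a \<le> l \<Longrightarrow> l \<le> r \<Longrightarrow> r \<le> b \<Longrightarrow>
    \<exists>\<beta> J. admissible (\<lambda>u. (r - l) * (G (r - u) - G (l - u))) \<beta> J \<and> \<beta> + J \<le> L * (r - l)\<^sup>2"
    using cell_admissible[OF G] by blast
  define t where "t = dyadic_pt a b"
  define c where "c m k u = (t m (Suc k) - t m k) * (G (t m (Suc k) - u) - G (t m k - u))" for m k u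
  define B where "B D m k \<omega> = point_sum \<tau> D (c m k) \<omega>" for D m k \<omega>
  \<comment> \<open>A cell is bad with probability at most \<open>C / 4 ^ m\<close>; the
    \<open>2 ^ m\<close> cells together contribute \<open>C / 2 ^ m\<close>.\<close>
  define C where "C = hit_const * L * (b - a)\<^sup>2"
  have C: "C \<ge> 0" using hit_const_nonneg L by (simp add: C_def)
  have t_mem: "t m k \<in> {a..b}" if "k \<le> 2 ^ m" for m k unfolding t_def by (rule dyadic_pt_mem[OF ab that])
  have t_mono: "t m k \<le> t m (Suc k)" for m k unfolding t_def by (rule dyadic_pt_mono[OF ab]) simp
  have c_admissible: "\<exists>\<beta> J. admissible (c m k) \<beta> J \<and> \<beta> + J \<le> L * ((b - a) / 2 ^ m)\<^sup>2" if "k < 2 ^ m" for m k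
    using L(2)[of "t m k" "t m (Suc k)"] t_mem[of k m] t_mem[of "Suc k" m] t_mono[of m k] that dyadic_pt_Suc[OF ab, of m k]
    unfolding c_def by (simp add: t_def)
  have B_meas: "B D m k \<in> borel_measurable P" if "region D" "k < 2 ^ m" for D m k
  proof -
    from c_admissible[OF that(2)] obtain \<beta> J where "admissible (c m k) \<beta> J" by blast
    then show ?thesis unfolding B_def using that(1) by (intro measurable_point_sum region_borel admissible_measurable)
  qed
  have hit_sets: "(near_event D s \<alpha> (B D m k)) \<in> events" if "region D" "k < 2 ^ m" for D s \<alpha> m k
  proof -
    have [measurable]: "B D m k \<in> borel_measurable P" "noise D s \<in> borel_measurable P"
      using B_meas[OF that] that by (auto intro: noise_measurable)
    show ?thesis by measurable
  qed
  have hit: "prob (near_event D s \<alpha> (B D m k)) \<le> C / 2 ^ m / 2 ^ m"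
    if "region D" "k < 2 ^ m" "s \<in> {a..b}" for D s \<alpha> m k
  proof -
    from c_admissible[OF that(2)] obtain \<beta> J where *: "admissible (c m k) \<beta> J" "\<beta> + J \<le> L * ((b - a) / 2 ^ m)\<^sup>2" by blast
    have "prob (near_event D s \<alpha> (B D m k)) \<le> hit_const * (\<beta> + J)"
      unfolding B_def by (rule hit_bound[OF that(1,3) *(1)])
    also have "\<dots> \<le> hit_const * (L * ((b - a) / 2 ^ m)\<^sup>2)" by (rule mult_left_mono[OF *(2) hit_const_nonneg])
    also have "\<dots> = C / 2 ^ m / 2 ^ m" by (simp add: C_def power2_eq_square)
    finally show ?thesis .
  qed
  have sum_hit: "(\<Sum>k<2 ^ m. prob (near_event D (s k) \<alpha> (B D m k))) \<le> C / 2 ^ m"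
    if "region D" "\<And>k. k < 2 ^ m \<Longrightarrow> s k \<in> {a..b}" for D s \<alpha> m
  proof -
    have "(\<Sum>k<2 ^ m. prob (near_event D (s k) \<alpha> (B D m k))) \<le> (\<Sum>k\<in>{..<2 ^ m :: nat}. C / 2 ^ m / 2 ^ m)"
      using that by (intro sum_mono hit) auto
    then show ?thesis by simp
  qed
  have main: "ennreal (expected_sign_changes D \<alpha> m) \<le> expected_crossings D \<alpha> \<and>
     expected_crossings D \<alpha> \<le> ennreal (expected_sign_changes D \<alpha> m + 4 * C / 2 ^ m)"
    if D: "region D" for D \<alpha> m
  proof -
    define Q where "Q m \<omega> = sign_changes (\<lambda>t. noise D t \<omega>) \<alpha> a b m" for m \<omega>
    \<comment> \<open>\<open>Z\<close> counts cells where a crossing may go undetected,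
      \<open>Y\<close> those where the new midpoint may add two sign changes.\<close>
    define Z where "Z m \<omega> = card {k. k < 2 ^ m \<and> (\<bar>noise D (t m k) \<omega> - \<alpha>\<bar> \<le> B D m k \<omega> \<or> \<bar>noise D (t m (Suc k)) \<omega> - \<alpha>\<bar> \<le> B D m k \<omega>)}" for m \<omega>
    define Y where "Y m \<omega> = card {k. k < 2 ^ m \<and> \<bar>noise D (t (Suc m) (2 * k + 1)) \<omega> - \<alpha>\<bar> \<le> B D m k \<omega>}" for m \<omega>
    define q where "q m = expected_sign_changes D \<alpha> m" for m
    let ?E = "\<lambda>f. \<integral>\<^sup>+\<omega>. of_nat (f \<omega>) * indicator many \<omega> \<partial>P"
    let ?QZ = "\<lambda>n. \<integral>\<^sup>+\<omega>. of_nat (Q n \<omega>) * indicator many \<omega> + of_nat (Z n \<omega>) * indicator many \<omega> \<partial>P"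
    let ?hit = "\<lambda>m k \<omega>. \<bar>noise D (t m k) \<omega> - \<alpha>\<bar> \<le> B D m k \<omega> \<or> \<bar>noise D (t m (Suc k)) \<omega> - \<alpha>\<bar> \<le> B D m k \<omega>"
    have q_nonneg: "q m \<ge> 0" for m unfolding q_def expected_sign_changes_def by (intro sum_nonneg) simp
    have Q_int: "?E (Q m) = ennreal (q m)" for m
      unfolding Q_def q_def by (rule expected_sign_changes_eq[OF D])
    have Z_sets: "{\<omega> \<in> space P. ?hit m k \<omega> \<and> \<omega> \<in> many} \<in> events"
      if "k < 2 ^ m" for m k
    proof -
      have [measurable]: "B D m k \<in> borel_measurable P" "noise D (t m k) \<in> borel_measurable P" "noise D (t m (Suc k)) \<in> borel_measurable P"
        using B_meas[OF D that] D by (auto intro: noise_measurable)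
      show ?thesis by measurable
    qed
    have Z_int: "?E (Z m) \<le> ennreal (2 * C / 2 ^ m)" for m
    proof -
      have "?E (Z m)
        = ennreal (\<Sum>k<2 ^ m. prob {\<omega> \<in> space P. ?hit m k \<omega> \<and> \<omega> \<in> many})"
        unfolding Z_def by (intro nn_integral_card Z_sets)
      also have "\<dots> \<le> ennreal (\<Sum>k<2 ^ m. prob (near_event D (t m k) \<alpha> (B D m k))
          + prob (near_event D (t m (Suc k)) \<alpha> (B D m k)))"
      proof (intro ennreal_leI sum_mono)
        fix k :: nat assume "k \<in> {..<2 ^ m}"
        then have k: "k < 2 ^ m" by simp
        show "prob {\<omega> \<in> space P. ?hit m k \<omega> \<and> \<omega> \<in> many}
          \<le> prob (near_event D (t m k) \<alpha> (B D m k))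
          + prob (near_event D (t m (Suc k)) \<alpha> (B D m k))"
          by (rule order_trans[OF finite_measure_mono measure_Un_le])
            (use hit_sets[OF D k] in \<open>auto intro: sets.Un\<close>)
      qed
      also have "\<dots> \<le> ennreal (C / 2 ^ m + C / 2 ^ m)"
        unfolding sum.distrib using D t_mem by (intro ennreal_leI add_mono sum_hit) auto
      finally show ?thesis by (simp add: field_simps)
    qed
    have Y_int: "?E (Y m) \<le> ennreal (C / 2 ^ m)" for m
    proof -
      have "?E (Y m)
        = ennreal (\<Sum>k<2 ^ m. prob (near_event D (t (Suc m) (2 * k + 1)) \<alpha> (B D m k)))"
        unfolding Y_def by (intro nn_integral_card hit_sets D)
      also have "\<dots> \<le> ennreal (C / 2 ^ m)"
        by (intro ennreal_leI sum_hit D t_mem) auto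
      finally show ?thesis .
    qed
    have "AE \<omega> in P. \<forall>m k. k < 2 ^ m \<longrightarrow> (\<lambda>i. c m k (\<tau> i \<omega>)) summable_on UNIV"
    proof (intro AE_all_countable[THEN iffD2] allI)
      fix m k
      show "AE \<omega> in P. k < 2 ^ m \<longrightarrow> (\<lambda>i. c m k (\<tau> i \<omega>)) summable_on UNIV"
        using c_admissible[of k m] AE_summable_admissible[of "c m k"] by (cases "k < 2 ^ m") auto
    qed
    moreover have "AE \<omega> in P. \<forall>m k. k \<le> 2 ^ m \<longrightarrow> \<omega> \<in> many \<longrightarrow> noise D (t m k) \<omega> \<noteq> \<alpha>"
    proof (intro AE_all_countable[THEN iffD2] allI)
      fix m k
      show "AE \<omega> in P. k \<le> 2 ^ m \<longrightarrow> \<omega> \<in> many \<longrightarrow> noise D (t m k) \<omega> \<noteq> \<alpha>"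
        using AE_noise_neq[OF D t_mem[of k m]] by (cases "k \<le> 2 ^ m") auto
    qed
    ultimately have good: "AE \<omega> in P. (\<forall>m. of_nat (Q m \<omega>) \<le> crossings (\<lambda>t. noise D t \<omega>) \<alpha> {a..b}) \<and>
        crossings (\<lambda>t. noise D t \<omega>) \<alpha> {a..b} \<le> liminf (\<lambda>m. of_nat (Q m \<omega> + Z m \<omega>)) \<and>
        (\<omega> \<in> many \<longrightarrow> (\<forall>m. Q (Suc m) \<omega> \<le> Q m \<omega> + 2 * Y m \<omega>))"
      using AE_summable_continuous
    proof eventually_elim
      case (elim \<omega>)
      define f where "f s = noise D s \<omega>" for s
      have interp: "min (f (t m k)) (f (t m (Suc k))) - B D m k \<omega> \<le> f s \<and> f s \<le> max (f (t m k)) (f (t m (Suc k))) + B D m k \<omega>"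
        if k: "k < 2 ^ m" and s: "s \<in> {t m k..t m (Suc k)}" for m k s
      proof -
        define l r where "l = t m k" and "r = t m (Suc k)"
        define \<theta> where "\<theta> = (s - l) / (r - l)"
        have lr: "l \<in> {a..b}" "r \<in> {a..b}" "s \<in> {a..b}" "l \<le> s" "s \<le> r"
          using t_mem[of k m] t_mem[of "Suc k" m] k s by (auto simp: l_def r_def)
        have \<theta>: "0 \<le> \<theta>" "\<theta> \<le> 1" using lr by (auto simp: \<theta>_def divide_le_eq_1)
        have sm: "(\<lambda>i. g (x - \<tau> i \<omega>)) summable_on UNIV" if "x \<in> {a..b}" for x using elim(3) that by blast
        \<comment> \<open>The interpolation residual of the kernel as seen from a point
          \<open>u\<close>. By linearity its point sum is the residual of the noise, so the kernel
          bound \<open>c m k\<close> sums to the random bound \<open>B D m k\<close>.\<close>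
        define \<phi> where "\<phi> u = g (s - u) + (- 1) * (g (l - u) + \<theta> * (g (r - u) + (- 1) * g (l - u)))" for u
        have "\<bar>\<phi> u\<bar> \<le> c m k u" for u
        proof -
          have "\<phi> u = g (s - u) - (g (l - u) + ((s - u) - (l - u)) / ((r - u) - (l - u)) * (g (r - u) - g (l - u)))"
            by (simp add: \<phi>_def \<theta>_def)
          also have "\<bar>\<dots>\<bar> \<le> ((r - u) - (l - u)) * (G (r - u) - G (l - u))"
            using lr by (intro interpolation_error[OF g g1 G]) auto
          finally show ?thesis by (simp add: c_def l_def r_def)
        qed
        then have "\<bar>point_sum \<tau> D \<phi> \<omega>\<bar> \<le> B D m k \<omega>"
          unfolding B_def using elim(1) k by (intro abs_point_sum_le) auto
        moreover have "point_sum \<tau> D \<phi> \<omega> = f s + (- 1) * (f l + \<theta> * (f r + (- 1) * f l))"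
        proof -
          define d where "d u = g (r - u) + (- 1) * g (l - u)" for u
          define e where "e u = g (l - u) + \<theta> * d u" for u
          have d_sm: "(\<lambda>i. d (\<tau> i \<omega>)) summable_on UNIV"
            unfolding d_def using sm lr by (intro summable_on_add summable_on_cmult_right) auto
          have e_sm: "(\<lambda>i. e (\<tau> i \<omega>)) summable_on UNIV"
            unfolding e_def using sm lr d_sm by (intro summable_on_add summable_on_cmult_right) auto
          have "point_sum \<tau> D \<phi> \<omega> = f s + (- 1) * point_sum \<tau> D e \<omega>"
            using point_sum_linear[where \<tau> = \<tau> and \<omega> = \<omega> and D = D and f = "\<lambda>u. g (s - u)" and h = e and c = "- 1"] sm lr e_sm
            by (simp add: \<phi>_def[abs_def] e_def[abs_def] d_def f_def noise_def)
          also have "point_sum \<tau> D e \<omega> = f l + \<theta> * point_sum \<tau> D d \<omega>"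
            using point_sum_linear[where \<tau> = \<tau> and \<omega> = \<omega> and D = D and f = "\<lambda>u. g (l - u)" and h = d and c = \<theta>] sm lr d_sm
            by (simp add: e_def[abs_def] f_def noise_def)
          also have "point_sum \<tau> D d \<omega> = f r + (- 1) * f l"
            using point_sum_linear[where \<tau> = \<tau> and \<omega> = \<omega> and D = D and f = "\<lambda>u. g (r - u)" and h = "\<lambda>u. g (l - u)" and c = "- 1"] sm lr
            by (simp add: d_def[abs_def] f_def noise_def)
          finally show ?thesis .
        qed
        ultimately have near: "\<bar>f s - ((1 - \<theta>) * f l + \<theta> * f r)\<bar> \<le> B D m k \<omega>" by (simp add: algebra_simps)
        have "(1 - \<theta>) * min (f l) (f r) + \<theta> * min (f l) (f r) \<le> (1 - \<theta>) * f l + \<theta> * f r"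
          using \<theta> by (intro add_mono mult_left_mono) auto
        moreover have "(1 - \<theta>) * f l + \<theta> * f r \<le> (1 - \<theta>) * max (f l) (f r) + \<theta> * max (f l) (f r)"
          using \<theta> by (intro add_mono mult_left_mono) auto
        ultimately have "min (f l) (f r) \<le> (1 - \<theta>) * f l + \<theta> * f r" "(1 - \<theta>) * f l + \<theta> * f r \<le> max (f l) (f r)"
          by (simp_all add: algebra_simps)
        with near show ?thesis unfolding l_def[symmetric] r_def[symmetric] by linarith
      qed
      have "of_nat (Q m \<omega>) \<le> crossings f \<alpha> {a..b}" for m
        unfolding Q_def f_def[abs_def] using elim(3) by (intro sign_changes_le_crossings ab) auto
      moreover have "crossings f \<alpha> {a..b} \<le> liminf (\<lambda>m. of_nat (Q m \<omega> + Z m \<omega>))"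
        using crossings_le_liminf[OF ab, of f "\<lambda>m k. B D m k \<omega>" \<alpha>] interp
        unfolding Q_def Z_def t_def f_def[abs_def] by simp
      moreover have "Q (Suc m) \<omega> \<le> Q m \<omega> + 2 * Y m \<omega>" if "\<omega> \<in> many" for m
        using sign_changes_refine[OF ab, of m f "\<lambda>k. B D m k \<omega>" \<alpha>] interp[of _ m] elim(2) that
        unfolding Q_def Y_def t_def f_def[abs_def] by simp
      ultimately show ?case by (simp add: f_def[abs_def])
    qed
    have Q_meas: "(\<lambda>\<omega>. of_nat (Q m \<omega>) * indicator many \<omega> :: ennreal) \<in> borel_measurable P" for m
      unfolding Q_def sign_changes_def using D by (intro measurable_card_many sign_change_sets)
    have Z_meas: "(\<lambda>\<omega>. of_nat (Z m \<omega>) * indicator many \<omega> :: ennreal) \<in> borel_measurable P" for m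
      unfolding Z_def by (intro measurable_card_many Z_sets)
    have Y_meas: "(\<lambda>\<omega>. of_nat (Y m \<omega>) * indicator many \<omega> :: ennreal) \<in> borel_measurable P" for m
      unfolding Y_def by (intro measurable_card_many hit_sets D)
    \<comment> \<open>The possible gain \<open>2 * C / 2 ^ m\<close> is exactly the drop of
      \<open>4 * C / 2 ^ m\<close> on halving, so \<open>q m + 4 * C / 2 ^ m\<close> is
      nonincreasing.\<close>
    have step: "q (Suc m) + 4 * C / 2 ^ Suc m \<le> q m + 4 * C / 2 ^ m" for m
    proof -
      have "ennreal (q (Suc m)) \<le> (\<integral>\<^sup>+\<omega>. of_nat (Q m \<omega>) * indicator many \<omega> + 2 * (of_nat (Y m \<omega>) * indicator many \<omega>) \<partial>P)"
        unfolding Q_int[symmetric]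
      proof (rule nn_integral_mono_AE)
        show "AE \<omega> in P. of_nat (Q (Suc m) \<omega>) * indicator many \<omega>
            \<le> of_nat (Q m \<omega>) * indicator many \<omega> + 2 * (of_nat (Y m \<omega>) * indicator many \<omega> :: ennreal)"
          using good
        proof eventually_elim
          case (elim \<omega>)
          show ?case
          proof (cases "\<omega> \<in> many")
            case True
            then have "of_nat (Q (Suc m) \<omega>) \<le> (of_nat (Q m \<omega> + 2 * Y m \<omega>) :: ennreal)"
              using elim by (intro of_nat_mono) blast
            then show ?thesis using True by simp
          qed simp
        qed
      qed
      also have "\<dots> = ennreal (q m) + 2 * ?E (Y m)"
        using Q_meas Y_meas by (simp add: nn_integral_add nn_integral_cmult Q_int)
      also have "\<dots> \<le> ennreal (q m) + 2 * ennreal (C / 2 ^ m)"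
        by (intro add_left_mono mult_left_mono Y_int) simp
      also have "\<dots> = ennreal (q m + 2 * (C / 2 ^ m))"
      proof -
        have "ennreal (2 * (C / 2 ^ m)) = 2 * ennreal (C / 2 ^ m)" using C by (subst ennreal_mult) auto
        moreover have "ennreal (q m + 2 * (C / 2 ^ m)) = ennreal (q m) + ennreal (2 * (C / 2 ^ m))"
          using q_nonneg C by (intro ennreal_plus) auto
        ultimately show ?thesis by simp
      qed
      finally have "ennreal (q (Suc m)) \<le> ennreal (q m + 2 * (C / 2 ^ m))" .
      moreover have "0 \<le> q m + 2 * (C / 2 ^ m)" using q_nonneg[of m] C by simp
      ultimately have "q (Suc m) \<le> q m + 2 * (C / 2 ^ m)" by (simp only: ennreal_le_iff)
      then show ?thesis by simp
    qed
    have q_le: "q n + 4 * C / 2 ^ n \<le> q m + 4 * C / 2 ^ m" if "m \<le> n" for n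
      using that by (induction n rule: dec_induct) (use step in \<open>auto intro: order_trans\<close>)
    have "ennreal (q m) \<le> expected_crossings D \<alpha>"
      unfolding Q_int[symmetric] expected_crossings_def
      using good by (intro nn_integral_mono_AE) (auto elim!: eventually_mono intro!: mult_right_mono)
    moreover have "expected_crossings D \<alpha> \<le> ennreal (q m + 4 * C / 2 ^ m)"
    proof -
      have "expected_crossings D \<alpha> \<le> (\<integral>\<^sup>+\<omega>. liminf (\<lambda>n. of_nat (Q n \<omega>) * indicator many \<omega> + of_nat (Z n \<omega>) * indicator many \<omega>) \<partial>P)"
        unfolding expected_crossings_def
      proof (rule nn_integral_mono_AE)
        show "AE \<omega> in P. crossings (\<lambda>t. noise D t \<omega>) \<alpha> {a..b} * indicator many \<omega>
            \<le> liminf (\<lambda>n. of_nat (Q n \<omega>) * indicator many \<omega> + of_nat (Z n \<omega>) * indicator many \<omega> :: ennreal)"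
          using good by eventually_elim (auto split: split_indicator)
      qed
      also have "\<dots> \<le> liminf (\<lambda>n. \<integral>\<^sup>+\<omega>. of_nat (Q n \<omega>) * indicator many \<omega> + of_nat (Z n \<omega>) * indicator many \<omega> \<partial>P)"
        using Q_meas Z_meas by (intro nn_integral_liminf) auto
      \<comment> \<open>The undetected crossings cost \<open>2 * C / 2 ^ n\<close>, less than the
        correction \<open>4 * C / 2 ^ n\<close>, so the monotone quantity at \<open>n\<close>, hence
        at \<open>m\<close>, bounds the total.\<close>
      also have "\<dots> \<le> liminf (\<lambda>n. ennreal (q m + 4 * C / 2 ^ m))"
      proof (rule Liminf_mono, rule eventually_sequentiallyI)
        fix n assume "m \<le> n"
        have "?QZ n
            = ennreal (q n) + ?E (Z n)"
          using Q_meas Z_meas by (simp add: nn_integral_add Q_int)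
        also have "\<dots> \<le> ennreal (q n) + ennreal (2 * C / 2 ^ n)" by (intro add_left_mono Z_int)
        also have "\<dots> = ennreal (q n + 2 * C / 2 ^ n)" using q_nonneg C by (simp add: ennreal_plus)
        also have "\<dots> \<le> ennreal (q m + 4 * C / 2 ^ m)"
        proof (rule ennreal_leI)
          have "2 * C / 2 ^ n \<le> 4 * C / 2 ^ n" using C by (intro divide_right_mono) auto
          with q_le[OF \<open>m \<le> n\<close>] show "q n + 2 * C / 2 ^ n \<le> q m + 4 * C / 2 ^ m" by linarith
        qed
        finally show "?QZ n
            \<le> ennreal (q m + 4 * C / 2 ^ m)" .
      qed
      also have "\<dots> = ennreal (q m + 4 * C / 2 ^ m)" by (simp add: Liminf_const)
      finally show ?thesis .
    qed
    ultimately show ?thesis unfolding q_def by blast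
  qed
  have "4 * C \<ge> 0" using C by simp
  with main show ?thesis by blast
qed

end

lemma (in prob_space) abs_prob_diff_le:
  assumes [measurable]: "A \<in> events" "B \<in> events" "C1 \<in> events" "C2 \<in> events"
    and "AE \<omega> in M. (\<omega> \<in> A) \<noteq> (\<omega> \<in> B) \<longrightarrow> \<omega> \<in> C1 \<or> \<omega> \<in> C2"
  shows "\<bar>prob A - prob B\<bar> \<le> prob C1 + prob C2"
proof -
  have *: "prob S \<le> prob R + (prob C1 + prob C2)"
    if [measurable]: "R \<in> events" and "AE \<omega> in M. \<omega> \<in> S \<longrightarrow> \<omega> \<in> R \<union> (C1 \<union> C2)" for R S
  proof -
    have "prob S \<le> prob (R \<union> (C1 \<union> C2))"
      using that(2) by (rule finite_measure_mono_AE) measurable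
    also have "\<dots> \<le> prob R + prob (C1 \<union> C2)" by (rule measure_Un_le) measurable
    also have "prob (C1 \<union> C2) \<le> prob C1 + prob C2" by (rule measure_Un_le) measurable
    finally show ?thesis by simp
  qed
  have "prob A \<le> prob B + (prob C1 + prob C2)" "prob B \<le> prob A + (prob C1 + prob C2)"
    using assms(5) by (auto intro!: * elim!: eventually_mono)
  then show ?thesis by linarith
qed

section \<open>Dependence on the level and on the truncation\<close>

context shot_noise_window begin

lemma region_UNIV: "region UNIV" and region_Icc: "T \<le> M \<Longrightarrow> region {-M..M}"
  unfolding region_def by blast+

lemma near_sets:
  assumes "region D" "h \<in> borel_measurable P"
  shows "(near_event D t \<alpha> (h)) \<in> events"
proof -
  have [measurable]: "h \<in> borel_measurable P" "noise D t \<in> borel_measurable P"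
    using assms by (simp_all add: noise_measurable)
  show ?thesis by measurable
qed

text \<open>Moving the level changes the sign pattern of a cell only if an end value lies within
  \<open>\<bar>\<alpha> - \<alpha>'\<bar>\<close> of \<alpha>. Two ends at cost
  \<open>3 * hit_const\<close> each, over \<open>2 ^ m\<close> cells, give the constant.\<close>

lemma expected_sign_changes_lipschitz:
  assumes D: "region D"
  shows "\<bar>expected_sign_changes D \<alpha> m - expected_sign_changes D \<alpha>' m\<bar> \<le> 2 ^ m * (6 * hit_const) * \<bar>\<alpha> - \<alpha>'\<bar>"
proof -
  define \<delta> where "\<delta> = \<bar>\<alpha> - \<alpha>'\<bar>"
  define t where "t = dyadic_pt a b m"
  have "\<bar>expected_sign_changes D \<alpha> m - expected_sign_changes D \<alpha>' m\<bar>
      \<le> (\<Sum>k\<in>{..<2 ^ m :: nat}. hit_const * (3 * \<delta>) + hit_const * (3 * \<delta>))"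
    unfolding expected_sign_changes_def sum_subtractf[symmetric]
  proof (rule order_trans[OF sum_abs], rule sum_mono)
    fix k :: nat assume "k \<in> {..<2 ^ m}"
    then have mem: "t k \<in> {a..b}" "t (Suc k) \<in> {a..b}"
      unfolding t_def by (auto intro!: dyadic_pt_mem[OF ab] simp del: atLeastAtMost_iff)
    have "\<bar>prob (sign_change_event D (t k) (t (Suc k)) \<alpha>)
        - prob (sign_change_event D (t k) (t (Suc k)) \<alpha>')\<bar>
      \<le> prob (near_event D (t k) \<alpha> (\<lambda>_. \<delta>))
        + prob (near_event D (t (Suc k)) \<alpha> (\<lambda>_. \<delta>))"
    proof (intro abs_prob_diff_le sign_change_sets near_sets D borel_measurable_const AE_I2 impI)
      fix \<omega>
      have "(x - \<alpha>) * (y - \<alpha>) < 0 \<longleftrightarrow> (x - \<alpha>') * (y - \<alpha>') < 0" if "\<not> \<bar>x - \<alpha>\<bar> \<le> \<delta>" "\<not> \<bar>y - \<alpha>\<bar> \<le> \<delta>" for x y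
      proof -
        have "x - \<alpha> < 0 \<longleftrightarrow> x - \<alpha>' < 0" "0 < x - \<alpha> \<longleftrightarrow> 0 < x - \<alpha>'" "y - \<alpha> < 0 \<longleftrightarrow> y - \<alpha>' < 0" "0 < y - \<alpha> \<longleftrightarrow> 0 < y - \<alpha>'"
          using that unfolding \<delta>_def by linarith+
        then show ?thesis unfolding mult_less_0_iff by blast
      qed
      then show "\<omega> \<in> (near_event D (t k) \<alpha> (\<lambda>_. \<delta>)) \<or> \<omega> \<in> (near_event D (t (Suc k)) \<alpha> (\<lambda>_. \<delta>))"
        if "(\<omega> \<in> (sign_change_event D (t k) (t (Suc k)) \<alpha>))
         \<noteq> (\<omega> \<in> (sign_change_event D (t k) (t (Suc k)) \<alpha>'))"
        using that by blast
    qed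
    also have "\<dots> \<le> hit_const * (3 * \<delta>) + hit_const * (3 * \<delta>)"
      using D mem by (intro add_mono noise_near_bound) (auto simp: \<delta>_def)
    finally show "\<bar>prob (sign_change_event D (dyadic_pt a b m k) (dyadic_pt a b m (Suc k)) \<alpha>)
        - prob (sign_change_event D (dyadic_pt a b m k) (dyadic_pt a b m (Suc k)) \<alpha>')\<bar>
      \<le> hit_const * (3 * \<delta>) + hit_const * (3 * \<delta>)"
      by (simp add: t_def)
  qed
  also have "\<dots> = 2 ^ m * (6 * hit_const) * \<bar>\<alpha> - \<alpha>'\<bar>" by (simp add: \<delta>_def)
  finally show ?thesis .
qed

text \<open>A continuous majorant of the part of the kernel cut off by truncation at
  \<open>M\<close>: the ramp rises from 0 at distance \<open>M - 1\<close> to 1 at distance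
  \<open>M\<close>, since tolerances have to be continuous.\<close>

definition tail :: "real \<Rightarrow> real \<Rightarrow> real \<Rightarrow> real" where
  "tail M t u = \<bar>g (t - u)\<bar> * min 1 (max 0 (\<bar>u\<bar> - (M - 1)))"

abbreviation tail_mass :: "real \<Rightarrow> real \<Rightarrow> real" where
  "tail_mass M t \<equiv> LINT u|lborel. tail M t u"

lemma tail_bounds: "0 \<le> tail M t u" "tail M t u \<le> \<bar>g (t - u)\<bar>" "\<bar>u\<bar> \<ge> M \<Longrightarrow> tail M t u = \<bar>g (t - u)\<bar>"
  "\<bar>u\<bar> \<le> M - 1 \<Longrightarrow> tail M t u = 0"
  by (auto simp: tail_def mult_left_le)

lemma continuous_tail: "continuous_on UNIV (tail M t)"
  unfolding tail_def by (intro continuous_intros continuous_on_compose2[OF cont_g[of UNIV]]) auto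

lemma integrable_tail: "integrable lborel (tail M t)"
proof (rule Bochner_Integration.integrable_bound[OF integrable_reflect[OF integrable_kernel(1)]])
  show "tail M t \<in> borel_measurable lborel" using borel_measurable_continuous_onI[OF continuous_tail] by simp
  show "AE u in lborel. norm (tail M t u) \<le> norm (g (t - u))"
    using tail_bounds(1,2)[of M t] by (intro AE_I2) simp
qed

lemma integral_tail_tendsto: "((\<lambda>M. tail_mass M t) \<longlongrightarrow> 0) at_top"
proof -
  have "((\<lambda>M. tail_mass M t) \<longlongrightarrow> (LINT u|(lborel :: real measure). (0 :: real))) at_top"
  proof (rule integral_dominated_convergence_at_top[where s = "\<lambda>M. tail M t" and f = "\<lambda>_. 0" and w = "\<lambda>u. \<bar>g (t - u)\<bar>"])
    show "tail M t \<in> borel_measurable lborel" for M using borel_measurable_continuous_onI[OF continuous_tail] by simp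
    show "integrable lborel (\<lambda>u. \<bar>g (t - u)\<bar>)" by (intro integrable_abs integrable_reflect integrable_kernel)
    show "AE u in lborel. ((\<lambda>M. tail M t u) \<longlongrightarrow> 0) at_top"
    proof (intro AE_I2 tendsto_eventually)
      fix u
      show "\<forall>\<^sub>F M in at_top. tail M t u = 0"
        using eventually_ge_at_top[of "\<bar>u\<bar> + 1"] by eventually_elim (simp add: tail_bounds(4))
    qed
    show "\<forall>\<^sub>F M in at_top. AE u in lborel. norm (tail M t u) \<le> \<bar>g (t - u)\<bar>"
      using tail_bounds(1,2) by (intro always_eventually allI AE_I2) simp
  qed simp
  then show ?thesis by simp
qed

text \<open>For \<open>M\<close> at least \<open>T + 1\<close> the ramp vanishes on the window, so
  only the outside mass remains, and it tends to 0 as \<open>M\<close> grows.\<close>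

lemma admissible_tail:
  assumes "M \<ge> T + 1"
  shows "admissible (tail M t) 0 (tail_mass M t)"
  unfolding admissible_def
proof (intro conjI allI ballI)
  show "tail M t u \<le> 0" if "u \<in> {-T..T}" for u using that assms tail_bounds(4)[of u M t] by auto
  have "outside_mass (tail M t) \<le> (\<integral>\<^sup>+u. ennreal (tail M t u) \<partial>lborel)"
    by (intro nn_integral_mono) (auto split: split_indicator)
  also have "\<dots> = ennreal (tail_mass M t)"
    using tail_bounds(1) by (intro nn_integral_eq_integral integrable_tail) auto
  finally show "outside_mass (tail M t) \<le> ennreal (tail_mass M t)" .
qed (auto intro: continuous_tail integrable_tail tail_bounds Bochner_Integration.integral_nonneg)

lemma AE_noise_truncation:
  "AE \<omega> in P. \<bar>noise UNIV t \<omega> - noise {-M..M} t \<omega>\<bar> \<le> point_sum \<tau> UNIV (tail M t) \<omega>"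
  using AE_summable_shift[of t] AE_abs_summable[OF integrable_tail[of M t]]
proof eventually_elim
  case (elim \<omega>)
  define f where "f u = g (t - u)" for u
  define h where "h u = indicator {-M..M} u * f u" for u
  have s: "(\<lambda>i. f (\<tau> i \<omega>)) summable_on UNIV" using elim(1) by (simp add: f_def)
  have "(\<lambda>i. f (\<tau> i \<omega>)) summable_on {i. \<tau> i \<omega> \<in> {-M..M}}"
    by (rule summable_at_points_subset[where \<tau> = \<tau> and \<omega> = \<omega> and f = f, OF s])
  also have "?this \<longleftrightarrow> (\<lambda>i. h (\<tau> i \<omega>)) summable_on UNIV"
    by (intro summable_on_cong_neutral) (auto simp: h_def)
  finally have hs: "(\<lambda>i. h (\<tau> i \<omega>)) summable_on UNIV" .
  have "point_sum \<tau> {-M..M} f \<omega> = point_sum \<tau> UNIV h \<omega>"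
    unfolding point_sum_def by (intro infsum_cong_neutral) (auto simp: h_def)
  then have "noise UNIV t \<omega> - noise {-M..M} t \<omega> = point_sum \<tau> UNIV (\<lambda>u. f u + (- 1) * h u) \<omega>"
    using point_sum_linear[where \<tau> = \<tau> and \<omega> = \<omega> and D = UNIV and c = "- 1", OF s hs] by (simp add: noise_def f_def[abs_def])
  moreover have "\<bar>f u + (- 1) * h u\<bar> \<le> tail M t u" for u
    using tail_bounds(1)[of M t u] tail_bounds(3)[of M u t] by (auto simp: h_def f_def split: split_indicator)
  ultimately show ?case
    using elim(2) tail_bounds(1) by (auto intro!: abs_point_sum_le)
qed

text \<open>Truncation can alter a sign only if the full noise at that grid point is within the tail
  sum of \<alpha>. The concentration bound does not see \<alpha>, which is why the convergence is
  uniform in the level.\<close>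

lemma expected_sign_changes_truncation:
  assumes M: "M \<ge> T + 1"
  shows "\<bar>expected_sign_changes {-M..M} \<alpha> m - expected_sign_changes UNIV \<alpha> m\<bar>
    \<le> (\<Sum>k<2 ^ m. hit_const * tail_mass M (dyadic_pt a b m k)
        + hit_const * tail_mass M (dyadic_pt a b m (Suc k)))"
  unfolding expected_sign_changes_def sum_subtractf[symmetric]
proof (rule order_trans[OF sum_abs], rule sum_mono)
  fix k :: nat assume "k \<in> {..<2 ^ m}"
  define l r where "l = dyadic_pt a b m k" and "r = dyadic_pt a b m (Suc k)"
  have mem: "l \<in> {a..b}" "r \<in> {a..b}"
    using \<open>k \<in> {..<2 ^ m}\<close> unfolding l_def r_def by (auto intro!: dyadic_pt_mem[OF ab] simp del: atLeastAtMost_iff)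
  have D: "region UNIV" "region {-M..M}" using M by (simp_all add: region_UNIV region_Icc)
  have tail_meas: "point_sum \<tau> UNIV (tail M s) \<in> borel_measurable P" for s
    by (intro measurable_point_sum borel_measurable_continuous_onI continuous_tail) auto
  have "\<bar>prob (sign_change_event {-M..M} l r \<alpha>)
      - prob (sign_change_event UNIV l r \<alpha>)\<bar>
    \<le> prob (near_event UNIV l \<alpha> (point_sum \<tau> UNIV (tail M l)))
      + prob (near_event UNIV r \<alpha> (point_sum \<tau> UNIV (tail M r)))"
  proof (intro abs_prob_diff_le sign_change_sets near_sets D tail_meas)
    show "AE \<omega> in P. (\<omega> \<in> (sign_change_event {-M..M} l r \<alpha>))
        \<noteq> (\<omega> \<in> (sign_change_event UNIV l r \<alpha>)) \<longrightarrow>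
      \<omega> \<in> (near_event UNIV l \<alpha> (point_sum \<tau> UNIV (tail M l))) \<or>
      \<omega> \<in> (near_event UNIV r \<alpha> (point_sum \<tau> UNIV (tail M r)))"
      using AE_noise_truncation[of l M] AE_noise_truncation[of r M]
    proof eventually_elim
      case (elim \<omega>)
      have "(x - \<alpha>) * (y - \<alpha>) < 0 \<longleftrightarrow> (x' - \<alpha>) * (y' - \<alpha>) < 0"
        if "\<bar>x' - x\<bar> \<le> p" "\<bar>y' - y\<bar> \<le> q" "\<not> \<bar>x' - \<alpha>\<bar> \<le> p" "\<not> \<bar>y' - \<alpha>\<bar> \<le> q" for x y x' y' p q
      proof -
        have "x - \<alpha> < 0 \<longleftrightarrow> x' - \<alpha> < 0" "0 < x - \<alpha> \<longleftrightarrow> 0 < x' - \<alpha>" "y - \<alpha> < 0 \<longleftrightarrow> y' - \<alpha> < 0" "0 < y - \<alpha> \<longleftrightarrow> 0 < y' - \<alpha>"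
          using that by linarith+
        then show ?thesis unfolding mult_less_0_iff by blast
      qed
      from this[OF elim] show ?case by blast
    qed
  qed
  also have "\<dots> \<le> hit_const * (0 + (tail_mass M l)) + hit_const * (0 + (tail_mass M r))"
    using mem M by (intro add_mono hit_bound D admissible_tail)
  finally show "\<bar>prob (sign_change_event {-M..M} (dyadic_pt a b m k) (dyadic_pt a b m (Suc k)) \<alpha>)
      - prob (sign_change_event UNIV (dyadic_pt a b m k) (dyadic_pt a b m (Suc k)) \<alpha>)\<bar>
    \<le> hit_const * tail_mass M (dyadic_pt a b m k) + hit_const * tail_mass M (dyadic_pt a b m (Suc k))"
    by (simp add: l_def r_def)
qed

text \<open>The error \<open>L / 2 ^ m\<close> is common to all levels and regions. Continuity is
  therefore inherited by uniform limits, and the convergence in \<open>M\<close> splits into three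
  errors: \<open>m\<close> is fixed by the grid errors before \<open>M\<close> is taken large for
  that grid.\<close>

lemma expected_crossings_finite_continuous:
  assumes D: "region D"
  shows "expected_crossings D \<alpha> < \<infinity>" and "continuous_on UNIV (\<lambda>\<alpha>. enn2real (expected_crossings D \<alpha>))"
    and "uniform_limit UNIV (\<lambda>M \<alpha>. enn2real (expected_crossings {-M..M} \<alpha>)) (\<lambda>\<alpha>. enn2real (expected_crossings UNIV \<alpha>)) at_top"
proof -
  define e where "e D \<alpha> = enn2real (expected_crossings D \<alpha>)" for D \<alpha>
  obtain L where L: "L \<ge> 0" "\<And>D \<alpha> m. region D \<Longrightarrow> ennreal (expected_sign_changes D \<alpha> m) \<le> expected_crossings D \<alpha>"
     "\<And>D \<alpha> m. region D \<Longrightarrow> expected_crossings D \<alpha> \<le> ennreal (expected_sign_changes D \<alpha> m + L / 2 ^ m)"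
    using crossings_approx by blast
  have fin: "expected_crossings D \<alpha> < \<infinity>" if "region D" for D \<alpha>
    using le_less_trans[OF L(3)[OF that, of \<alpha> 0]] by simp
  show "expected_crossings D \<alpha> < \<infinity>" by (rule fin[OF D])
  have near: "\<bar>expected_sign_changes D \<alpha> m - e D \<alpha>\<bar> \<le> L / 2 ^ m" if "region D" for D \<alpha> m
  proof -
    have nonneg: "expected_sign_changes D \<alpha> m \<ge> 0" unfolding expected_sign_changes_def by (intro sum_nonneg) simp
    have eq: "expected_crossings D \<alpha> = ennreal (e D \<alpha>)" using fin[OF that] by (simp add: e_def)
    have e: "e D \<alpha> \<ge> 0" by (simp add: e_def)
    have "expected_sign_changes D \<alpha> m \<le> e D \<alpha>"
      using L(2)[OF that, of \<alpha> m] e by (simp only: eq ennreal_le_iff)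
    moreover have "e D \<alpha> \<le> expected_sign_changes D \<alpha> m + L / 2 ^ m"
    proof -
      have "0 \<le> expected_sign_changes D \<alpha> m + L / 2 ^ m" using nonneg L(1) by simp
      then show ?thesis using L(3)[OF that, of \<alpha> m] by (simp only: eq ennreal_le_iff)
    qed
    ultimately show ?thesis by linarith
  qed
  have small: "\<forall>\<^sub>F m in sequentially. L / 2 ^ m < \<epsilon>" if "\<epsilon> > 0" for \<epsilon>
  proof -
    have "(\<lambda>m. L / 2 ^ m) \<longlonglongrightarrow> 0" by real_asymp
    then show ?thesis using that by (rule order_tendstoD)
  qed
  show "continuous_on UNIV (\<lambda>\<alpha>. enn2real (expected_crossings D \<alpha>))"
  proof (rule uniform_limit_theorem)
    show "\<forall>\<^sub>F m in sequentially. continuous_on UNIV (\<lambda>\<alpha>. expected_sign_changes D \<alpha> m)"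
    proof (intro always_eventually allI)
      fix m
      have "(2 ^ m * (6 * hit_const))-lipschitz_on UNIV (\<lambda>\<alpha>. expected_sign_changes D \<alpha> m)"
        using expected_sign_changes_lipschitz[OF D] hit_const_nonneg
        by (intro lipschitz_onI) (auto simp: dist_real_def)
      then show "continuous_on UNIV (\<lambda>\<alpha>. expected_sign_changes D \<alpha> m)" by (rule lipschitz_on_continuous_on)
    qed
    show "uniform_limit UNIV (\<lambda>m \<alpha>. expected_sign_changes D \<alpha> m) (\<lambda>\<alpha>. enn2real (expected_crossings D \<alpha>)) sequentially"
    proof (rule uniform_limitI)
      fix \<epsilon> :: real assume "\<epsilon> > 0"
      from small[OF this] show "\<forall>\<^sub>F m in sequentially. \<forall>\<alpha>\<in>UNIV. dist (expected_sign_changes D \<alpha> m) (enn2real (expected_crossings D \<alpha>)) < \<epsilon>"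
        by eventually_elim (use near[OF D] in \<open>auto simp: dist_real_def e_def intro: le_less_trans\<close>)
    qed
  qed simp
  show "uniform_limit UNIV (\<lambda>M \<alpha>. enn2real (expected_crossings {-M..M} \<alpha>)) (\<lambda>\<alpha>. enn2real (expected_crossings UNIV \<alpha>)) at_top"
  proof (rule uniform_limitI)
    fix \<epsilon> :: real assume "\<epsilon> > 0"
    then obtain m where m: "L / 2 ^ m < \<epsilon> / 3" using eventually_happens[OF small[of "\<epsilon> / 3"]] by auto
    define R where "R M = (\<Sum>k<2 ^ m. hit_const * tail_mass M (dyadic_pt a b m k)
        + hit_const * tail_mass M (dyadic_pt a b m (Suc k)))" for M
    have "(R \<longlongrightarrow> (\<Sum>k\<in>{..<2 ^ m :: nat}. hit_const * 0 + hit_const * 0)) at_top"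
      unfolding R_def by (intro tendsto_intros integral_tail_tendsto)
    then have "\<forall>\<^sub>F M in at_top. R M < \<epsilon> / 3" using \<open>\<epsilon> > 0\<close> by (intro order_tendstoD) auto
    then show "\<forall>\<^sub>F M in at_top. \<forall>\<alpha>\<in>UNIV. dist (enn2real (expected_crossings {-M..M} \<alpha>)) (enn2real (expected_crossings UNIV \<alpha>)) < \<epsilon>"
      using eventually_ge_at_top[of "T + 1"]
    proof eventually_elim
      case (elim M)
      have D: "region UNIV" "region {-M..M}" using elim(2) by (simp_all add: region_UNIV region_Icc)
      have "\<bar>e {-M..M} \<alpha> - e UNIV \<alpha>\<bar> < \<epsilon>" for \<alpha>
        using near[OF D(1), of \<alpha> m] near[OF D(2), of \<alpha> m] expected_sign_changes_truncation[OF elim(2), of \<alpha> m] elim(1) m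
        unfolding R_def[symmetric] by linarith
      then show ?case by (simp add: dist_real_def e_def)
    qed
  qed
qed

lemma prob_many_pos: "prob many > 0"
proof -
  have "prob {\<omega> \<in> space P. point_count \<tau> {-T..T} \<omega> = k0} > 0"
    using T_pos rate_pos by (subst poisson_count) (auto simp: emeasure_lborel_Icc_eq)
  also have "prob {\<omega> \<in> space P. point_count \<tau> {-T..T} \<omega> = k0} \<le> prob many"
    by (rule finite_measure_mono[OF _ many_sets]) (auto simp: many_def)
  finally show ?thesis .
qed

end

section \<open>From smoothness and invertibility to the window setting\<close>

lemma class_C_deriv:
  assumes "class_C n f" "j < n"
  shows "((deriv ^^ j) f has_real_derivative (deriv ^^ Suc j) f x) (at x)"
  using assms by (simp add: class_C_def DERIV_deriv_iff_real_differentiable)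

lemma det_\<Phi>: "det (\<Phi> g s) = deriv g s * (deriv ^^ 3) g s - (deriv ^^ 2) g s * (deriv ^^ 2) g s"
  by (simp add: det_2 \<Phi>_def)

theorem theorem2:
  fixes P :: "'w measure" and rate :: real and \<tau> :: "'i::countable \<Rightarrow> 'w \<Rightarrow> real"
    and g :: "real \<Rightarrow> real" and T a b :: real and k0 :: nat
    and E_M :: "real \<Rightarrow> real \<Rightarrow> ennreal" and E_X :: "real \<Rightarrow> ennreal"
  assumes "homogeneous_poisson_process P rate \<tau>"
    and "class_C 4 g"
    and "integrable lborel g"
    and "integrable lborel (deriv g)"
    and "integrable lborel ((deriv ^^ 2) g)"
    and "T > 0" and "a \<le> b"
    and "\<And>s. s \<in> {- T + a..T + b} \<Longrightarrow> invertible (\<Phi> g s) \<and> invertible (\<Phi>' g s)"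
    and "k0 \<ge> 8"
  defines "E_M \<equiv> \<lambda>M \<alpha>. cond_nn_expectation P
             (\<lambda>\<omega>. crossings (truncated_shot_noise g \<tau> M \<omega>) \<alpha> {a..b})
             {\<omega> \<in> space P. point_count \<tau> {- T..T} \<omega> \<ge> k0}"
    and "E_X \<equiv> \<lambda>\<alpha>. cond_nn_expectation P
             (\<lambda>\<omega>. crossings (shot_noise g \<tau> \<omega>) \<alpha> {a..b})
             {\<omega> \<in> space P. point_count \<tau> {- T..T} \<omega> \<ge> k0}"
  shows "(\<forall>M\<ge>T. (\<forall>\<alpha>. E_M M \<alpha> < \<infinity>) \<and> continuous_on UNIV (\<lambda>\<alpha>. enn2real (E_M M \<alpha>)))
       \<and> (\<forall>\<alpha>. E_X \<alpha> < \<infinity>)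
       \<and> uniform_limit UNIV (\<lambda>M \<alpha>. enn2real (E_M M \<alpha>)) (\<lambda>\<alpha>. enn2real (E_X \<alpha>)) at_top"
proof -
  note smooth = class_C_deriv[OF assms(2)]
  interpret shot_noise_window P rate \<tau> g "deriv g" "(deriv ^^ 2) g" T a b k0
  proof (intro shot_noise_window.intro shot_noise_window_axioms.intro)
    show "(g has_real_derivative deriv g x) (at x)" for x using smooth[of 0 x] by simp
    show "(deriv g has_real_derivative (deriv ^^ 2) g x) (at x)" for x using smooth[of 1 x] by (simp add: numeral_2_eq_2)
    show "continuous_on UNIV ((deriv ^^ 2) g)" by (rule DERIV_continuous_on[OF smooth]) simp
    show "deriv g s \<noteq> 0 \<or> (deriv ^^ 2) g s \<noteq> 0" if "s \<in> {a - T..b + T}" for s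
    proof -
      have "invertible (\<Phi> g s)" using assms(8)[of s] that by auto
      \<comment> \<open>If the first two derivatives vanished together, the first row of the matrix
        would be zero.\<close>
      then have "det (\<Phi> g s) \<noteq> 0" by (simp add: invertible_det_nz)
      then show ?thesis by (auto simp: det_\<Phi>)
    qed
  qed (use assms in auto)
  define p where "p = prob many"
  have p: "p > 0" "emeasure P many = ennreal p" using prob_many_pos by (simp_all add: p_def emeasure_eq_measure)
  have "truncated_shot_noise g \<tau> M \<omega> = (\<lambda>t. noise {-M..M} t \<omega>)" for M \<omega>
    by (auto simp: truncated_shot_noise_def noise_def point_sum_def abs_le_iff fun_eq_iff minus_le_iff conj_commute)
  then have E_M: "E_M M \<alpha> = expected_crossings {-M..M} \<alpha> / ennreal p" for M \<alpha>
    unfolding E_M_def cond_nn_expectation_def expected_crossings_def p(2)[symmetric] many_def by simp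
  have "shot_noise g \<tau> \<omega> = (\<lambda>t. noise UNIV t \<omega>)" for \<omega>
    by (simp add: shot_noise_def noise_def point_sum_def fun_eq_iff)
  then have E_X: "E_X \<alpha> = expected_crossings UNIV \<alpha> / ennreal p" for \<alpha>
    unfolding E_X_def cond_nn_expectation_def expected_crossings_def p(2)[symmetric] many_def by simp
  \<comment> \<open>Conditioning is division by a fixed positive probability, so it acts on the real
    values as a scaling. Finiteness is carried along because \<open>enn2real\<close> sends infinity
    to 0.\<close>
  have quot: "x / ennreal p < \<infinity> \<and> enn2real (x / ennreal p) = inverse p * enn2real x" if "x < \<infinity>" for x
    using that p(1) by (cases x) (auto simp: divide_ennreal field_simps)
  note region = region_UNIV region_Icc
  note ec = expected_crossings_finite_continuous
  have "continuous_on UNIV (\<lambda>\<alpha>. enn2real (E_M M \<alpha>))" if "M \<ge> T" for M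
    unfolding E_M using quot[OF ec(1)[OF region(2)[OF that]]] ec(2)[OF region(2)[OF that]]
    by (simp add: continuous_on_mult_left)
  moreover have "uniform_limit UNIV (\<lambda>M \<alpha>. enn2real (E_M M \<alpha>)) (\<lambda>\<alpha>. enn2real (E_X \<alpha>)) at_top"
  proof (rule uniform_limit_cong[THEN iffD2])
    show "uniform_limit UNIV (\<lambda>M \<alpha>. inverse p * enn2real (expected_crossings {-M..M} \<alpha>))
        (\<lambda>\<alpha>. inverse p * enn2real (expected_crossings UNIV \<alpha>)) at_top"
      by (rule bounded_linear.uniform_limit[OF bounded_linear_mult_right ec(3)[OF region(1)]])
    show "\<forall>\<^sub>F M in at_top. \<forall>\<alpha>\<in>UNIV. enn2real (E_M M \<alpha>) = inverse p * enn2real (expected_crossings {-M..M} \<alpha>)"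
      using eventually_ge_at_top[of T] by eventually_elim (simp add: E_M quot[OF ec(1)[OF region(2)]])
  qed (simp add: E_X quot[OF ec(1)[OF region(1)]])
  ultimately show ?thesis
    using quot[OF ec(1)[OF region(1)]] quot[OF ec(1)[OF region(2)]] by (auto simp: E_M E_X)
qed

end
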